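(* Let $S\geq R$ be an excellent ring extension of Artin algebras and let $n\in\mathbb{N}$. Then $R$ is $n$-syzygy finite if and only if $S$ is $n$-syzygy finite.
   Context: All rings are Artin $k$-algebras with unit, where $k$ is a fixed commutative Artin ring, and all modules are finitely generated left modules unless otherwise indicated. $\mathbb{N}$ is the set of non-negative integers. For an Artin algebra $A$, $A\text{-}\mathrm{mod}$ is the category of finitely generated left $A$-modules. Syzygies. For $n\geq 1$ and $M\in A\text{-}\mathrm{mod}$, a module $K$ is an $n$-th syzygy module of $M$ if there is an exact sequence $\cdots\to P_n\to P_{n-1}\to\cdots\to P_0\to M\to 0$ in $A\text{-}\mathrm{mod}$ with all $P_i$ projective and $K\cong\mathrm{Im}(P_n\to P_{n-1})$; the $0$-th syzygy of $M$ is $M$ (up to isomorphism). $\Omega^n(A\text{-}\mathrm{mod})$ is the full subcategory of $A\text{-}\mathrm{mod}$ of all $n$-th syzygy modules, and $\Omega^0(A\text{-}\mathrm{mod})=A\text{-}\mathrm{mod}$. The algebra $A$ is $n$-syzygy finite if the number of non-isomorphic indecomposable objects in $\Omega^n(A\text{-}\mathrm{mod})$ is finite. Excellent extension. If $R$ is a subring of $S$ with the same unit, one writes $S\geq R$ (a ring extension). It is an excellent extension if: (1) for every $S$-module $M$ and $S$-submodule $N$ of $M$, if $N$ is a direct summand of $M$ as an $R$-module, then $N$ is a direct summand of $M$ as an $S$-module; (2) there is a finite set $\{s_1,\dots,s_m\}\subseteq S$ with $S=\sum_{j=1}^m Rs_j$; (3) ${}_RS$ and $S_R$ are free with common basis $\{s_1,\dots,s_m\}$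 such that $Rs_j=s_jR$ for $1\leq j\leq m$.
   Formalization: "n-syzygy finite" here counts the indecomposable direct summands of n-th syzygy modules, not only indecomposables that are n-th syzygies themselves; with the latter reading the claim fails for n = 2 (a skew group algebra by Z/2), while for n ≤ 1 both readings agree. *)

theory Defs
  imports "HOL-Algebra.Algebra"
begin

section \<open>Finitely generated left modules over a ring\<close>

text \<open>The library locale \<^locale>\<open>module\<close> requires a commutative ring of scalars; the axioms below are
  the same over an arbitrary ring. Multiplication and one of the record \<open>M\<close> play no role.\<close>

locale left_module = R?: ring R + M?: abelian_group M
  for R :: "('a, 'r) ring_scheme" (structure) and M :: "('a, 'c, 'm) module_scheme" (structure) +
  assumes smult_closed:
      "\<lbrakk>a \<in> carrier R; x \<in> carrier M\<rbrakk> \<Longrightarrow> a \<odot>\<^bsub>M\<^esub> x \<in> carrier M"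
    and smult_l_distr:
      "\<lbrakk>a \<in> carrier R; b \<in> carrier R; x \<in> carrier M\<rbrakk>
        \<Longrightarrow> (a \<oplus> b) \<odot>\<^bsub>M\<^esub> x = a \<odot>\<^bsub>M\<^esub> x \<oplus>\<^bsub>M\<^esub> b \<odot>\<^bsub>M\<^esub> x"
    and smult_r_distr:
      "\<lbrakk>a \<in> carrier R; x \<in> carrier M; y \<in> carrier M\<rbrakk>
        \<Longrightarrow> a \<odot>\<^bsub>M\<^esub> (x \<oplus>\<^bsub>M\<^esub> y) = a \<odot>\<^bsub>M\<^esub> x \<oplus>\<^bsub>M\<^esub> a \<odot>\<^bsub>M\<^esub> y"
    and smult_assoc:
      "\<lbrakk>a \<in> carrier R; b \<in> carrier R; x \<in> carrier M\<rbrakk>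
        \<Longrightarrow> (a \<otimes> b) \<odot>\<^bsub>M\<^esub> x = a \<odot>\<^bsub>M\<^esub> (b \<odot>\<^bsub>M\<^esub> x)"
    and smult_one: "x \<in> carrier M \<Longrightarrow> \<one> \<odot>\<^bsub>M\<^esub> x = x"

definition fg_module :: "('a, 'r) ring_scheme \<Rightarrow> ('a, 'c) module \<Rightarrow> bool" where
  "fg_module A M \<longleftrightarrow> left_module A M \<and>
     (\<exists>G. finite G \<and> G \<subseteq> carrier M \<and>
        carrier M = {(\<Oplus>\<^bsub>M\<^esub>g\<in>G. c g \<odot>\<^bsub>M\<^esub> g) | c. c \<in> G \<rightarrow> carrier A})"

definition module_hom ::
  "('a, 'r) ring_scheme \<Rightarrow> ('a, 'c) module \<Rightarrow> ('a, 'd) module \<Rightarrow> ('c \<Rightarrow> 'd) set" where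
  "module_hom A M N = {f \<in> carrier M \<rightarrow> carrier N.
     (\<forall>x\<in>carrier M. \<forall>y\<in>carrier M. f (x \<oplus>\<^bsub>M\<^esub> y) = f x \<oplus>\<^bsub>N\<^esub> f y) \<and>
     (\<forall>a\<in>carrier A. \<forall>x\<in>carrier M. f (a \<odot>\<^bsub>M\<^esub> x) = a \<odot>\<^bsub>N\<^esub> f x)}"

definition module_iso ::
  "('a, 'r) ring_scheme \<Rightarrow> ('a, 'c) module \<Rightarrow> ('a, 'd) module \<Rightarrow> bool" where
  "module_iso A M N \<longleftrightarrow> (\<exists>f\<in>module_hom A M N. bij_betw f (carrier M) (carrier N))"

definition direct_sum_of ::
  "('a, 'r) ring_scheme \<Rightarrow> ('a, 'c) module \<Rightarrow> 'c set \<Rightarrow> 'c set \<Rightarrow> bool" where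
  "direct_sum_of A M N N' \<longleftrightarrow> submodule N A M \<and> submodule N' A M \<and>
     N \<inter> N' = {\<zero>\<^bsub>M\<^esub>} \<and> N <+>\<^bsub>M\<^esub> N' = carrier M"

definition direct_summand ::
  "('a, 'r) ring_scheme \<Rightarrow> ('a, 'c) module \<Rightarrow> 'c set \<Rightarrow> bool" where
  "direct_summand A M N \<longleftrightarrow> (\<exists>N'. direct_sum_of A M N N')"

definition indecomposable_module :: "('a, 'r) ring_scheme \<Rightarrow> ('a, 'c) module \<Rightarrow> bool" where
  "indecomposable_module A M \<longleftrightarrow> carrier M \<noteq> {\<zero>\<^bsub>M\<^esub>} \<and>
     (\<forall>N N'. direct_sum_of A M N N' \<longrightarrow> N = {\<zero>\<^bsub>M\<^esub>} \<or> N' = {\<zero>\<^bsub>M\<^esub>})"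

text \<open>HOL cannot quantify over modules on all types inside a definition. Quantification over
  \<open>A\<close>-mod is over finitely generated modules with elements in \<^typ>\<open>nat \<Rightarrow> 'a\<close>, where \<^typ>\<open>'a\<close> is the
  type of elements of \<open>A\<close>. Up to isomorphism these are all finitely generated modules
  (\<open>fg_module_copy\<close> below).\<close>

type_synonym 'a umodule = "('a, nat \<Rightarrow> 'a) module"

lemma module_hom_finsum:
  assumes "left_module A M" "left_module A N" "f \<in> module_hom A M N"
    and "finite G" "h \<in> G \<rightarrow> carrier M"
  shows "f (finsum M h G) = finsum N (\<lambda>g. f (h g)) G"
proof -
  interpret M: left_module A M by fact
  interpret N: left_module A N by fact
  have f: "f \<in> carrier M \<rightarrow> carrier N"
    and add: "\<And>x y. x \<in> carrier M \<Longrightarrow> y \<in> carrier M \<Longrightarrow> f (x \<oplus>\<^bsub>M\<^esub> y) = f x \<oplus>\<^bsub>N\<^esub> f y"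
    using assms(3) by (auto simp: module_hom_def)
  have "f \<zero>\<^bsub>M\<^esub> \<oplus>\<^bsub>N\<^esub> f \<zero>\<^bsub>M\<^esub> = f \<zero>\<^bsub>M\<^esub>"
    using add[of "\<zero>\<^bsub>M\<^esub>" "\<zero>\<^bsub>M\<^esub>"] by simp
  moreover have "f \<zero>\<^bsub>M\<^esub> \<in> carrier N"
    using f by auto
  ultimately have zero: "f \<zero>\<^bsub>M\<^esub> = \<zero>\<^bsub>N\<^esub>"
    by (metis N.M.add.l_cancel_one)
  show ?thesis
    using assms(4,5)
  proof (induction G rule: finite_induct)
    case (insert x F)
    then have "h x \<in> carrier M" "h \<in> F \<rightarrow> carrier M" by auto
    moreover have "(\<lambda>g. f (h g)) \<in> F \<rightarrow> carrier N" "f (h x) \<in> carrier N"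
      using f insert.prems by (auto simp: Pi_iff)
    ultimately show ?case
      using insert by (simp add: add)
  qed (simp add: zero)
qed

lemma fg_module_copy:
  fixes A :: "('a, 'r) ring_scheme" and M :: "('a, 'c) module"
  assumes "fg_module A M"
  shows "\<exists>M' :: 'a umodule. fg_module A M' \<and> module_iso A M M'"
proof -
  interpret M: left_module A M using assms by (simp add: fg_module_def)
  obtain G where G: "finite G" "G \<subseteq> carrier M"
    and gen: "carrier M = {(\<Oplus>\<^bsub>M\<^esub>g\<in>G. c g \<odot>\<^bsub>M\<^esub> g) | c. c \<in> G \<rightarrow> carrier A}"
    using assms by (auto simp: fg_module_def)
  obtain e :: "'c \<Rightarrow> nat" where e: "inj_on e G"
    using finite_imp_inj_to_nat_seg[OF G(1)] by blast
  have "\<exists>u :: nat \<Rightarrow> 'a. x = (\<Oplus>\<^bsub>M\<^esub>g\<in>G. u (e g) \<odot>\<^bsub>M\<^esub> g)" if "x \<in> carrier M" for x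
  proof -
    from that gen obtain c where c: "c \<in> G \<rightarrow> carrier A" "x = (\<Oplus>\<^bsub>M\<^esub>g\<in>G. c g \<odot>\<^bsub>M\<^esub> g)"
      by blast
    have "(\<Oplus>\<^bsub>M\<^esub>g\<in>G. c g \<odot>\<^bsub>M\<^esub> g) = (\<Oplus>\<^bsub>M\<^esub>g\<in>G. (c \<circ> the_inv_into G e) (e g) \<odot>\<^bsub>M\<^esub> g)"
      using c G e
      by (intro M.M.finsum_cong') (auto intro!: M.smult_closed simp: the_inv_into_f_f Pi_iff)
    with c show ?thesis by blast
  qed
  then obtain u :: "'c \<Rightarrow> nat \<Rightarrow> 'a"
    where u: "\<And>x. x \<in> carrier M \<Longrightarrow> x = (\<Oplus>\<^bsub>M\<^esub>g\<in>G. u x (e g) \<odot>\<^bsub>M\<^esub> g)"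
    by metis
  have inj: "inj_on u (carrier M)"
    by (rule inj_onI) (metis u)
  define v where "v = the_inv_into (carrier M) u"
  have vu: "\<And>x. x \<in> carrier M \<Longrightarrow> v (u x) = x"
    using inj by (simp add: v_def the_inv_into_f_f)
  define M' :: "'a umodule" where
    "M' = \<lparr>carrier = u ` carrier M, monoid.mult = undefined, one = undefined, ring.zero = u \<zero>\<^bsub>M\<^esub>,
           ring.add = (\<lambda>x y. u (v x \<oplus>\<^bsub>M\<^esub> v y)), smult = (\<lambda>a x. u (a \<odot>\<^bsub>M\<^esub> v x))\<rparr>"
  have "abelian_group M'"
  proof (rule abelian_groupI)
    fix x assume "x \<in> carrier M'"
    then obtain m where "m \<in> carrier M" "x = u m" by (auto simp: M'_def)
    then show "\<exists>y\<in>carrier M'. y \<oplus>\<^bsub>M'\<^esub> x = \<zero>\<^bsub>M'\<^esub>"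
      by (intro bexI[of _ "u (\<ominus>\<^bsub>M\<^esub> m)"]) (auto simp: M'_def vu M.M.l_neg)
  qed (auto simp: M'_def vu M.M.a_ac)
  then have lm: "left_module A M'"
    by (intro left_module.intro left_module_axioms.intro M.R.ring_axioms)
      (auto simp: M'_def vu M.smult_closed M.smult_l_distr M.smult_r_distr M.smult_assoc M.smult_one)
  have hom: "u \<in> module_hom A M M'"
    by (auto simp: module_hom_def M'_def vu)
  have fin: "(\<Oplus>\<^bsub>M'\<^esub>g\<in>u ` G. c g \<odot>\<^bsub>M'\<^esub> g) = u (\<Oplus>\<^bsub>M\<^esub>g\<in>G. c (u g) \<odot>\<^bsub>M\<^esub> g)"
    if c: "c \<in> u ` G \<rightarrow> carrier A" for c
  proof -
    interpret M': left_module A M' by fact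
    have GM: "\<And>g. g \<in> G \<Longrightarrow> g \<in> carrier M" using G by auto
    have uM: "\<And>g. g \<in> G \<Longrightarrow> u g \<in> carrier M'" using GM by (auto simp: M'_def)
    have "(\<Oplus>\<^bsub>M'\<^esub>g\<in>u ` G. c g \<odot>\<^bsub>M'\<^esub> g) = (\<Oplus>\<^bsub>M'\<^esub>g\<in>G. c (u g) \<odot>\<^bsub>M'\<^esub> u g)"
      using c uM inj_on_subset[OF inj G(2)]
      by (intro M'.M.finsum_reindex) (auto intro!: M'.smult_closed)
    also have "\<dots> = (\<Oplus>\<^bsub>M'\<^esub>g\<in>G. u (c (u g) \<odot>\<^bsub>M\<^esub> g))"
      using c GM vu by (intro M'.M.finsum_cong') (auto simp: M'_def intro!: M.smult_closed)
    also have "\<dots> = u (\<Oplus>\<^bsub>M\<^esub>g\<in>G. c (u g) \<odot>\<^bsub>M\<^esub> g)"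
      using c GM G(1)
      by (intro module_hom_finsum[OF M.left_module_axioms lm hom, symmetric])
        (auto intro!: M.smult_closed)
    finally show ?thesis .
  qed
  have "carrier M' = {(\<Oplus>\<^bsub>M'\<^esub>g\<in>u ` G. c g \<odot>\<^bsub>M'\<^esub> g) | c. c \<in> u ` G \<rightarrow> carrier A}"
    (is "_ = ?X")
  proof (intro equalityI subsetI)
    fix y assume "y \<in> carrier M'"
    then obtain x where x: "x \<in> carrier M" "y = u x" by (auto simp: M'_def)
    then obtain c where c: "c \<in> G \<rightarrow> carrier A" "x = (\<Oplus>\<^bsub>M\<^esub>g\<in>G. c g \<odot>\<^bsub>M\<^esub> g)"
      using gen by blast
    have vG: "\<And>g. g \<in> G \<Longrightarrow> v (u g) = g" using G vu by auto
    have cv: "c \<circ> v \<in> u ` G \<rightarrow> carrier A" using c vG by auto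
    have "y = (\<Oplus>\<^bsub>M'\<^esub>g\<in>u ` G. (c \<circ> v) g \<odot>\<^bsub>M'\<^esub> g)"
    proof -
      have "(\<Oplus>\<^bsub>M\<^esub>g\<in>G. (c \<circ> v) (u g) \<odot>\<^bsub>M\<^esub> g) = x"
        unfolding c(2) using c(1) G vG
        by (intro M.M.finsum_cong') (auto intro!: M.smult_closed)
      then show ?thesis using fin[OF cv] x by simp
    qed
    with cv show "y \<in> ?X" by blast
  next
    fix y assume "y \<in> ?X"
    then obtain c where c: "c \<in> u ` G \<rightarrow> carrier A" "y = (\<Oplus>\<^bsub>M'\<^esub>g\<in>u ` G. c g \<odot>\<^bsub>M'\<^esub> g)"
      by blast
    have "(\<Oplus>\<^bsub>M\<^esub>g\<in>G. c (u g) \<odot>\<^bsub>M\<^esub> g) \<in> carrier M"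
      using c(1) G by (intro M.M.finsum_closed) (auto intro!: M.smult_closed)
    then show "y \<in> carrier M'" using c fin by (simp add: M'_def)
  qed
  moreover have "finite (u ` G)" "u ` G \<subseteq> carrier M'"
    using G by (auto simp: M'_def)
  ultimately have "fg_module A M'"
    using lm unfolding fg_module_def by blast
  moreover have "bij_betw u (carrier M) (carrier M')"
    using inj by (simp add: bij_betw_def M'_def)
  ultimately show ?thesis
    using hom unfolding module_iso_def by blast
qed

section \<open>Syzygies\<close>

definition projective_module :: "('a, 'r) ring_scheme \<Rightarrow> ('a, 'c) module \<Rightarrow> bool" where
  "projective_module A P \<longleftrightarrow> fg_module A P \<and>
     (\<forall>(M :: 'a umodule) (N :: 'a umodule) g f.
        fg_module A M \<and> fg_module A N \<and> g \<in> module_hom A M N \<and> g ` carrier M = carrier N \<and>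
        f \<in> module_hom A P N \<longrightarrow>
        (\<exists>h\<in>module_hom A P M. \<forall>x\<in>carrier P. g (h x) = f x))"

text \<open>An exact sequence \<open>\<dots> \<rightarrow> P 1 \<rightarrow> P 0 \<rightarrow> M \<rightarrow> 0\<close> with \<open>d i : P (Suc i) \<rightarrow> P i\<close> and augmentation
  \<open>\<epsilon> : P 0 \<rightarrow> M\<close>.\<close>

definition projective_resolution ::
  "('a, 'r) ring_scheme \<Rightarrow> (nat \<Rightarrow> 'a umodule) \<Rightarrow> (nat \<Rightarrow> (nat \<Rightarrow> 'a) \<Rightarrow> (nat \<Rightarrow> 'a))
     \<Rightarrow> ((nat \<Rightarrow> 'a) \<Rightarrow> 'c) \<Rightarrow> ('a, 'c) module \<Rightarrow> bool" where
  "projective_resolution A P d \<epsilon> M \<longleftrightarrow>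
     (\<forall>i. projective_module A (P i)) \<and>
     (\<forall>i. d i \<in> module_hom A (P (Suc i)) (P i)) \<and>
     \<epsilon> \<in> module_hom A (P 0) M \<and> \<epsilon> ` carrier (P 0) = carrier M \<and>
     d 0 ` carrier (P 1) = {x \<in> carrier (P 0). \<epsilon> x = \<zero>\<^bsub>M\<^esub>} \<and>
     (\<forall>i. d (Suc i) ` carrier (P (Suc (Suc i))) = {x \<in> carrier (P (Suc i)). d i x = \<zero>\<^bsub>P i\<^esub>})"

text \<open>Here \<open>d m : P (Suc m) \<rightarrow> P m\<close>, so for \<open>n = Suc m\<close> its image is \<open>Im (P n \<rightarrow> P (n - 1))\<close>.\<close>

definition nth_syzygy ::
  "('a, 'r) ring_scheme \<Rightarrow> nat \<Rightarrow> ('a, 'c) module \<Rightarrow> ('a, 'd) module \<Rightarrow> bool" where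
  "nth_syzygy A n M K \<longleftrightarrow>
     (case n of
        0 \<Rightarrow> module_iso A K M
      | Suc m \<Rightarrow> (\<exists>P d \<epsilon>. projective_resolution A P d \<epsilon> M \<and>
                   module_iso A K (P m\<lparr>carrier := d m ` carrier (P (Suc m))\<rparr>)))"

definition Omega :: "('a, 'r) ring_scheme \<Rightarrow> nat \<Rightarrow> 'a umodule set" where
  "Omega A n = {K. fg_module A K \<and> (\<exists>M :: 'a umodule. fg_module A M \<and> nth_syzygy A n M K)}"

text \<open>For \<open>n \<ge> 2\<close>, \<open>\<Omega>\<^sup>n(A-mod)\<close> need not be closed under direct summands: over the local algebra
  \<open>k[x,y]/(x,y)\<^sup>2\<close> the module \<open>k \<oplus> k\<close> is a second syzygy, but \<open>k\<close> is not. As usual for syzygy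
  finiteness (\<open>\<Omega>\<^sup>n(A-mod) \<subseteq> add M\<close> for some finitely generated \<open>M\<close>), the indecomposables counted
  are the indecomposable modules into which the objects of \<open>\<Omega>\<^sup>n(A-mod)\<close> decompose.\<close>

definition Omega_indecomposables :: "('a, 'r) ring_scheme \<Rightarrow> nat \<Rightarrow> 'a umodule set" where
  "Omega_indecomposables A n = {L. fg_module A L \<and> indecomposable_module A L \<and>
     (\<exists>K\<in>Omega A n. \<exists>N. direct_summand A K N \<and> module_iso A L (K\<lparr>carrier := N\<rparr>))}"

definition syzygy_finite :: "('a, 'r) ring_scheme \<Rightarrow> nat \<Rightarrow> bool" where
  "syzygy_finite A n \<longleftrightarrow>
     finite (Omega_indecomposables A n //
       {(L, L'). L \<in> Omega_indecomposables A n \<and> L' \<in> Omega_indecomposables A n \<and> module_iso A L L'})"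

section \<open>Artin algebras and excellent extensions\<close>

definition comm_artin_ring :: "('k, 'r) ring_scheme \<Rightarrow> bool" where
  "comm_artin_ring k \<longleftrightarrow> cring k \<and>
     (\<forall>I :: nat \<Rightarrow> 'k set. (\<forall>i. ideal (I i) k \<and> I (Suc i) \<subseteq> I i) \<longrightarrow> (\<exists>n. \<forall>i\<ge>n. I i = I n))"

text \<open>The algebra structure on \<open>A\<close> is given by a ring homomorphism \<open>\<phi>\<close> from \<open>k\<close> to the centre of
  \<open>A\<close>; the last conjunct says that \<open>A\<close> is finitely generated as a \<open>k\<close>-module.\<close>

definition artin_algebra ::
  "('k, 'q) ring_scheme \<Rightarrow> ('a, 'r) ring_scheme \<Rightarrow> ('k \<Rightarrow> 'a) \<Rightarrow> bool" where
  "artin_algebra k A \<phi> \<longleftrightarrow> comm_artin_ring k \<and> ring A \<and> \<phi> \<in> ring_hom k A \<and>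
     (\<forall>r\<in>carrier k. \<forall>x\<in>carrier A. \<phi> r \<otimes>\<^bsub>A\<^esub> x = x \<otimes>\<^bsub>A\<^esub> \<phi> r) \<and>
     (\<exists>G. finite G \<and> G \<subseteq> carrier A \<and>
        carrier A = {(\<Oplus>\<^bsub>A\<^esub>g\<in>G. \<phi> (c g) \<otimes>\<^bsub>A\<^esub> g) | c. c \<in> G \<rightarrow> carrier k})"

definition left_basis :: "('a, 'r) ring_scheme \<Rightarrow> 'a set \<Rightarrow> 'a set \<Rightarrow> bool" where
  "left_basis S R B \<longleftrightarrow>
     carrier S = {(\<Oplus>\<^bsub>S\<^esub>b\<in>B. c b \<otimes>\<^bsub>S\<^esub> b) | c. c \<in> B \<rightarrow> R} \<and>
     (\<forall>c. c \<in> B \<rightarrow> R \<and> (\<Oplus>\<^bsub>S\<^esub>b\<in>B. c b \<otimes>\<^bsub>S\<^esub> b) = \<zero>\<^bsub>S\<^esub> \<longrightarrow> (\<forall>b\<in>B. c b = \<zero>\<^bsub>S\<^esub>))"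

definition right_basis :: "('a, 'r) ring_scheme \<Rightarrow> 'a set \<Rightarrow> 'a set \<Rightarrow> bool" where
  "right_basis S R B \<longleftrightarrow>
     carrier S = {(\<Oplus>\<^bsub>S\<^esub>b\<in>B. b \<otimes>\<^bsub>S\<^esub> c b) | c. c \<in> B \<rightarrow> R} \<and>
     (\<forall>c. c \<in> B \<rightarrow> R \<and> (\<Oplus>\<^bsub>S\<^esub>b\<in>B. b \<otimes>\<^bsub>S\<^esub> c b) = \<zero>\<^bsub>S\<^esub> \<longrightarrow> (\<forall>b\<in>B. c b = \<zero>\<^bsub>S\<^esub>))"

text \<open>A subring is given by its set \<open>R\<close> of elements (\<^const>\<open>subring\<close> includes the same unit); as a ring
  it is \<open>S\<lparr>carrier := R\<rparr>\<close>, and an \<open>S\<close>-module regarded as an \<open>R\<close>-module is the same record \<open>M\<close>.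
  The equation \<open>S = \<Sum> R s\<^sub>j\<close> is the spanning part of \<^const>\<open>left_basis\<close>.\<close>

definition excellent_extension :: "('a, 'r) ring_scheme \<Rightarrow> 'a set \<Rightarrow> bool" where
  "excellent_extension S R \<longleftrightarrow> ring S \<and> subring R S \<and>
     (\<forall>(M :: 'a umodule) N. fg_module S M \<and> submodule N S M \<and>
        direct_summand (S\<lparr>carrier := R\<rparr>) M N \<longrightarrow> direct_summand S M N) \<and>
     (\<exists>B. finite B \<and> B \<subseteq> carrier S \<and> left_basis S R B \<and> right_basis S R B \<and>
        (\<forall>b\<in>B. R #>\<^bsub>S\<^esub> b = b <#\<^bsub>S\<^esub> R))"

end

theory Submission
  imports Defs
begin

text \<open>Everything is phrased with retracts: \<open>L\<close> is a retract of \<open>K\<close> when homomorphisms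
  \<open>i : L \<rightarrow> K\<close> and \<open>p : K \<rightarrow> L\<close> with \<open>p \<circ> i = id\<close> exist, that is, when \<open>L\<close> is isomorphic to a direct
  summand of \<open>K\<close>. By the theorem of Krull and Schmidt, \<open>A\<close> is \<open>n\<close>-syzygy finite iff there are
  finitely many finitely generated modules such that every indecomposable summand of an \<open>n\<close>-th
  syzygy is a retract of one of them (\<open>syzygy_finite_iff\<close>). This criterion can be moved along the two
  additive functors between \<open>S\<close>-modules and \<open>R\<close>-modules, restriction and induction
  \<open>Ind M = S \<otimes>\<^sub>R M\<close>. As \<open>S\<close> is free of finite rank on both sides, both functors are exact and preserve
  finitely generated modules and finitely generated projectives, hence \<open>n\<close>-th syzygies
  (\<open>restrict_Omega\<close>, \<open>Ind_Omega\<close>).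

  From \<open>R\<close> to \<open>S\<close>. Let \<open>W\<close> be an indecomposable summand of an \<open>n\<close>-th syzygy over \<open>S\<close>. The
  multiplication map \<open>Ind W \<rightarrow> W\<close> is split over \<open>R\<close> by \<open>x \<mapsto> 1 \<otimes> x\<close>, so by the summand condition of an
  excellent extension it is split over \<open>S\<close>, and \<open>W\<close> is a retract of \<open>Ind W\<close>. Decomposing \<open>W\<close> over \<open>R\<close> exhibits
  \<open>W\<close> as a retract of \<open>Ind N\<close> for an indecomposable \<open>R\<close>-summand \<open>N\<close> of \<open>W\<close>; this \<open>N\<close> is a
  retract of one of the finitely many modules belonging to \<open>R\<close>, so \<open>W\<close> is a retract of one of the
  finitely many modules induced from them.

  From \<open>S\<close> to \<open>R\<close>. Let \<open>L\<close> be an indecomposable summand of an \<open>n\<close>-th syzygy over \<open>R\<close>. If \<open>L\<close> is an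
  \<open>R\<close>-retract of \<open>Ind L\<close>, then it is an \<open>R\<close>-retract of an indecomposable \<open>S\<close>-summand of \<open>Ind L\<close>, and
  those are retracts of finitely many modules. That \<open>L\<close> is a retract of \<open>Ind L\<close> is clear when \<open>1\<close> is
  one of the basis elements \<open>b\<close>, but the common basis need not contain \<open>1\<close>. Write
  \<open>1 = \<Sum> b q\<^sub>b\<close> with \<open>q\<^sub>b \<in> R\<close>. The condition \<open>R b = b R\<close> gives an automorphism \<open>\<sigma>\<^sub>b\<close> of \<open>R\<close> with
  \<open>r b = b \<sigma>\<^sub>b(r)\<close>, and comparing coefficients in \<open>r 1 = 1 r\<close> gives \<open>q\<^sub>b r = \<sigma>\<^sub>b(r) q\<^sub>b\<close>. So
  multiplication by \<open>q\<^sub>b\<close> is a semilinear endomorphism of \<open>L\<close>, and Fitting's lemma applies to it: it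
  is bijective or nilpotent. If all \<open>q\<^sub>b\<close> acted nilpotently, they would all kill a minimal submodule
  \<open>T\<close> of \<open>L\<close>; but then \<open>1 \<otimes> x = \<Sum> b \<otimes> q\<^sub>b x = 0\<close> for \<open>x \<in> T\<close>, and \<open>b \<otimes> x = b (1 \<otimes> x) = 0\<close> yields \<open>x = 0\<close>.
  Hence some \<open>q\<^sub>b\<close> is bijective on \<open>L\<close>, and the \<open>b\<close>-th coordinate followed by its inverse is a
  retraction \<open>Ind L \<rightarrow> L\<close> (\<open>retract_restricted_Ind\<close>).\<close>

section \<open>Homomorphisms, submodules and retracts\<close>

context left_module
begin

declare smult_closed [simp, intro]

lemma smult_r_null: "a \<in> carrier R \<Longrightarrow> a \<odot>\<^bsub>M\<^esub> \<zero>\<^bsub>M\<^esub> = \<zero>\<^bsub>M\<^esub>"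
  using smult_r_distr[of a "\<zero>\<^bsub>M\<^esub>" "\<zero>\<^bsub>M\<^esub>"] smult_closed[of a "\<zero>\<^bsub>M\<^esub>"]
  by (simp add: M.add.l_cancel_one')

lemma smult_l_null: "x \<in> carrier M \<Longrightarrow> \<zero> \<odot>\<^bsub>M\<^esub> x = \<zero>\<^bsub>M\<^esub>"
  using smult_l_distr[of \<zero> \<zero> x] smult_closed[of \<zero> x]
  by (simp add: M.add.l_cancel_one')

lemma smult_minus_one: "x \<in> carrier M \<Longrightarrow> (\<ominus> \<one>) \<odot>\<^bsub>M\<^esub> x = \<ominus>\<^bsub>M\<^esub> x"
proof -
  assume x: "x \<in> carrier M"
  have "(\<ominus> \<one>) \<odot>\<^bsub>M\<^esub> x \<oplus>\<^bsub>M\<^esub> x = (\<ominus> \<one> \<oplus> \<one>) \<odot>\<^bsub>M\<^esub> x"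
    using x by (simp add: smult_l_distr smult_one)
  then show ?thesis
    using x by (metis M.minus_equality R.add.inv_closed R.l_neg R.one_closed smult_closed smult_l_null)
qed

lemma smult_r_minus:
  assumes "a \<in> carrier R" "x \<in> carrier M"
  shows "a \<odot>\<^bsub>M\<^esub> (\<ominus>\<^bsub>M\<^esub> x) = \<ominus>\<^bsub>M\<^esub> (a \<odot>\<^bsub>M\<^esub> x)"
proof (rule M.minus_equality[symmetric])
  show "a \<odot>\<^bsub>M\<^esub> (\<ominus>\<^bsub>M\<^esub> x) \<oplus>\<^bsub>M\<^esub> a \<odot>\<^bsub>M\<^esub> x = \<zero>\<^bsub>M\<^esub>"
    using assms by (simp add: smult_r_distr[symmetric] M.l_neg smult_r_null)
qed (use assms in \<open>auto intro: smult_closed\<close>)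

lemma finsum_smult_r:
  assumes "finite I" "a \<in> carrier R" "f \<in> I \<rightarrow> carrier M"
  shows "a \<odot>\<^bsub>M\<^esub> (\<Oplus>\<^bsub>M\<^esub>i\<in>I. f i) = (\<Oplus>\<^bsub>M\<^esub>i\<in>I. a \<odot>\<^bsub>M\<^esub> f i)"
  using assms(1,3)
proof (induction I rule: finite_induct)
  case (insert i I)
  then show ?case
    using assms(2) by (simp add: Pi_iff smult_closed smult_r_distr)
qed (simp add: assms smult_r_null)

lemma finsum_smult_l:
  assumes "finite I" "c \<in> I \<rightarrow> carrier R" "x \<in> carrier M"
  shows "(\<Oplus>i\<in>I. c i) \<odot>\<^bsub>M\<^esub> x = (\<Oplus>\<^bsub>M\<^esub>i\<in>I. c i \<odot>\<^bsub>M\<^esub> x)"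
  using assms(1,2)
proof (induction I rule: finite_induct)
  case (insert i I)
  then show ?case
    using assms(3) by (simp add: Pi_iff smult_closed smult_l_distr)
qed (simp add: assms smult_l_null)

lemma submoduleI:
  assumes "N \<subseteq> carrier M" "\<zero>\<^bsub>M\<^esub> \<in> N"
    and "\<And>x y. x \<in> N \<Longrightarrow> y \<in> N \<Longrightarrow> x \<oplus>\<^bsub>M\<^esub> y \<in> N"
    and smult: "\<And>a x. a \<in> carrier R \<Longrightarrow> x \<in> N \<Longrightarrow> a \<odot>\<^bsub>M\<^esub> x \<in> N"
  shows "submodule N R M"
proof -
  have "\<ominus>\<^bsub>M\<^esub> x \<in> N" if "x \<in> N" for x
    using smult[of "\<ominus> \<one>" x] that assms(1) by (auto simp: smult_minus_one)
  then show ?thesis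
    using assms by (intro submodule.intro subgroup.intro submodule_axioms.intro)
      (auto simp: a_inv_def)
qed

lemma submoduleD:
  assumes "submodule N R M"
  shows "N \<subseteq> carrier M" "\<zero>\<^bsub>M\<^esub> \<in> N"
    and "\<And>x y. x \<in> N \<Longrightarrow> y \<in> N \<Longrightarrow> x \<oplus>\<^bsub>M\<^esub> y \<in> N"
    and "\<And>x. x \<in> N \<Longrightarrow> \<ominus>\<^bsub>M\<^esub> x \<in> N"
    and "\<And>a x. a \<in> carrier R \<Longrightarrow> x \<in> N \<Longrightarrow> a \<odot>\<^bsub>M\<^esub> x \<in> N"
proof -
  interpret N: submodule N R M by fact
  show "N \<subseteq> carrier M" "\<zero>\<^bsub>M\<^esub> \<in> N"
    "\<And>x y. x \<in> N \<Longrightarrow> y \<in> N \<Longrightarrow> x \<oplus>\<^bsub>M\<^esub> y \<in> N"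
    "\<And>x. x \<in> N \<Longrightarrow> \<ominus>\<^bsub>M\<^esub> x \<in> N"
    "\<And>a x. a \<in> carrier R \<Longrightarrow> x \<in> N \<Longrightarrow> a \<odot>\<^bsub>M\<^esub> x \<in> N"
    using N.subset N.one_closed N.m_closed N.m_inv_closed N.smult_closed
    by (auto simp: a_inv_def)
qed

lemma submodule_carrier: "submodule (carrier M) R M"
  by (rule submoduleI) (auto intro: smult_closed)

lemma submodule_zero: "submodule {\<zero>\<^bsub>M\<^esub>} R M"
  by (rule submoduleI) (auto intro: smult_r_null)

lemma submodule_finsum:
  assumes N: "submodule N R M" and "h \<in> I \<rightarrow> N"
  shows "(\<Oplus>\<^bsub>M\<^esub>i\<in>I. h i) \<in> N"
proof (cases "finite I")
  case True
  then show ?thesis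
    using assms(2)
  proof (induction I rule: finite_induct)
    case (insert i I)
    moreover have "h \<in> I \<rightarrow> carrier M" "h i \<in> carrier M"
      using insert.prems submoduleD(1)[OF N] by auto
    ultimately show ?case
      using submoduleD(3)[OF N] by simp
  qed (simp add: submoduleD[OF N])
next
  case False
  then show ?thesis
    using submoduleD(2)[OF N] by (simp add: M.finsum_infinite)
qed

lemma submodule_left_module:
  assumes N: "submodule N R M"
  shows "left_module R (M\<lparr>carrier := N\<rparr>)"
proof -
  note [simp] = subsetD[OF submoduleD(1)[OF N]]
  have "abelian_group (M\<lparr>carrier := N\<rparr>)"
  proof (rule abelian_groupI)
    fix x assume "x \<in> carrier (M\<lparr>carrier := N\<rparr>)"
    then show "\<exists>y\<in>carrier (M\<lparr>carrier := N\<rparr>). y \<oplus>\<^bsub>M\<lparr>carrier := N\<rparr>\<^esub> x = \<zero>\<^bsub>M\<lparr>carrier := N\<rparr>\<^esub>"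
      using submoduleD(4)[OF N] by (auto intro!: bexI[of _ "\<ominus>\<^bsub>M\<^esub> x"] simp: M.l_neg)
  qed (use submoduleD[OF N] in \<open>auto simp: M.a_ac\<close>)
  then show ?thesis
    using submoduleD(5)[OF N]
    by (intro left_module.intro left_module_axioms.intro R.ring_axioms)
      (auto simp: smult_l_distr smult_r_distr smult_assoc smult_one)
qed

end

lemma module_homI:
  assumes "\<And>x. x \<in> carrier M \<Longrightarrow> f x \<in> carrier N"
    and "\<And>x y. x \<in> carrier M \<Longrightarrow> y \<in> carrier M \<Longrightarrow> f (x \<oplus>\<^bsub>M\<^esub> y) = f x \<oplus>\<^bsub>N\<^esub> f y"
    and "\<And>a x. a \<in> carrier A \<Longrightarrow> x \<in> carrier M \<Longrightarrow> f (a \<odot>\<^bsub>M\<^esub> x) = a \<odot>\<^bsub>N\<^esub> f x"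
  shows "f \<in> module_hom A M N"
  using assms by (auto simp: module_hom_def)

lemma module_homD:
  assumes "f \<in> module_hom A M N"
  shows "\<And>x. x \<in> carrier M \<Longrightarrow> f x \<in> carrier N"
    and "\<And>x y. x \<in> carrier M \<Longrightarrow> y \<in> carrier M \<Longrightarrow> f (x \<oplus>\<^bsub>M\<^esub> y) = f x \<oplus>\<^bsub>N\<^esub> f y"
    and "\<And>a x. a \<in> carrier A \<Longrightarrow> x \<in> carrier M \<Longrightarrow> f (a \<odot>\<^bsub>M\<^esub> x) = a \<odot>\<^bsub>N\<^esub> f x"
  using assms by (auto simp: module_hom_def)

lemma additive_zero:
  assumes "abelian_group M" "abelian_group N" "f \<in> carrier M \<rightarrow> carrier N"
    and "\<And>x y. x \<in> carrier M \<Longrightarrow> y \<in> carrier M \<Longrightarrow> f (x \<oplus>\<^bsub>M\<^esub> y) = f x \<oplus>\<^bsub>N\<^esub> f y"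
  shows "f \<zero>\<^bsub>M\<^esub> = \<zero>\<^bsub>N\<^esub>"
proof -
  interpret M: abelian_group M by fact
  interpret N: abelian_group N by fact
  have "f \<zero>\<^bsub>M\<^esub> \<in> carrier N" "f \<zero>\<^bsub>M\<^esub> \<oplus>\<^bsub>N\<^esub> f \<zero>\<^bsub>M\<^esub> = f \<zero>\<^bsub>M\<^esub>"
    using assms(3) assms(4)[of "\<zero>\<^bsub>M\<^esub>" "\<zero>\<^bsub>M\<^esub>"] by auto
  then show ?thesis
    using N.add.l_cancel_one by blast
qed

lemma additive_minus:
  assumes "abelian_group M" "abelian_group N" "f \<in> carrier M \<rightarrow> carrier N"
    and "\<And>x y. x \<in> carrier M \<Longrightarrow> y \<in> carrier M \<Longrightarrow> f (x \<oplus>\<^bsub>M\<^esub> y) = f x \<oplus>\<^bsub>N\<^esub> f y"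
    and "x \<in> carrier M"
  shows "f (\<ominus>\<^bsub>M\<^esub> x) = \<ominus>\<^bsub>N\<^esub> f x"
proof -
  interpret M: abelian_group M by fact
  interpret N: abelian_group N by fact
  have "f (\<ominus>\<^bsub>M\<^esub> x) \<oplus>\<^bsub>N\<^esub> f x = \<zero>\<^bsub>N\<^esub>"
    using assms(4)[of "\<ominus>\<^bsub>M\<^esub> x" x] assms(5) additive_zero[OF assms(1-4)] by (simp add: M.l_neg)
  then show ?thesis
    using assms(3,5) by (intro N.minus_equality[symmetric]) auto
qed

lemma additive_finsum:
  assumes "abelian_group M" "abelian_group N" "f \<in> carrier M \<rightarrow> carrier N"
    and add: "\<And>x y. x \<in> carrier M \<Longrightarrow> y \<in> carrier M \<Longrightarrow> f (x \<oplus>\<^bsub>M\<^esub> y) = f x \<oplus>\<^bsub>N\<^esub> f y"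
    and "finite I" "h \<in> I \<rightarrow> carrier M"
  shows "f (\<Oplus>\<^bsub>M\<^esub>i\<in>I. h i) = (\<Oplus>\<^bsub>N\<^esub>i\<in>I. f (h i))"
proof -
  interpret M: abelian_group M by fact
  interpret N: abelian_group N by fact
  show ?thesis
    using assms(5,6)
  proof (induction I rule: finite_induct)
    case (insert i I)
    then have "h i \<in> carrier M" "h \<in> I \<rightarrow> carrier M" by auto
    moreover have "(\<lambda>i. f (h i)) \<in> I \<rightarrow> carrier N" "f (h i) \<in> carrier N"
      using assms(3) insert.prems by (auto simp: Pi_iff)
    ultimately show ?case
      using insert by (simp add: add)
  qed (simp add: additive_zero[OF assms(1-4)])
qed

lemma module_hom_zero:
  "left_module A M \<Longrightarrow> left_module A N \<Longrightarrow> f \<in> module_hom A M N \<Longrightarrow> f \<zero>\<^bsub>M\<^esub> = \<zero>\<^bsub>N\<^esub>"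
  by (rule additive_zero) (auto simp: left_module_def module_hom_def)

lemma module_hom_minus:
  "left_module A M \<Longrightarrow> left_module A N \<Longrightarrow> f \<in> module_hom A M N \<Longrightarrow> x \<in> carrier M
    \<Longrightarrow> f (\<ominus>\<^bsub>M\<^esub> x) = \<ominus>\<^bsub>N\<^esub> f x"
  by (rule additive_minus) (auto simp: left_module_def module_hom_def)

lemma module_hom_comp:
  "f \<in> module_hom A L M \<Longrightarrow> g \<in> module_hom A M N \<Longrightarrow> g \<circ> f \<in> module_hom A L N"
  by (auto simp: module_hom_def Pi_iff)

lemma module_hom_id: "(\<lambda>x. x) \<in> module_hom A M M"
  by (auto simp: module_hom_def)

lemma module_hom_incl:
  "N \<subseteq> N' \<Longrightarrow> (\<lambda>x. x) \<in> module_hom A (M\<lparr>carrier := N\<rparr>) (M\<lparr>carrier := N'\<rparr>)"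
  "N \<subseteq> carrier M \<Longrightarrow> (\<lambda>x. x) \<in> module_hom A (M\<lparr>carrier := N\<rparr>) M"
  by (auto simp: module_hom_def)

lemma module_hom_corestrict:
  "f \<in> module_hom A M N \<Longrightarrow> f ` carrier M \<subseteq> N' \<Longrightarrow> f \<in> module_hom A M (N\<lparr>carrier := N'\<rparr>)"
  by (auto simp: module_hom_def)

lemma module_hom_inverse:
  assumes f: "f \<in> module_hom A M N" and M: "left_module A M"
    and bij: "bij_betw f (carrier M) (carrier N)"
  shows "the_inv_into (carrier M) f \<in> module_hom A N M"
proof -
  interpret M: left_module A M by fact
  let ?g = "the_inv_into (carrier M) f"
  have inj: "inj_on f (carrier M)" using bij by (rule bij_betw_imp_inj_on)
  have ex: "\<exists>x\<in>carrier M. y = f x" if "y \<in> carrier N" for y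
    using bij that by (auto simp: bij_betw_def)
  have gf: "?g (f x) = x" if "x \<in> carrier M" for x
    using inj that by (rule the_inv_into_f_f)
  show ?thesis
  proof (rule module_homI)
    fix y z assume "y \<in> carrier N" "z \<in> carrier N"
    then obtain u v where "u \<in> carrier M" "v \<in> carrier M" "y = f u" "z = f v" using ex by meson
    then show "?g (y \<oplus>\<^bsub>N\<^esub> z) = ?g y \<oplus>\<^bsub>M\<^esub> ?g z"
      by (simp add: gf flip: module_homD(2)[OF f])
  next
    fix a y assume "a \<in> carrier A" "y \<in> carrier N"
    moreover obtain u where "u \<in> carrier M" "y = f u" using ex calculation by meson
    ultimately show "?g (a \<odot>\<^bsub>N\<^esub> y) = a \<odot>\<^bsub>M\<^esub> ?g y"
      by (simp add: gf M.smult_closed flip: module_homD(3)[OF f])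
  qed (metis ex gf)
qed

lemma submodule_preimage:
  assumes M: "left_module A M" and N: "left_module A N"
    and f: "f \<in> module_hom A M N" and U: "submodule U A N"
  shows "submodule {x \<in> carrier M. f x \<in> U} A M"
proof -
  interpret M: left_module A M by fact
  interpret N: left_module A N by fact
  show ?thesis
    using module_homD[OF f] N.submoduleD[OF U] module_hom_zero[OF M N f]
    by (intro M.submoduleI) (auto intro: M.smult_closed)
qed

lemma submodule_kernel:
  assumes "left_module A M" "left_module A N" "f \<in> module_hom A M N"
  shows "submodule {x \<in> carrier M. f x = \<zero>\<^bsub>N\<^esub>} A M"
  using submodule_preimage[OF assms left_module.submodule_zero[OF assms(2)]] by simp

lemma submodule_image:
  assumes M: "left_module A M" and N: "left_module A N"
    and f: "f \<in> module_hom A M N" and U: "submodule U A M"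
  shows "submodule (f ` U) A N"
proof -
  interpret M: left_module A M by fact
  interpret N: left_module A N by fact
  note U' = M.submoduleD[OF U] and f' = module_homD[OF f]
  note UM = subsetD[OF U'(1)]
  show ?thesis
  proof (rule N.submoduleI)
    show "f ` U \<subseteq> carrier N" using U'(1) f'(1) by auto
    show "\<zero>\<^bsub>N\<^esub> \<in> f ` U" using U'(2) module_hom_zero[OF M N f] by (metis imageI)
    fix x y assume "x \<in> f ` U" "y \<in> f ` U"
    then obtain u v where "u \<in> U" "v \<in> U" "x = f u" "y = f v" by auto
    then show "x \<oplus>\<^bsub>N\<^esub> y \<in> f ` U"
      using U'(3) by (auto intro!: image_eqI[of _ _ "u \<oplus>\<^bsub>M\<^esub> v"] simp: f' UM)
  next
    fix a x assume "a \<in> carrier A" "x \<in> f ` U"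
    then obtain u where "u \<in> U" "x = f u" by auto
    with \<open>a \<in> carrier A\<close> show "a \<odot>\<^bsub>N\<^esub> x \<in> f ` U"
      using U'(5) by (auto intro!: image_eqI[of _ _ "a \<odot>\<^bsub>M\<^esub> u"] simp: f' UM)
  qed
qed

text \<open>Submodules are preserved by preimages, so this criterion passes through
  homomorphisms and through changes of the ring, where explicit linear combinations would have to be
  reindexed.\<close>

lemma fg_module_iff:
  fixes R (structure)
  assumes M: "left_module R M"
  shows "fg_module R M \<longleftrightarrow>
    (\<exists>G. finite G \<and> G \<subseteq> carrier M \<and> (\<forall>N. submodule N R M \<and> G \<subseteq> N \<longrightarrow> N = carrier M))"
  (is "?L \<longleftrightarrow> ?R")
proof -
  interpret left_module R M by fact
  show ?thesis
  proof
    assume ?L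
    then obtain G where G: "finite G" "G \<subseteq> carrier M"
      and gen: "carrier M = {(\<Oplus>\<^bsub>M\<^esub>g\<in>G. c g \<odot>\<^bsub>M\<^esub> g) | c. c \<in> G \<rightarrow> carrier R}"
      by (auto simp: fg_module_def)
    have "carrier M \<subseteq> N" if N: "submodule N R M" "G \<subseteq> N" for N
    proof
      fix x assume "x \<in> carrier M"
      then obtain c where "c \<in> G \<rightarrow> carrier R" "x = (\<Oplus>\<^bsub>M\<^esub>g\<in>G. c g \<odot>\<^bsub>M\<^esub> g)"
        using gen by blast
      then show "x \<in> N"
        using N by (auto intro!: submodule_finsum submoduleD(5)[OF N(1)])
    qed
    then show ?R
      using G submoduleD(1) by (intro exI[of _ G]) blast
  next
    assume ?R
    then obtain G where G: "finite G" "G \<subseteq> carrier M"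
      and gen: "\<And>N. submodule N R M \<Longrightarrow> G \<subseteq> N \<Longrightarrow> N = carrier M"
      by blast
    let ?N = "{(\<Oplus>\<^bsub>M\<^esub>g\<in>G. c g \<odot>\<^bsub>M\<^esub> g) | c. c \<in> G \<rightarrow> carrier R}"
    have GM: "\<And>g. g \<in> G \<Longrightarrow> g \<in> carrier M" using G by auto
    have "submodule ?N R M"
    proof (rule submoduleI)
      show "?N \<subseteq> carrier M"
        using GM by (auto intro!: M.finsum_closed smult_closed)
      have "(\<Oplus>\<^bsub>M\<^esub>g\<in>G. \<zero> \<odot>\<^bsub>M\<^esub> g) = (\<Oplus>\<^bsub>M\<^esub>g\<in>G. \<zero>\<^bsub>M\<^esub>)"
        using GM by (intro M.finsum_cong') (auto simp: smult_l_null)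
      then show "\<zero>\<^bsub>M\<^esub> \<in> ?N"
        by (intro CollectI exI[of _ "\<lambda>_. \<zero>"]) (simp add: M.finsum_zero)
    next
      fix x y assume "x \<in> ?N" "y \<in> ?N"
      then obtain c d where cd: "c \<in> G \<rightarrow> carrier R" "d \<in> G \<rightarrow> carrier R"
        "x = (\<Oplus>\<^bsub>M\<^esub>g\<in>G. c g \<odot>\<^bsub>M\<^esub> g)" "y = (\<Oplus>\<^bsub>M\<^esub>g\<in>G. d g \<odot>\<^bsub>M\<^esub> g)" by blast
      have "x \<oplus>\<^bsub>M\<^esub> y = (\<Oplus>\<^bsub>M\<^esub>g\<in>G. c g \<odot>\<^bsub>M\<^esub> g \<oplus>\<^bsub>M\<^esub> d g \<odot>\<^bsub>M\<^esub> g)"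
        using cd GM by (simp add: M.finsum_addf Pi_iff smult_closed)
      also have "\<dots> = (\<Oplus>\<^bsub>M\<^esub>g\<in>G. (c g \<oplus> d g) \<odot>\<^bsub>M\<^esub> g)"
        using cd GM by (intro M.finsum_cong') (auto simp: smult_l_distr Pi_iff smult_closed)
      finally show "x \<oplus>\<^bsub>M\<^esub> y \<in> ?N"
        using cd by (intro CollectI exI[of _ "\<lambda>g. c g \<oplus> d g"]) auto
    next
      fix a x assume a: "a \<in> carrier R" and "x \<in> ?N"
      then obtain c where c: "c \<in> G \<rightarrow> carrier R" "x = (\<Oplus>\<^bsub>M\<^esub>g\<in>G. c g \<odot>\<^bsub>M\<^esub> g)" by blast
      have "a \<odot>\<^bsub>M\<^esub> x = (\<Oplus>\<^bsub>M\<^esub>g\<in>G. a \<odot>\<^bsub>M\<^esub> (c g \<odot>\<^bsub>M\<^esub> g))"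
        unfolding c(2) using a c(1) G by (intro finsum_smult_r) (auto intro!: smult_closed)
      also have "\<dots> = (\<Oplus>\<^bsub>M\<^esub>g\<in>G. (a \<otimes> c g) \<odot>\<^bsub>M\<^esub> g)"
        using a c GM by (intro M.finsum_cong') (auto simp: smult_assoc Pi_iff smult_closed)
      finally show "a \<odot>\<^bsub>M\<^esub> x \<in> ?N"
        using a c by (intro CollectI exI[of _ "\<lambda>g. a \<otimes> c g"]) auto
    qed
    moreover have "G \<subseteq> ?N"
    proof
      fix h assume h: "h \<in> G"
      have "(\<Oplus>\<^bsub>M\<^esub>g\<in>G. (if h = g then \<one> else \<zero>) \<odot>\<^bsub>M\<^esub> g) = (\<Oplus>\<^bsub>M\<^esub>g\<in>G. if h = g then g else \<zero>\<^bsub>M\<^esub>)"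
        using GM by (intro M.finsum_cong') (auto simp: smult_l_null smult_one)
      also have "\<dots> = h"
        using G h M.finsum_singleton[of h G "\<lambda>g. g"] by auto
      finally show "h \<in> ?N"
        by (intro CollectI exI[of _ "\<lambda>g. if h = g then \<one> else \<zero>"]) auto
    qed
    ultimately have "carrier M = ?N"
      by (rule gen[symmetric])
    then show ?L
      using G left_module_axioms unfolding fg_module_def by blast
  qed
qed

lemma fg_module_left_module: "fg_module A M \<Longrightarrow> left_module A M"
  by (simp add: fg_module_def)

lemma fg_moduleE:
  assumes "fg_module A M"
  obtains G where "finite G" "G \<subseteq> carrier M"
    "\<And>N. submodule N A M \<Longrightarrow> G \<subseteq> N \<Longrightarrow> N = carrier M"
proof -
  obtain G where "finite G" "G \<subseteq> carrier M" "\<forall>N. submodule N A M \<and> G \<subseteq> N \<longrightarrow> N = carrier M"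
    using assms fg_module_iff[OF fg_module_left_module[OF assms]] by blast
  then show thesis
    by (intro that[of G]) auto
qed

lemma fg_module_image:
  assumes M: "fg_module A M" and N: "left_module A N"
    and f: "f \<in> module_hom A M N" and surj: "f ` carrier M = carrier N"
  shows "fg_module A N"
proof -
  obtain G where G: "finite G" "G \<subseteq> carrier M"
    and gen: "\<And>N. submodule N A M \<Longrightarrow> G \<subseteq> N \<Longrightarrow> N = carrier M"
    by (rule fg_moduleE[OF M]) blast
  have "U = carrier N" if "submodule U A N" "f ` G \<subseteq> U" for U
  proof
    have "{x \<in> carrier M. f x \<in> U} = carrier M"
      using that G
      by (intro gen submodule_preimage[OF fg_module_left_module[OF M] N f]) auto
    then show "carrier N \<subseteq> U"
      using surj by (metis (no_types, lifting) image_subsetI mem_Collect_eq)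
    show "U \<subseteq> carrier N" using that(1) N by (simp add: left_module.submoduleD)
  qed
  then show ?thesis
    using G surj unfolding fg_module_iff[OF N] by (intro exI[of _ "f ` G"]) auto
qed

text \<open>Retracts are direct summands up to isomorphism (\<open>retract_iff_direct_summand\<close>). They
  compose and are preserved by functors, with no reference to subsets of a carrier.\<close>

definition retract ::
  "('a, 'r) ring_scheme \<Rightarrow> ('a, 'c) module \<Rightarrow> ('a, 'd) module \<Rightarrow> bool" where
  "retract A L K \<longleftrightarrow>
    (\<exists>i\<in>module_hom A L K. \<exists>p\<in>module_hom A K L. \<forall>x\<in>carrier L. p (i x) = x)"

lemma retractI:
  "i \<in> module_hom A L K \<Longrightarrow> p \<in> module_hom A K L \<Longrightarrow> (\<And>x. x \<in> carrier L \<Longrightarrow> p (i x) = x)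
    \<Longrightarrow> retract A L K"
  by (auto simp: retract_def)

lemma retract_trans:
  assumes "retract A K L" "retract A L M"
  shows "retract A K M"
proof -
  obtain i p where ip: "i \<in> module_hom A K L" "p \<in> module_hom A L K" "\<forall>x\<in>carrier K. p (i x) = x"
    using assms(1) by (auto simp: retract_def)
  obtain j q where jq: "j \<in> module_hom A L M" "q \<in> module_hom A M L" "\<forall>x\<in>carrier L. q (j x) = x"
    using assms(2) by (auto simp: retract_def)
  show ?thesis
    by (rule retractI[OF module_hom_comp[OF ip(1) jq(1)] module_hom_comp[OF jq(2) ip(2)]])
      (use ip jq in \<open>auto simp: module_hom_def Pi_iff\<close>)
qed

lemma module_iso_sym:
  assumes "left_module A M" "module_iso A M N"
  shows "module_iso A N M"
  using assms module_hom_inverse unfolding module_iso_def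
  by (meson bij_betw_the_inv_into)

lemma module_iso_trans:
  assumes "module_iso A L M" "module_iso A M N"
  shows "module_iso A L N"
  using assms module_hom_comp unfolding module_iso_def
  by (meson bij_betw_trans)

lemma module_iso_imp_retract:
  assumes "left_module A M" "module_iso A M N"
  shows "retract A M N" "retract A N M"
proof -
  obtain f where f: "f \<in> module_hom A M N" "bij_betw f (carrier M) (carrier N)"
    using assms(2) by (auto simp: module_iso_def)
  note g = module_hom_inverse[OF f(1) assms(1) f(2)]
  show "retract A M N"
    by (rule retractI[OF f(1) g]) (use f(2) in \<open>auto simp: bij_betw_def the_inv_into_f_f\<close>)
  show "retract A N M"
    by (rule retractI[OF g f(1)]) (use f(2) in \<open>auto simp: bij_betw_def f_the_inv_into_f\<close>)
qed

lemma fg_module_retract: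
  assumes "fg_module A M" "left_module A L" "retract A L M"
  shows "fg_module A L"
proof -
  obtain i p where "i \<in> module_hom A L M" and p: "p \<in> module_hom A M L"
    and "\<forall>x\<in>carrier L. p (i x) = x"
    using assms(3) by (auto simp: retract_def)
  then have "p ` carrier M = carrier L"
    by (fastforce simp: module_hom_def Pi_iff intro: rev_image_eqI)
  then show ?thesis
    using fg_module_image[OF assms(1,2) p] by simp
qed

lemma mem_set_add: "x \<in> N <+>\<^bsub>M\<^esub> N' \<longleftrightarrow> (\<exists>y\<in>N. \<exists>z\<in>N'. x = y \<oplus>\<^bsub>M\<^esub> z)"
  by (auto simp: set_add_def set_mult_def)

text \<open>The projections are linear because the two components of an element are unique.\<close>

lemma direct_sum_of_decompose:
  assumes M: "left_module A M" and ds: "direct_sum_of A M N N'"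
  obtains p p' where "p \<in> module_hom A M (M\<lparr>carrier := N\<rparr>)" "p' \<in> module_hom A M (M\<lparr>carrier := N'\<rparr>)"
    "\<And>x. x \<in> carrier M \<Longrightarrow> x = p x \<oplus>\<^bsub>M\<^esub> p' x"
    "\<And>x. x \<in> N \<Longrightarrow> p x = x"
    "\<And>x. x \<in> N' \<Longrightarrow> p' x = x"
proof -
  interpret M: left_module A M by fact
  have N: "submodule N A M" "submodule N' A M" "N \<inter> N' = {\<zero>\<^bsub>M\<^esub>}" "N <+>\<^bsub>M\<^esub> N' = carrier M"
    using ds by (auto simp: direct_sum_of_def)
  note S = M.submoduleD[OF N(1)] and S' = M.submoduleD[OF N(2)]
  have NM: "\<And>x. x \<in> N \<Longrightarrow> x \<in> carrier M" "\<And>x. x \<in> N' \<Longrightarrow> x \<in> carrier M"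
    using S(1) S'(1) by auto
  have "\<exists>y z. y \<in> N \<and> z \<in> N' \<and> x = y \<oplus>\<^bsub>M\<^esub> z" if "x \<in> carrier M" for x
    using that N(4) by (auto simp: set_add_def set_mult_def)
  then obtain p p' where p: "\<And>x. x \<in> carrier M \<Longrightarrow> p x \<in> N" "\<And>x. x \<in> carrier M \<Longrightarrow> p' x \<in> N'"
    "\<And>x. x \<in> carrier M \<Longrightarrow> x = p x \<oplus>\<^bsub>M\<^esub> p' x"
    by metis
  have uniq: "y = u \<and> z = v"
    if "y \<in> N" "u \<in> N" "z \<in> N'" "v \<in> N'" "y \<oplus>\<^bsub>M\<^esub> z = u \<oplus>\<^bsub>M\<^esub> v" for y z u v
  proof -
    have cl: "y \<in> carrier M" "u \<in> carrier M" "z \<in> carrier M" "v \<in> carrier M"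
      using that NM by auto
    have "\<ominus>\<^bsub>M\<^esub> u \<oplus>\<^bsub>M\<^esub> y = \<ominus>\<^bsub>M\<^esub> u \<oplus>\<^bsub>M\<^esub> (y \<oplus>\<^bsub>M\<^esub> z) \<oplus>\<^bsub>M\<^esub> \<ominus>\<^bsub>M\<^esub> z"
      using cl by (simp add: M.a_assoc M.r_neg)
    also have "\<dots> = v \<oplus>\<^bsub>M\<^esub> \<ominus>\<^bsub>M\<^esub> z"
      using cl that(5) by (simp add: M.M.r_neg1)
    finally have e: "\<ominus>\<^bsub>M\<^esub> u \<oplus>\<^bsub>M\<^esub> y = v \<oplus>\<^bsub>M\<^esub> \<ominus>\<^bsub>M\<^esub> z" .
    have "\<ominus>\<^bsub>M\<^esub> u \<oplus>\<^bsub>M\<^esub> y \<in> N" "v \<oplus>\<^bsub>M\<^esub> \<ominus>\<^bsub>M\<^esub> z \<in> N'"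
      using S S' that by auto
    then have "\<ominus>\<^bsub>M\<^esub> u \<oplus>\<^bsub>M\<^esub> y = \<zero>\<^bsub>M\<^esub>"
      using e N(3) by auto
    then have "y = u"
      using cl by (metis M.add.inv_closed M.minus_equality M.add.inv_inv M.a_comm)
    with that(5) cl show ?thesis by simp
  qed
  have hom: "p (x \<oplus>\<^bsub>M\<^esub> y) = p x \<oplus>\<^bsub>M\<^esub> p y \<and> p' (x \<oplus>\<^bsub>M\<^esub> y) = p' x \<oplus>\<^bsub>M\<^esub> p' y"
    if "x \<in> carrier M" "y \<in> carrier M" for x y
  proof (rule uniq)
    have "p (x \<oplus>\<^bsub>M\<^esub> y) \<oplus>\<^bsub>M\<^esub> p' (x \<oplus>\<^bsub>M\<^esub> y) = (p x \<oplus>\<^bsub>M\<^esub> p' x) \<oplus>\<^bsub>M\<^esub> (p y \<oplus>\<^bsub>M\<^esub> p' y)"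
      using that p(3) by (metis M.a_closed)
    also have "\<dots> = (p x \<oplus>\<^bsub>M\<^esub> p y) \<oplus>\<^bsub>M\<^esub> (p' x \<oplus>\<^bsub>M\<^esub> p' y)"
      using that p(1,2) NM by (simp add: M.a_ac)
    finally show "p (x \<oplus>\<^bsub>M\<^esub> y) \<oplus>\<^bsub>M\<^esub> p' (x \<oplus>\<^bsub>M\<^esub> y) = (p x \<oplus>\<^bsub>M\<^esub> p y) \<oplus>\<^bsub>M\<^esub> (p' x \<oplus>\<^bsub>M\<^esub> p' y)" .
  qed (use that p S S' in auto)
  have hom2: "p (a \<odot>\<^bsub>M\<^esub> x) = a \<odot>\<^bsub>M\<^esub> p x \<and> p' (a \<odot>\<^bsub>M\<^esub> x) = a \<odot>\<^bsub>M\<^esub> p' x"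
    if "a \<in> carrier A" "x \<in> carrier M" for a x
  proof (rule uniq)
    have "p (a \<odot>\<^bsub>M\<^esub> x) \<oplus>\<^bsub>M\<^esub> p' (a \<odot>\<^bsub>M\<^esub> x) = a \<odot>\<^bsub>M\<^esub> (p x \<oplus>\<^bsub>M\<^esub> p' x)"
      using that p(3) M.smult_closed by metis
    also have "\<dots> = a \<odot>\<^bsub>M\<^esub> p x \<oplus>\<^bsub>M\<^esub> a \<odot>\<^bsub>M\<^esub> p' x"
      using that p(1,2) NM by (simp add: M.smult_r_distr)
    finally show "p (a \<odot>\<^bsub>M\<^esub> x) \<oplus>\<^bsub>M\<^esub> p' (a \<odot>\<^bsub>M\<^esub> x) = a \<odot>\<^bsub>M\<^esub> p x \<oplus>\<^bsub>M\<^esub> a \<odot>\<^bsub>M\<^esub> p' x" .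
  qed (use that p S S' M.smult_closed in auto)
  show ?thesis
  proof
    show "p \<in> module_hom A M (M\<lparr>carrier := N\<rparr>)" "p' \<in> module_hom A M (M\<lparr>carrier := N'\<rparr>)"
      using p hom hom2 by (auto intro!: module_homI)
    show "\<And>x. x \<in> carrier M \<Longrightarrow> x = p x \<oplus>\<^bsub>M\<^esub> p' x" by (rule p(3))
    show "p x = x" if "x \<in> N" for x
      using uniq[of "p x" x "p' x" "\<zero>\<^bsub>M\<^esub>"] p[of x] that NM S S' by auto
    show "p' x = x" if "x \<in> N'" for x
      using uniq[of "p x" "\<zero>\<^bsub>M\<^esub>" "p' x" x] p[of x] that NM S S' by auto
  qed
qed

lemma direct_summand_retract:
  assumes "left_module A M" "direct_summand A M N"
  shows "retract A (M\<lparr>carrier := N\<rparr>) M"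
proof -
  obtain N' where ds: "direct_sum_of A M N N'"
    using assms(2) by (auto simp: direct_summand_def)
  obtain p p' where p: "p \<in> module_hom A M (M\<lparr>carrier := N\<rparr>)" "p' \<in> module_hom A M (M\<lparr>carrier := N'\<rparr>)"
    "\<And>x. x \<in> carrier M \<Longrightarrow> x = p x \<oplus>\<^bsub>M\<^esub> p' x"
    "\<And>x. x \<in> N \<Longrightarrow> p x = x"
    "\<And>x. x \<in> N' \<Longrightarrow> p' x = x"
    by (rule direct_sum_of_decompose[OF assms(1) ds]) blast
  have "submodule N A M" using ds by (simp add: direct_sum_of_def)
  then have "N \<subseteq> carrier M" using left_module.submoduleD(1)[OF assms(1)] by blast
  then show ?thesis
    using p(1,4) by (intro retractI[OF module_hom_incl(2) p(1)]) auto
qed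

text \<open>The idempotent \<open>i \<circ> p\<close> splits \<open>x\<close> as \<open>i (p x) + (x - i (p x))\<close>.\<close>

lemma retract_direct_sum:
  assumes L: "left_module A L" and M: "left_module A M"
    and i: "i \<in> module_hom A L M" and p: "p \<in> module_hom A M L"
    and pi: "\<And>x. x \<in> carrier L \<Longrightarrow> p (i x) = x"
  shows "direct_sum_of A M (i ` carrier L) {x \<in> carrier M. p x = \<zero>\<^bsub>L\<^esub>}"
proof -
  interpret L: left_module A L by fact
  interpret M: left_module A M by fact
  note i' = module_homD[OF i] and p' = module_homD[OF p]
  have "x \<in> i ` carrier L <+>\<^bsub>M\<^esub> {x \<in> carrier M. p x = \<zero>\<^bsub>L\<^esub>}" if x: "x \<in> carrier M" for x
  proof -
    have "p (x \<oplus>\<^bsub>M\<^esub> \<ominus>\<^bsub>M\<^esub> i (p x)) = \<zero>\<^bsub>L\<^esub>"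
      using x i' p' pi by (simp add: module_hom_minus[OF M L p] L.r_neg)
    moreover have "x = i (p x) \<oplus>\<^bsub>M\<^esub> (x \<oplus>\<^bsub>M\<^esub> \<ominus>\<^bsub>M\<^esub> i (p x))"
      using x i'(1) p'(1) by (simp add: M.a_lcomm M.r_neg)
    moreover have "x \<oplus>\<^bsub>M\<^esub> \<ominus>\<^bsub>M\<^esub> i (p x) \<in> carrier M" "p x \<in> carrier L"
      using x i'(1) p'(1) by auto
    ultimately show ?thesis
      unfolding mem_set_add by blast
  qed
  moreover have "i ` carrier L <+>\<^bsub>M\<^esub> {x \<in> carrier M. p x = \<zero>\<^bsub>L\<^esub>} \<subseteq> carrier M"
    using i'(1) by (auto simp: mem_set_add)
  moreover have "i ` carrier L \<inter> {x \<in> carrier M. p x = \<zero>\<^bsub>L\<^esub>} = {\<zero>\<^bsub>M\<^esub>}" (is "?I = _")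
  proof
    show "?I \<subseteq> {\<zero>\<^bsub>M\<^esub>}" using pi module_hom_zero[OF L M i] by auto
    have "\<zero>\<^bsub>M\<^esub> \<in> i ` carrier L" using module_hom_zero[OF L M i] by (metis L.zero_closed imageI)
    then show "{\<zero>\<^bsub>M\<^esub>} \<subseteq> ?I" using module_hom_zero[OF M L p] by auto
  qed
  ultimately show ?thesis
    using submodule_image[OF L M i L.submodule_carrier] submodule_kernel[OF M L p]
    unfolding direct_sum_of_def by blast
qed

lemma retract_iff_direct_summand:
  assumes L: "left_module A L" and M: "left_module A M"
  shows "retract A L M \<longleftrightarrow> (\<exists>N. direct_summand A M N \<and> module_iso A L (M\<lparr>carrier := N\<rparr>))"
proof
  assume "retract A L M"
  then obtain i p where i: "i \<in> module_hom A L M" and p: "p \<in> module_hom A M L"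
    and pi: "\<And>x. x \<in> carrier L \<Longrightarrow> p (i x) = x"
    by (auto simp: retract_def)
  have "inj_on i (carrier L)" using pi by (rule inj_on_inverseI)
  then have "module_iso A L (M\<lparr>carrier := i ` carrier L\<rparr>)"
    using module_hom_corestrict[OF i] by (auto simp: module_iso_def bij_betw_def)
  then show "\<exists>N. direct_summand A M N \<and> module_iso A L (M\<lparr>carrier := N\<rparr>)"
    using retract_direct_sum[OF L M i p pi] by (auto simp: direct_summand_def)
next
  assume "\<exists>N. direct_summand A M N \<and> module_iso A L (M\<lparr>carrier := N\<rparr>)"
  then show "retract A L M"
    using direct_summand_retract[OF M] module_iso_imp_retract(1)[OF L] retract_trans by blast
qed

text \<open>The kernel of the retraction is a complement of a nonzero submodule, hence zero.\<close>

lemma retract_indecomposable_iso: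
  assumes L: "left_module A L" and M: "left_module A M" "indecomposable_module A M"
    and nz: "carrier L \<noteq> {\<zero>\<^bsub>L\<^esub>}" and r: "retract A L M"
  shows "module_iso A L M"
proof -
  interpret L: left_module A L by fact
  interpret M: left_module A M by fact
  obtain i p where i: "i \<in> module_hom A L M" and p: "p \<in> module_hom A M L"
    and pi: "\<And>x. x \<in> carrier L \<Longrightarrow> p (i x) = x"
    using r by (auto simp: retract_def)
  let ?K = "{x \<in> carrier M. p x = \<zero>\<^bsub>L\<^esub>}"
  note ds = retract_direct_sum[OF L M(1) i p pi]
  have inj: "inj_on i (carrier L)" using pi by (rule inj_on_inverseI)
  have "i ` carrier L \<noteq> {\<zero>\<^bsub>M\<^esub>}"
  proof
    assume "i ` carrier L = {\<zero>\<^bsub>M\<^esub>}"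
    then have "\<And>x. x \<in> carrier L \<Longrightarrow> x = \<zero>\<^bsub>L\<^esub>"
      using inj module_hom_zero[OF L M(1) i] by (metis L.zero_closed imageI inj_onD singletonD)
    then show False using nz by auto
  qed
  then have K: "?K = {\<zero>\<^bsub>M\<^esub>}"
    using M(2) ds by (auto simp: indecomposable_module_def)
  have "i ` carrier L = carrier M"
  proof
    show le: "i ` carrier L \<subseteq> carrier M" using module_homD(1)[OF i] by auto
    show "carrier M \<subseteq> i ` carrier L"
    proof
      fix x assume "x \<in> carrier M"
      then have "x \<in> i ` carrier L <+>\<^bsub>M\<^esub> {\<zero>\<^bsub>M\<^esub>}"
        using ds unfolding K direct_sum_of_def by simp
      then obtain y where "y \<in> i ` carrier L" "x = y \<oplus>\<^bsub>M\<^esub> \<zero>\<^bsub>M\<^esub>"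
        unfolding mem_set_add by blast
      then show "x \<in> i ` carrier L" using le by auto
    qed
  qed
  then show ?thesis
    using i inj by (auto simp: module_iso_def bij_betw_def)
qed

lemma indecomposable_module_iso:
  assumes M: "left_module A M" and iso: "module_iso A M N" and N: "left_module A N"
    and ind: "indecomposable_module A M"
  shows "indecomposable_module A N"
proof -
  obtain f where f: "f \<in> module_hom A N M" and bij: "bij_betw f (carrier N) (carrier M)"
    using module_iso_sym[OF M iso] by (auto simp: module_iso_def)
  have inj: "inj_on f (carrier N)" and im: "f ` carrier N = carrier M"
    using bij by (auto simp: bij_betw_def)
  note f0 = module_hom_zero[OF N M f]
  interpret N: left_module A N by fact
  have trivial: "U = {\<zero>\<^bsub>N\<^esub>}" if "U \<subseteq> carrier N" "f ` U = {\<zero>\<^bsub>M\<^esub>}" for U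
  proof -
    have "f ` U = f ` {\<zero>\<^bsub>N\<^esub>}" using that f0 by simp
    then show ?thesis using inj_on_image_eq_iff[OF inj that(1), of "{\<zero>\<^bsub>N\<^esub>}"] by simp
  qed
  show ?thesis
    unfolding indecomposable_module_def
  proof (intro conjI allI impI)
    show "carrier N \<noteq> {\<zero>\<^bsub>N\<^esub>}"
      using im f0 ind by (auto simp: indecomposable_module_def)
    fix U V assume ds: "direct_sum_of A N U V"
    then have UV: "submodule U A N" "submodule V A N" "U \<inter> V = {\<zero>\<^bsub>N\<^esub>}" "U <+>\<^bsub>N\<^esub> V = carrier N"
      by (auto simp: direct_sum_of_def)
    have sub: "U \<subseteq> carrier N" "V \<subseteq> carrier N" using UV N.submoduleD(1) by auto
    have "f ` U \<inter> f ` V = f ` (U \<inter> V)" by (rule inj_on_image_Int[OF inj sub, symmetric])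
    moreover have "f ` U <+>\<^bsub>M\<^esub> f ` V = f ` (U <+>\<^bsub>N\<^esub> V)"
    proof -
      have eq: "f u \<oplus>\<^bsub>M\<^esub> f v = f (u \<oplus>\<^bsub>N\<^esub> v)" if "u \<in> U" "v \<in> V" for u v
        using module_homD(2)[OF f subsetD[OF sub(1) that(1)] subsetD[OF sub(2) that(2)]] by simp
      show ?thesis
      proof (intro equalityI subsetI)
        fix y assume "y \<in> f ` U <+>\<^bsub>M\<^esub> f ` V"
        then obtain u v where "u \<in> U" "v \<in> V" "y = f u \<oplus>\<^bsub>M\<^esub> f v" by (auto simp: mem_set_add)
        then show "y \<in> f ` (U <+>\<^bsub>N\<^esub> V)"
          by (intro image_eqI[of _ _ "u \<oplus>\<^bsub>N\<^esub> v"]) (auto simp: eq mem_set_add)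
      next
        fix y assume "y \<in> f ` (U <+>\<^bsub>N\<^esub> V)"
        then obtain u v where "u \<in> U" "v \<in> V" "y = f (u \<oplus>\<^bsub>N\<^esub> v)" by (auto simp: mem_set_add)
        then show "y \<in> f ` U <+>\<^bsub>M\<^esub> f ` V"
          by (auto simp: mem_set_add simp flip: eq)
      qed
    qed
    ultimately have "direct_sum_of A M (f ` U) (f ` V)"
      using submodule_image[OF N M f] UV im f0 by (simp add: direct_sum_of_def)
    then have "f ` U = {\<zero>\<^bsub>M\<^esub>} \<or> f ` V = {\<zero>\<^bsub>M\<^esub>}"
      using ind unfolding indecomposable_module_def by simp
    then show "U = {\<zero>\<^bsub>N\<^esub>} \<or> V = {\<zero>\<^bsub>N\<^esub>}"
      using trivial[OF sub(1)] trivial[OF sub(2)] by auto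
  qed
qed

section \<open>The descending chain condition and Fitting's lemma\<close>

text \<open>Finite generation of \<open>M\<close> over \<open>A\<close> and of \<open>A\<close> over \<open>k\<close> makes \<open>M\<close> a finitely generated
  module over the commutative Artin ring \<open>k\<close>. All finiteness used below comes from there.\<close>

locale fg_artin_module =
  fixes k :: "('k, 'q) ring_scheme" and A :: "('a, 'r) ring_scheme" and \<phi> :: "'k \<Rightarrow> 'a"
    and M :: "('a, 'c) module" (structure)
  assumes artin: "artin_algebra k A \<phi>" and fg: "fg_module A M"
begin

sublocale M: left_module A M
  using fg by (rule fg_module_left_module)

sublocale k: cring k
  using artin by (simp add: artin_algebra_def comm_artin_ring_def)

lemma \<phi>_hom: "\<phi> \<in> ring_hom k A"
  using artin by (simp add: artin_algebra_def)

lemma \<phi>_closed [simp]: "c \<in> carrier k \<Longrightarrow> \<phi> c \<in> carrier A"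
  using \<phi>_hom by (rule ring_hom_closed)

lemma \<phi>_add: "c \<in> carrier k \<Longrightarrow> d \<in> carrier k \<Longrightarrow> \<phi> (c \<oplus>\<^bsub>k\<^esub> d) = \<phi> c \<oplus>\<^bsub>A\<^esub> \<phi> d"
  using \<phi>_hom by (rule ring_hom_add)

lemma \<phi>_mult: "c \<in> carrier k \<Longrightarrow> d \<in> carrier k \<Longrightarrow> \<phi> (c \<otimes>\<^bsub>k\<^esub> d) = \<phi> c \<otimes>\<^bsub>A\<^esub> \<phi> d"
  using \<phi>_hom by (rule ring_hom_mult)

lemma \<phi>_one: "\<phi> \<one>\<^bsub>k\<^esub> = \<one>\<^bsub>A\<^esub>"
  using \<phi>_hom by (rule ring_hom_one)

lemma \<phi>_zero: "\<phi> \<zero>\<^bsub>k\<^esub> = \<zero>\<^bsub>A\<^esub>"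
  using \<phi>_hom k.ring_axioms M.R.ring_axioms by (rule ring_hom_zero)

lemma \<phi>_minus_one: "\<phi> (\<ominus>\<^bsub>k\<^esub> \<one>\<^bsub>k\<^esub>) = \<ominus>\<^bsub>A\<^esub> \<one>\<^bsub>A\<^esub>"
  using additive_minus[OF k.abelian_group_axioms M.R.abelian_group_axioms _ \<phi>_add k.one_closed]
  by (simp add: \<phi>_one Pi_iff)

lemma \<phi>_central: "c \<in> carrier k \<Longrightarrow> a \<in> carrier A \<Longrightarrow> \<phi> c \<otimes>\<^bsub>A\<^esub> a = a \<otimes>\<^bsub>A\<^esub> \<phi> c"
  using artin by (simp add: artin_algebra_def)

text \<open>The chain condition is needed for submodules over \<open>k\<close>: it is applied to images of
  maps that are linear over \<open>k\<close> only.\<close>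

definition ksubmodule :: "'c set \<Rightarrow> bool" where
  "ksubmodule N \<longleftrightarrow> N \<subseteq> carrier M \<and> \<zero> \<in> N \<and> (\<forall>x\<in>N. \<forall>y\<in>N. x \<oplus> y \<in> N) \<and>
     (\<forall>c\<in>carrier k. \<forall>x\<in>N. \<phi> c \<odot> x \<in> N)"

lemma ksubmoduleD:
  assumes "ksubmodule N"
  shows "\<And>x. x \<in> N \<Longrightarrow> x \<in> carrier M" "\<zero> \<in> N"
    "\<And>x y. x \<in> N \<Longrightarrow> y \<in> N \<Longrightarrow> x \<oplus> y \<in> N"
    "\<And>c x. c \<in> carrier k \<Longrightarrow> x \<in> N \<Longrightarrow> \<phi> c \<odot> x \<in> N"
    "\<And>x. x \<in> N \<Longrightarrow> \<ominus> x \<in> N"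
proof -
  show *: "\<And>x. x \<in> N \<Longrightarrow> x \<in> carrier M" "\<zero> \<in> N"
    "\<And>x y. x \<in> N \<Longrightarrow> y \<in> N \<Longrightarrow> x \<oplus> y \<in> N"
    "\<And>c x. c \<in> carrier k \<Longrightarrow> x \<in> N \<Longrightarrow> \<phi> c \<odot> x \<in> N"
    using assms by (auto simp: ksubmodule_def)
  show "\<ominus> x \<in> N" if "x \<in> N" for x
    using *(4)[of "\<ominus>\<^bsub>k\<^esub> \<one>\<^bsub>k\<^esub>" x] that *(1) by (simp add: \<phi>_minus_one M.smult_minus_one)
qed

lemma submodule_ksubmodule: "submodule N A M \<Longrightarrow> ksubmodule N"
  using M.submoduleD unfolding ksubmodule_def by simp

lemma ksubmodule_finsum:
  assumes N: "ksubmodule N" and "finite I" "h \<in> I \<rightarrow> N"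
  shows "(\<Oplus>i\<in>I. h i) \<in> N"
  using assms(2,3)
proof (induction I rule: finite_induct)
  case (insert i I)
  moreover have "h \<in> I \<rightarrow> carrier M" "h i \<in> carrier M"
    using insert.prems ksubmoduleD(1)[OF N] by auto
  ultimately show ?case
    using ksubmoduleD(3)[OF N] by simp
qed (simp add: ksubmoduleD[OF N])

text \<open>Generators are listed so that they can be added one at a time in inductions.\<close>

primrec kspan :: "'c list \<Rightarrow> 'c set" where
  "kspan [] = {\<zero>}"
| "kspan (g # gs) = {\<phi> c \<odot> g \<oplus> y | c y. c \<in> carrier k \<and> y \<in> kspan gs}"

lemma ksubmodule_kspan: "set gs \<subseteq> carrier M \<Longrightarrow> ksubmodule (kspan gs)"
proof (induction gs)
  case Nil
  then show ?case by (simp add: ksubmodule_def M.smult_r_null)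
next
  case (Cons g gs)
  then have K: "ksubmodule (kspan gs)" and g: "g \<in> carrier M" by auto
  note D = ksubmoduleD[OF K]
  show ?case
    unfolding ksubmodule_def
  proof (intro conjI ballI)
    show "kspan (g # gs) \<subseteq> carrier M" using D(1) g by (auto intro: M.smult_closed)
    show "\<zero> \<in> kspan (g # gs)"
      using D(2) g by (auto intro!: exI[of _ "\<zero>\<^bsub>k\<^esub>"] exI[of _ "\<zero>"] simp: \<phi>_zero M.smult_l_null)
  next
    fix x y assume "x \<in> kspan (g # gs)" "y \<in> kspan (g # gs)"
    then obtain c u d v where *: "x = \<phi> c \<odot> g \<oplus> u" "c \<in> carrier k" "u \<in> kspan gs"
      "y = \<phi> d \<odot> g \<oplus> v" "d \<in> carrier k" "v \<in> kspan gs" by auto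
    then have "x \<oplus> y = \<phi> (c \<oplus>\<^bsub>k\<^esub> d) \<odot> g \<oplus> (u \<oplus> v)"
      using g D(1) by (simp add: \<phi>_add M.smult_l_distr M.smult_closed M.a_ac)
    then show "x \<oplus> y \<in> kspan (g # gs)"
      using * D(3) by auto
  next
    fix c x assume c: "c \<in> carrier k" and "x \<in> kspan (g # gs)"
    then obtain d u where *: "x = \<phi> d \<odot> g \<oplus> u" "d \<in> carrier k" "u \<in> kspan gs" by auto
    then have "\<phi> c \<odot> x = \<phi> (c \<otimes>\<^bsub>k\<^esub> d) \<odot> g \<oplus> \<phi> c \<odot> u"
      using g D(1) c by (simp add: \<phi>_mult M.smult_r_distr M.smult_assoc M.smult_closed)
    then show "\<phi> c \<odot> x \<in> kspan (g # gs)"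
      using * c D(4) by auto
  qed
qed

lemma kspan_superset: "set gs \<subseteq> carrier M \<Longrightarrow> set gs \<subseteq> kspan gs"
proof (induction gs)
  case (Cons g gs)
  then have K: "ksubmodule (kspan gs)" and g: "g \<in> carrier M" by (auto intro: ksubmodule_kspan)
  have "g = \<phi> \<one>\<^bsub>k\<^esub> \<odot> g \<oplus> \<zero>"
    using g by (simp add: \<phi>_one M.smult_one)
  then have "g \<in> kspan (g # gs)"
    using ksubmoduleD(2)[OF K] unfolding kspan.simps by blast
  moreover have "y \<in> kspan (g # gs)" if "y \<in> kspan gs" for y
  proof -
    have "y = \<phi> \<zero>\<^bsub>k\<^esub> \<odot> g \<oplus> y"
      using g that ksubmoduleD(1)[OF K] by (simp add: \<phi>_zero M.smult_l_null)
    then show ?thesis using that unfolding kspan.simps by blast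
  qed
  ultimately show ?case
    using Cons by auto
qed simp

text \<open>The products of generators of \<open>A\<close> over \<open>k\<close> with generators of \<open>M\<close> over \<open>A\<close> generate \<open>M\<close>
  over \<open>k\<close>.\<close>

lemma exists_kspan: "\<exists>gs. set gs \<subseteq> carrier M \<and> kspan gs = carrier M"
proof -
  obtain G where G: "finite G" "G \<subseteq> carrier M"
    and gen: "\<And>N. submodule N A M \<Longrightarrow> G \<subseteq> N \<Longrightarrow> N = carrier M"
    by (rule fg_moduleE[OF fg]) blast
  obtain H where H: "finite H" "H \<subseteq> carrier A"
    and genA: "carrier A = {(\<Oplus>\<^bsub>A\<^esub>h\<in>H. \<phi> (c h) \<otimes>\<^bsub>A\<^esub> h) | c. c \<in> H \<rightarrow> carrier k}"
    using artin unfolding artin_algebra_def by blast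
  obtain gs where gs: "set gs = (\<lambda>(h, g). h \<odot> g) ` (H \<times> G)"
    using G(1) H(1) finite_list[of "(\<lambda>(h, g). h \<odot> g) ` (H \<times> G)"] by auto
  have gsM: "set gs \<subseteq> carrier M"
    using G H gs by (auto intro: M.smult_closed)
  note K = ksubmodule_kspan[OF gsM]
  note D = ksubmoduleD[OF K]
  \<comment> \<open>The largest \<open>A\<close>-submodule contained in the \<open>k\<close>-span.\<close>
  let ?U = "{x \<in> carrier M. \<forall>a\<in>carrier A. a \<odot> x \<in> kspan gs}"
  have "submodule ?U A M"
    using D by (intro M.submoduleI)
      (auto simp: M.smult_r_null M.smult_r_distr M.smult_closed simp flip: M.smult_assoc)
  moreover have "G \<subseteq> ?U"
  proof safe
    fix g a assume g: "g \<in> G" and "a \<in> carrier A"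
    then obtain c where c: "c \<in> H \<rightarrow> carrier k" "a = (\<Oplus>\<^bsub>A\<^esub>h\<in>H. \<phi> (c h) \<otimes>\<^bsub>A\<^esub> h)"
      using genA by blast
    have gM: "g \<in> carrier M" and HA: "\<And>h. h \<in> H \<Longrightarrow> h \<in> carrier A" using g G H by auto
    have "a \<odot> g = (\<Oplus>h\<in>H. (\<phi> (c h) \<otimes>\<^bsub>A\<^esub> h) \<odot> g)"
      unfolding c(2) using c(1) H(1) HA gM by (intro M.finsum_smult_l) (auto simp: Pi_iff)
    also have "\<dots> = (\<Oplus>h\<in>H. \<phi> (c h) \<odot> (h \<odot> g))"
      using c(1) HA gM
      by (intro M.M.finsum_cong') (auto simp: M.smult_assoc Pi_iff intro!: M.smult_closed)
    also have "\<dots> \<in> kspan gs"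
      using c(1) kspan_superset[OF gsM] gs g
      by (intro ksubmodule_finsum[OF K H(1)]) (force intro!: D(4))
    finally show "a \<odot> g \<in> kspan gs" .
  qed (use G in auto)
  ultimately have U: "?U = carrier M" by (rule gen)
  have "x \<in> kspan gs" if "x \<in> carrier M" for x
  proof -
    have "x \<in> ?U" using U that by simp
    then show ?thesis using M.smult_one[OF that] by (metis (no_types, lifting) M.R.one_closed mem_Collect_eq)
  qed
  then show ?thesis
    using gsM D(1) by blast
qed

text \<open>Induction on the number of generators. For one more generator \<open>g\<close>, a submodule \<open>N\<close> of
  \<open>k g + K\<close> is recovered from \<open>N \<inter> K\<close> and the ideal of all \<open>c\<close> with \<open>c g + y \<in> N\<close> for some \<open>y \<in> K\<close>, and
  along a descending chain both become stationary.\<close>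

lemma ksubmodule_dcc:
  assumes N: "\<And>i::nat. ksubmodule (N i)" and dec: "\<And>i. N (Suc i) \<subseteq> N i"
  shows "\<exists>n. \<forall>i\<ge>n. N i = N n"
proof -
  have anti: "N j \<subseteq> N i" if "i \<le> j" for i j
    using dec that by (rule lift_Suc_antimono_le)
  note D = ksubmoduleD[OF N]
  have span: "\<exists>n. \<forall>i\<ge>n. N n \<inter> kspan gs \<subseteq> N i" if "set gs \<subseteq> carrier M" for gs
    using that
  proof (induction gs)
    case Nil
    then show ?case using D(2) by auto
  next
    case (Cons g gs)
    then obtain n where n: "\<And>i. i \<ge> n \<Longrightarrow> N n \<inter> kspan gs \<subseteq> N i" by auto
    have g: "g \<in> carrier M" and K: "ksubmodule (kspan gs)"
      using Cons.prems ksubmodule_kspan by auto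
    note E = ksubmoduleD[OF K]
    define I where "I i = {c \<in> carrier k. \<exists>y\<in>kspan gs. \<phi> c \<odot> g \<oplus> y \<in> N i}" for i
    have ideal: "ideal (I i) k" for i
    proof (rule idealI)
      show "ring k" by (rule k.ring_axioms)
      have mult: "d \<otimes>\<^bsub>k\<^esub> c \<in> I i" if c: "c \<in> I i" and d: "d \<in> carrier k" for c d
      proof -
        obtain y where y: "c \<in> carrier k" "y \<in> kspan gs" "\<phi> c \<odot> g \<oplus> y \<in> N i"
          using c by (auto simp: I_def)
        have "\<phi> (d \<otimes>\<^bsub>k\<^esub> c) \<odot> g \<oplus> \<phi> d \<odot> y = \<phi> d \<odot> (\<phi> c \<odot> g \<oplus> y)"
          using y(1,2) d g E(1) by (simp add: \<phi>_mult M.smult_assoc M.smult_r_distr M.smult_closed)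
        also have "\<dots> \<in> N i" using y d D(4) by auto
        finally show ?thesis using y d E(4) by (auto simp: I_def)
      qed
      show "subgroup (I i) (add_monoid k)"
      proof (rule group.subgroupI)
        show "group (add_monoid k)" by (rule k.add.is_group)
        show "I i \<subseteq> carrier (add_monoid k)" by (auto simp: I_def)
        have "\<zero>\<^bsub>k\<^esub> \<in> I i"
          using g E(2) D(2) by (auto simp: I_def \<phi>_zero M.smult_l_null intro!: bexI[of _ "\<zero>"])
        then show "I i \<noteq> {}" by auto
        fix c assume c: "c \<in> I i"
        have "(\<ominus>\<^bsub>k\<^esub> \<one>\<^bsub>k\<^esub>) \<otimes>\<^bsub>k\<^esub> c = \<ominus>\<^bsub>k\<^esub> c"
          using c by (simp add: I_def k.l_minus)
        then show "inv\<^bsub>add_monoid k\<^esub> c \<in> I i"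
          using mult[OF c, of "\<ominus>\<^bsub>k\<^esub> \<one>\<^bsub>k\<^esub>"] by (simp add: a_inv_def)
        fix d assume d: "d \<in> I i"
        obtain y z where y: "c \<in> carrier k" "y \<in> kspan gs" "\<phi> c \<odot> g \<oplus> y \<in> N i"
          "d \<in> carrier k" "z \<in> kspan gs" "\<phi> d \<odot> g \<oplus> z \<in> N i"
          using c d by (auto simp: I_def)
        have "\<phi> (c \<oplus>\<^bsub>k\<^esub> d) \<odot> g \<oplus> (y \<oplus> z) =
          (\<phi> c \<odot> g \<oplus> y) \<oplus> (\<phi> d \<odot> g \<oplus> z)"
          using y(1,2,4,5) g E(1) by (simp add: \<phi>_add M.smult_l_distr M.smult_closed M.a_ac)
        also have "\<dots> \<in> N i" using y D(3) by auto
        finally show "c \<otimes>\<^bsub>add_monoid k\<^esub> d \<in> I i" using y E(3) by (auto simp: I_def)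
      qed
      fix c d assume "c \<in> I i" "d \<in> carrier k"
      then show "d \<otimes>\<^bsub>k\<^esub> c \<in> I i" "c \<otimes>\<^bsub>k\<^esub> d \<in> I i"
        using mult k.m_comm by (auto simp: I_def)
    qed
    moreover have "I (Suc i) \<subseteq> I i" for i
      using dec by (auto simp: I_def)
    ultimately obtain m where m: "\<And>i. i \<ge> m \<Longrightarrow> I i = I m"
      using artin unfolding artin_algebra_def comm_artin_ring_def by meson
    show ?case
    proof (intro exI allI impI subsetI)
      fix i x assume i: "max n m \<le> i" and "x \<in> N (max n m) \<inter> kspan (g # gs)"
      then obtain c y where x: "x \<in> N (max n m)" "x = \<phi> c \<odot> g \<oplus> y" "c \<in> carrier k" "y \<in> kspan gs"
        by auto
      then have "c \<in> I (max n m)" by (auto simp: I_def)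
      then have "c \<in> I i" using m i by (metis max.cobounded2 order_trans)
      then obtain z where z: "z \<in> kspan gs" "\<phi> c \<odot> g \<oplus> z \<in> N i" by (auto simp: I_def)
      have cl: "\<phi> c \<odot> g \<in> carrier M" "y \<in> carrier M" "z \<in> carrier M"
        using x z g E(1) by (auto intro: M.smult_closed)
      have eq: "x \<oplus> \<ominus> (\<phi> c \<odot> g \<oplus> z) = y \<oplus> \<ominus> z"
      proof -
        have "x \<oplus> \<ominus> (\<phi> c \<odot> g \<oplus> z)
          = (\<phi> c \<odot> g \<oplus> \<ominus> (\<phi> c \<odot> g)) \<oplus> (y \<oplus> \<ominus> z)"
          unfolding x(2) using cl by (simp add: M.M.minus_add M.a_ac)
        then show ?thesis using cl by (simp add: M.r_neg)
      qed
      have "x \<oplus> \<ominus> (\<phi> c \<odot> g \<oplus> z) \<in> N (max n m)"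
        using x(1) z(2) anti[OF i] D(3,5) by blast
      then have "y \<oplus> \<ominus> z \<in> N n \<inter> kspan gs"
        using eq anti[of n "max n m"] E(3,5) x(4) z(1) by auto
      then have "y \<oplus> \<ominus> z \<in> N i"
        using n[of i] i by auto
      moreover have "x = (y \<oplus> \<ominus> z) \<oplus> (\<phi> c \<odot> g \<oplus> z)"
      proof -
        have "(y \<oplus> \<ominus> z) \<oplus> (\<phi> c \<odot> g \<oplus> z) = x \<oplus> (z \<oplus> \<ominus> z)"
          unfolding x(2) using cl by (simp add: M.a_ac)
        then show ?thesis using cl x(2) by (simp add: M.r_neg)
      qed
      ultimately show "x \<in> N i"
        using z(2) D(3) by metis
    qed
  qed
  obtain gs where "set gs \<subseteq> carrier M" "kspan gs = carrier M"
    using exists_kspan by blast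
  then obtain n where "\<forall>i\<ge>n. N n \<inter> carrier M \<subseteq> N i"
    using span[of gs] by auto
  moreover have "N n \<subseteq> carrier M" using D(1) by auto
  ultimately show ?thesis
    using anti by blast
qed

lemma wf_submodule: "wf {(N, N'). submodule N A M \<and> submodule N' A M \<and> N \<subset> N'}"
  unfolding wf_iff_no_infinite_down_chain
proof
  assume "\<exists>N. \<forall>i. (N (Suc i), N i) \<in> {(N, N'). submodule N A M \<and> submodule N' A M \<and> N \<subset> N'}"
  then obtain N where "\<forall>i. (N (Suc i), N i) \<in> {(N, N'). submodule N A M \<and> submodule N' A M \<and> N \<subset> N'}"
    by blast
  then have N: "\<And>i. submodule (N i) A M" "\<And>i. N (Suc i) \<subset> N i" by auto
  then obtain n where "\<forall>i\<ge>n. N i = N n"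
    using ksubmodule_dcc[of N] submodule_ksubmodule by blast
  then show False using N(2)[of n] by (metis le_SucI order_refl psubset_eq)
qed

definition klinear :: "('c \<Rightarrow> 'c) \<Rightarrow> bool" where
  "klinear f \<longleftrightarrow> (\<forall>x\<in>carrier M. f x \<in> carrier M) \<and>
     (\<forall>x\<in>carrier M. \<forall>y\<in>carrier M. f (x \<oplus> y) = f x \<oplus> f y) \<and>
     (\<forall>c\<in>carrier k. \<forall>x\<in>carrier M. f (\<phi> c \<odot> x) = \<phi> c \<odot> f x)"

lemma klinearD:
  assumes "klinear f"
  shows "\<And>x. x \<in> carrier M \<Longrightarrow> f x \<in> carrier M"
    "\<And>x y. x \<in> carrier M \<Longrightarrow> y \<in> carrier M \<Longrightarrow> f (x \<oplus> y) = f x \<oplus> f y"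
    "\<And>c x. c \<in> carrier k \<Longrightarrow> x \<in> carrier M \<Longrightarrow> f (\<phi> c \<odot> x) = \<phi> c \<odot> f x"
    "f \<zero> = \<zero>" "\<And>x. x \<in> carrier M \<Longrightarrow> f (\<ominus> x) = \<ominus> f x"
proof -
  show *: "\<And>x. x \<in> carrier M \<Longrightarrow> f x \<in> carrier M"
    "\<And>x y. x \<in> carrier M \<Longrightarrow> y \<in> carrier M \<Longrightarrow> f (x \<oplus> y) = f x \<oplus> f y"
    "\<And>c x. c \<in> carrier k \<Longrightarrow> x \<in> carrier M \<Longrightarrow> f (\<phi> c \<odot> x) = \<phi> c \<odot> f x"
    using assms by (auto simp: klinear_def)
  show "f \<zero> = \<zero>"
    using additive_zero[OF M.M.abelian_group_axioms M.M.abelian_group_axioms _ *(2)] *(1) by auto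
  show "f (\<ominus> x) = \<ominus> f x" if "x \<in> carrier M" for x
    using additive_minus[OF M.M.abelian_group_axioms M.M.abelian_group_axioms _ *(2) that] *(1) by auto
qed

lemma klinear_comp: "klinear f \<Longrightarrow> klinear g \<Longrightarrow> klinear (\<lambda>x. f (g x))"
  by (simp add: klinear_def)

lemma klinear_funpow: "klinear f \<Longrightarrow> klinear (f ^^ n)"
  by (induction n) (simp_all add: klinear_def)

lemma klinear_smult:
  assumes "c \<in> carrier k"
  shows "klinear (\<lambda>x. \<phi> c \<odot> x)"
  using assms by (simp add: klinear_def M.smult_closed M.smult_r_distr \<phi>_mult[symmetric] k.m_comm
      flip: M.smult_assoc)

lemma klinear_add:
  assumes "klinear f" "klinear g"
  shows "klinear (\<lambda>x. f x \<oplus> g x)"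
  unfolding klinear_def using klinearD[OF assms(1)] klinearD[OF assms(2)]
  by (simp add: M.a_ac M.smult_r_distr)

lemma klinear_minus:
  assumes "klinear f"
  shows "klinear (\<lambda>x. \<ominus> f x)"
  unfolding klinear_def using klinearD[OF assms]
  by (simp add: M.M.minus_add M.smult_r_minus)

lemma commute_funpow:
  assumes "klinear f" "\<And>x. x \<in> carrier M \<Longrightarrow> w (f x) = f (w x)" "x \<in> carrier M"
  shows "w ((f ^^ n) x) = (f ^^ n) (w x)"
  using assms(3)
proof (induction n)
  case (Suc n)
  then show ?case using assms(2) klinearD(1)[OF klinear_funpow[OF assms(1)]] by simp
qed simp

text \<open>Kernels form an ascending chain, but the descending chain condition suffices.
  Let \<open>D\<close> be the set of \<open>k\<close>-linear maps commuting with \<open>f\<close>. For an element \<open>g\<close>, the submodules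
  \<open>f\<^sup>i (D g)\<close> decrease, so \<open>f\<^sup>n g = f\<^sup>n\<^sup>+\<^sup>1 (v g)\<close> for some \<open>n\<close> and some \<open>v \<in> D\<close>. The map \<open>w = 1 - f v\<close>
  lies in \<open>D\<close>, is the identity on the kernel of \<open>f\<close>, and \<open>f\<^sup>n w\<close> kills \<open>g\<close>. Composing such maps for one
  generator after the other gives \<open>w\<close> with the same properties and \<open>f\<^sup>n w = 0\<close> on all of \<open>M\<close>. If
  \<open>f\<^sup>n\<^sup>+\<^sup>1 x = 0\<close>, then \<open>f\<^sup>n x\<close> is in the kernel of \<open>f\<close>, so \<open>f\<^sup>n x = w (f\<^sup>n x) = f\<^sup>n (w x) = 0\<close>.\<close>

lemma kernel_funpow_stable:
  assumes f: "klinear f"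
  shows "\<exists>n. \<forall>x\<in>carrier M. (f ^^ Suc n) x = \<zero> \<longrightarrow> (f ^^ n) x = \<zero>"
proof -
  note F = klinearD[OF f] and P = klinearD[OF klinear_funpow[OF f]]
  define D where "D = {v. klinear v \<and> (\<forall>x\<in>carrier M. v (f x) = f (v x))}"
  define W where "W = {w \<in> D. \<forall>x\<in>carrier M. f x = \<zero> \<longrightarrow> w x = x}"
  have D: "klinear v" "\<And>x. x \<in> carrier M \<Longrightarrow> v (f x) = f (v x)" if "v \<in> D" for v
    using that by (auto simp: D_def)
  have kill: "\<exists>n. \<exists>w\<in>W. (f ^^ n) (w g) = \<zero>" if g: "g \<in> carrier M" for g
  proof -
    define U where "U i = {(f ^^ i) (v g) | v. v \<in> D}" for i
    have U_I: "(f ^^ i) (v g) \<in> U i" if "v \<in> D" for v i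
      using that by (auto simp: U_def)
    have "ksubmodule (U i)" for i
      unfolding ksubmodule_def
    proof (intro conjI ballI)
      show "U i \<subseteq> carrier M" using D g P by (auto simp: U_def klinearD)
      have "(\<lambda>_. \<zero>) \<in> D" by (auto simp: D_def klinear_def F M.smult_r_null)
      then show "\<zero> \<in> U i" using U_I[of "\<lambda>_. \<zero>" i] by (simp add: P(4))
    next
      fix x y assume "x \<in> U i" "y \<in> U i"
      then obtain v w where v: "v \<in> D" "w \<in> D" "x = (f ^^ i) (v g)" "y = (f ^^ i) (w g)"
        by (auto simp: U_def)
      then have "(\<lambda>x. v x \<oplus> w x) \<in> D" "x \<oplus> y = (f ^^ i) (v g \<oplus> w g)"
        using g by (auto simp: D_def klinear_add F P klinearD)
      then show "x \<oplus> y \<in> U i" using U_I[of "\<lambda>x. v x \<oplus> w x" i] by simp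
    next
      fix c x assume c: "c \<in> carrier k" and "x \<in> U i"
      then obtain v where v: "v \<in> D" "x = (f ^^ i) (v g)" by (auto simp: U_def)
      then have "(\<lambda>x. \<phi> c \<odot> v x) \<in> D" "\<phi> c \<odot> x = (f ^^ i) (\<phi> c \<odot> v g)"
        using g c by (auto simp: D_def klinear_comp[OF klinear_smult] F P klinearD)
      then show "\<phi> c \<odot> x \<in> U i" using U_I[of "\<lambda>x. \<phi> c \<odot> v x" i] by simp
    qed
    moreover have "U (Suc i) \<subseteq> U i" for i
    proof
      fix x assume "x \<in> U (Suc i)"
      then obtain v where v: "v \<in> D" "x = (f ^^ Suc i) (v g)" by (auto simp: U_def)
      then have "(\<lambda>x. f (v x)) \<in> D" "x = (f ^^ i) (f (v g))"
        using klinear_comp[OF f] by (auto simp: D_def funpow_swap1)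
      then show "x \<in> U i" using U_I[of "\<lambda>x. f (v x)" i] by simp
    qed
    ultimately obtain n where "\<forall>i\<ge>n. U i = U n"
      using ksubmodule_dcc[of U] by blast
    then have "U n = U (Suc n)" by (metis le_SucI order_refl)
    moreover have "(\<lambda>x. x) \<in> D" by (auto simp: D_def klinear_def)
    then have "(f ^^ n) g \<in> U n" using U_I[of "\<lambda>x. x" n] by simp
    ultimately obtain v where v: "v \<in> D" "(f ^^ n) g = (f ^^ Suc n) (v g)"
      by (auto simp: U_def)
    let ?w = "\<lambda>x. x \<oplus> \<ominus> f (v x)"
    have "klinear ?w"
      using klinear_add[OF _ klinear_minus[OF klinear_comp[OF f D(1)[OF v(1)]]], of "\<lambda>x. x"]
      by (auto simp: klinear_def)
    moreover have "?w x = x" if "x \<in> carrier M" "f x = \<zero>" for x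
    proof -
      have "f (v x) = \<zero>"
        using that D(2)[OF v(1), of x] klinearD(4)[OF D(1)[OF v(1)]] by simp
      then show ?thesis using that(1) by simp
    qed
    moreover have "?w (f x) = f (?w x)" if "x \<in> carrier M" for x
      using that D(2)[OF v(1)] F klinearD(1)[OF D(1)[OF v(1)]] by auto
    ultimately have "?w \<in> W" by (auto simp: W_def D_def)
    moreover have "(f ^^ n) (?w g) = \<zero>"
    proof -
      have "v g \<in> carrier M" using g v(1) D(1) klinearD(1) by blast
      then have "(f ^^ n) (?w g) = (f ^^ n) g \<oplus> \<ominus> ((f ^^ Suc n) (v g))"
        using g F P by (simp add: funpow_swap1)
      then show ?thesis using v(2) P(1)[OF g, of n] by (metis M.r_neg)
    qed
    ultimately show ?thesis by (intro exI[of _ n] bexI[of _ ?w])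
  qed
  have kill_span: "\<exists>n. \<exists>w\<in>W. \<forall>y\<in>kspan gs. (f ^^ n) (w y) = \<zero>" if "set gs \<subseteq> carrier M" for gs
    using that
  proof (induction gs)
    case Nil
    have "(\<lambda>x. x) \<in> W" by (auto simp: W_def D_def klinear_def)
    then show ?case using P(4) by force
  next
    case (Cons g gs)
    then obtain n w where w: "w \<in> W" "\<forall>y\<in>kspan gs. (f ^^ n) (w y) = \<zero>" by auto
    have g: "g \<in> carrier M" and K: "\<And>y. y \<in> kspan gs \<Longrightarrow> y \<in> carrier M"
      using Cons.prems ksubmoduleD(1)[OF ksubmodule_kspan] by auto
    have wk: "klinear w" and wD: "w \<in> D" using w(1) D by (auto simp: W_def)
    obtain m w' where w': "w' \<in> W" "(f ^^ m) (w' (w g)) = \<zero>"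
      using kill klinearD(1)[OF wk g] by blast
    have wk': "klinear w'" and wD': "w' \<in> D" using w'(1) D by (auto simp: W_def)
    note X = klinearD[OF wk] klinearD[OF wk']
    have "(\<lambda>x. w' (w x)) \<in> W"
      using w(1) w'(1) X by (auto simp: W_def D_def klinear_comp)
    moreover have "(f ^^ (n + m)) (w' (w x)) = \<zero>" if "x \<in> kspan (g # gs)" for x
    proof -
      obtain c y where x: "x = \<phi> c \<odot> g \<oplus> y" "c \<in> carrier k" "y \<in> kspan gs" using \<open>x \<in> kspan (g # gs)\<close> by auto
      have y: "y \<in> carrier M" using x K by auto
      have "(f ^^ (n + m)) (w' (w g)) = \<zero>"
        using w'(2) P(4) by (simp add: funpow_add)
      moreover have "(f ^^ (n + m)) (w' (w y)) = \<zero>"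
      proof -
        have "(f ^^ (n + m)) (w' (w y)) = (f ^^ m) ((f ^^ n) (w' (w y)))"
          by (metis add.commute comp_apply funpow_add)
        also have "(f ^^ n) (w' (w y)) = w' ((f ^^ n) (w y))"
          using D(2)[OF wD'] X(1)[OF y] by (intro commute_funpow[OF f, symmetric])
        finally show ?thesis using w(2) x(3) X P(4) by simp
      qed
      moreover have "w' (w x) = \<phi> c \<odot> w' (w g) \<oplus> w' (w y)"
        unfolding x(1) using x(2) g y X by (simp add: M.smult_closed)
      ultimately show ?thesis
        using P x(2) g y X by (simp add: M.smult_closed M.smult_r_null)
    qed
    ultimately show ?case by (intro exI[of _ "n + m"] bexI[of _ "\<lambda>x. w' (w x)"]) auto
  qed
  obtain gs where "set gs \<subseteq> carrier M" "kspan gs = carrier M"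
    using exists_kspan by blast
  then obtain n w where w: "w \<in> W" "\<forall>y\<in>carrier M. (f ^^ n) (w y) = \<zero>"
    using kill_span[of gs] by auto
  have "(f ^^ n) x = \<zero>" if x: "x \<in> carrier M" "(f ^^ Suc n) x = \<zero>" for x
  proof -
    have "w ((f ^^ n) x) = (f ^^ n) x"
      using w(1) x P(1) by (auto simp: W_def)
    moreover have "w ((f ^^ n) x) = (f ^^ n) (w x)"
      using w(1) x(1) by (intro commute_funpow[OF f]) (auto simp: W_def D_def)
    ultimately show ?thesis using w(2) x(1) by simp
  qed
  then show ?thesis by blast
qed

text \<open>Fitting's lemma. For large \<open>l\<close>, \<open>M\<close> is the direct sum of the kernel and the image
  of \<open>f\<^sup>l\<close> as a \<open>k\<close>-module. If \<open>f\<close> is semilinear over a surjective \<open>\<sigma>\<close>, both are submodules over \<open>A\<close>: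
  surjectivity is what makes the image stable, as \<open>\<sigma>(a) f(x) = f(a x)\<close>. The semilinear form is needed
  for the multiplications by the coefficients of \<open>1\<close> in a normal basis.\<close>

lemma fitting_indecomposable:
  assumes f: "klinear f" and \<sigma>: "\<sigma> \<in> carrier A \<rightarrow> carrier A" "\<sigma> ` carrier A = carrier A"
    and semi: "\<And>a x. a \<in> carrier A \<Longrightarrow> x \<in> carrier M \<Longrightarrow> f (a \<odot> x) = \<sigma> a \<odot> f x"
    and ind: "indecomposable_module A M"
  shows "bij_betw f (carrier M) (carrier M) \<or> (\<exists>n. \<forall>x\<in>carrier M. (f ^^ n) x = \<zero>)"
proof -
  note F = klinearD[OF f] and P = klinearD[OF klinear_funpow[OF f]]
  obtain n where n: "\<And>x. x \<in> carrier M \<Longrightarrow> (f ^^ Suc n) x = \<zero> \<Longrightarrow> (f ^^ n) x = \<zero>"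
    using kernel_funpow_stable[OF f] by blast
  have n_iter: "(f ^^ n) x = \<zero>" if "x \<in> carrier M" "(f ^^ (n + j)) x = \<zero>" for x j
    using that(2)
  proof (induction j)
    case (Suc j)
    have "(f ^^ Suc n) ((f ^^ j) x) = \<zero>"
      using Suc.prems by (simp add: funpow_add)
    then have "(f ^^ n) ((f ^^ j) x) = \<zero>"
      using n P(1)[OF that(1)] by blast
    then show ?case using Suc.IH by (simp add: funpow_add)
  qed simp
  have "ksubmodule ((f ^^ i) ` carrier M)" for i
    unfolding ksubmodule_def using P imageI[of "\<zero>" "carrier M" "f ^^ i"]
    by (auto simp flip: P(2,3))
  moreover have "(f ^^ Suc i) ` carrier M \<subseteq> (f ^^ i) ` carrier M" for i
    using F(1) by (auto simp: funpow_swap1 simp del: funpow.simps(2)) (auto simp: funpow_swap1)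
  ultimately obtain m where m: "\<And>i. i \<ge> m \<Longrightarrow> (f ^^ i) ` carrier M = (f ^^ m) ` carrier M"
    using ksubmodule_dcc[of "\<lambda>i. (f ^^ i) ` carrier M"] by blast
  \<comment> \<open>The successor makes \<open>f\<close> itself injective and surjective once \<open>f\<^sup>l\<close> is.\<close>
  define l where "l = Suc (max n m)"
  define g where "g = f ^^ l"
  note G = klinearD[OF klinear_funpow[OF f, of l], folded g_def]
  have "g ` carrier M = g ` g ` carrier M"
  proof -
    have "g ` g ` carrier M = (f ^^ (l + l)) ` carrier M"
      by (simp add: g_def funpow_add image_comp)
    then show ?thesis using m[of l] m[of "l + l"] by (simp add: g_def l_def)
  qed
  have ker: "g x = \<zero>" if "x \<in> carrier M" "g (g x) = \<zero>" for x
  proof -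
    have "(f ^^ (l + l)) x = \<zero>" using that(2) by (simp add: g_def funpow_add)
    moreover have "l + l = n + (l + l - n)" "l = (l - n) + n" by (auto simp: l_def)
    ultimately have "(f ^^ n) x = \<zero>" "g x = (f ^^ (l - n)) ((f ^^ n) x)"
      using n_iter[OF that(1)] unfolding g_def by (metis, metis comp_apply funpow_add)
    then show ?thesis using P(4) by simp
  qed
  have \<sigma>i: "(\<sigma> ^^ i) ` carrier A = carrier A" for i
    using \<sigma>(2) by (induction i) (simp_all only: funpow.simps image_comp[symmetric] image_id id_apply)
  have semi_i: "(f ^^ i) (a \<odot> x) = (\<sigma> ^^ i) a \<odot> (f ^^ i) x"
    if "a \<in> carrier A" "x \<in> carrier M" for a x i
  proof (induction i)
    case (Suc i)
    have "(\<sigma> ^^ i) a \<in> carrier A" using \<sigma>i that(1) by blast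
    then show ?case using Suc semi P(1)[OF that(2)] by simp
  qed simp
  let ?K = "{x \<in> carrier M. g x = \<zero>}"
  have K: "submodule ?K A M"
  proof (rule M.submoduleI)
    fix a x assume a: "a \<in> carrier A" and "x \<in> ?K"
    then have x: "x \<in> carrier M" "g x = \<zero>" by auto
    have "(\<sigma> ^^ l) a \<in> carrier A" using \<sigma>i a by blast
    then have "g (a \<odot> x) = \<zero>"
      using semi_i[OF a x(1), of l] x(2) by (simp add: g_def M.smult_r_null)
    then show "a \<odot> x \<in> ?K" using a x by (auto intro: M.smult_closed)
  qed (use G in auto)
  have I: "submodule (g ` carrier M) A M"
  proof (rule M.submoduleI)
    show "\<zero> \<in> g ` carrier M" using G(4) by (metis M.M.zero_closed imageI)
    fix a x assume a: "a \<in> carrier A" and "x \<in> g ` carrier M"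
    then obtain y where y: "y \<in> carrier M" "x = g y" by auto
    obtain b where b: "b \<in> carrier A" "a = (\<sigma> ^^ l) b" using \<sigma>i a by (metis imageE)
    then have "a \<odot> x = g (b \<odot> y)"
      using semi_i[OF b(1) y(1), of l] y by (simp add: g_def)
    then show "a \<odot> x \<in> g ` carrier M" using b y by (auto intro: M.smult_closed)
  qed (use G in \<open>auto simp flip: G(2)\<close>)
  have "direct_sum_of A M ?K (g ` carrier M)"
    unfolding direct_sum_of_def
  proof (intro conjI K I)
    show "?K \<inter> g ` carrier M = {\<zero>}"
      using ker M.submoduleD(2)[OF K] M.submoduleD(2)[OF I] by auto
    show "?K <+> g ` carrier M = carrier M"
    proof
      show "?K <+> g ` carrier M \<subseteq> carrier M" using G(1) by (auto simp: mem_set_add)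
      show "carrier M \<subseteq> ?K <+> g ` carrier M"
      proof
        fix x assume x: "x \<in> carrier M"
        then obtain y where y: "y \<in> carrier M" "g x = g (g y)"
          using \<open>g ` carrier M = g ` g ` carrier M\<close> by (metis (no_types, lifting) imageE imageI)
        have "x \<oplus> \<ominus> g y \<in> ?K"
          using x y G by (simp add: M.r_neg)
        moreover have "x = (x \<oplus> \<ominus> g y) \<oplus> g y"
          using x y G(1) by (simp add: M.a_assoc M.l_neg)
        ultimately show "x \<in> ?K <+> g ` carrier M"
          unfolding mem_set_add using y(1) by blast
      qed
    qed
  qed
  then consider "?K = {\<zero>}" "direct_sum_of A M ?K (g ` carrier M)" | "g ` carrier M = {\<zero>}"
    using ind unfolding indecomposable_module_def by blast
  then show ?thesis
  proof cases
    case 1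
    have step: "g x = (f ^^ max n m) (f x)" "g x = f ((f ^^ max n m) x)" for x
      by (simp_all add: g_def l_def funpow_swap1)
    have "inj_on f (carrier M)"
    proof (rule inj_onI)
      fix x y assume xy: "x \<in> carrier M" "y \<in> carrier M" "f x = f y"
      then have "f (x \<oplus> \<ominus> y) = \<zero>" using F by (simp add: M.r_neg)
      then have "g (x \<oplus> \<ominus> y) = \<zero>" using step(1) P(4) by simp
      then have "x \<oplus> \<ominus> y = \<zero>" using 1(1) xy by blast
      then show "x = y" using xy by (metis M.minus_equality M.add.inv_closed M.add.inv_inv)
    qed
    moreover have "carrier M \<subseteq> f ` carrier M"
    proof
      fix x assume x: "x \<in> carrier M"
      then have "x \<in> {\<zero>} <+> g ` carrier M"
        using 1(2) unfolding 1(1) direct_sum_of_def by simp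
      then obtain y where "y \<in> carrier M" "x = \<zero> \<oplus> g y" unfolding mem_set_add by blast
      then have "x = f ((f ^^ max n m) y)" using G(1) step(2) by simp
      then show "x \<in> f ` carrier M" using P(1) \<open>y \<in> carrier M\<close> by blast
    qed
    ultimately show ?thesis using F(1) by (auto simp: bij_betw_def)
  next
    case 2
    then show ?thesis unfolding g_def by blast
  qed
qed

lemma module_hom_klinear: "f \<in> module_hom A M M \<Longrightarrow> klinear f"
  by (auto simp: klinear_def module_hom_def)

text \<open>The endomorphism ring is local. If both maps were nilpotent, an element of the
  kernel of \<open>f\<close> would be fixed by \<open>g\<close>, hence zero; so \<open>f\<close> would be injective and nilpotent.\<close>

lemma indecomposable_local:
  assumes ind: "indecomposable_module A M"
    and f: "f \<in> module_hom A M M" and g: "g \<in> module_hom A M M"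
    and sum: "\<And>x. x \<in> carrier M \<Longrightarrow> f x \<oplus> g x = x"
  shows "bij_betw f (carrier M) (carrier M) \<or> bij_betw g (carrier M) (carrier M)"
proof (rule ccontr)
  assume c: "\<not> ?thesis"
  have "bij_betw h (carrier M) (carrier M) \<or> (\<exists>n. \<forall>x\<in>carrier M. (h ^^ n) x = \<zero>)"
    if "h \<in> module_hom A M M" for h
    using fitting_indecomposable[OF module_hom_klinear[OF that], of "\<lambda>a. a"] module_homD(3)[OF that] ind
    by auto
  then obtain n m where n: "\<And>x. x \<in> carrier M \<Longrightarrow> (f ^^ n) x = \<zero>"
    and m: "\<And>x. x \<in> carrier M \<Longrightarrow> (g ^^ m) x = \<zero>"
    using c f g by meson
  have ker_f: "y = \<zero>" if y: "y \<in> carrier M" "f y = \<zero>" for y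
  proof -
    have "g y = y" using sum[OF y(1)] y module_homD(1)[OF g] by simp
    then have "(g ^^ m) y = y" by (induction m) simp_all
    then show ?thesis using m[OF y(1)] by simp
  qed
  have "x = \<zero>" if x: "x \<in> carrier M" for x
  proof -
    have "(f ^^ i) x = \<zero> \<Longrightarrow> x = \<zero>" for i
      using ker_f klinearD(1)[OF klinear_funpow[OF module_hom_klinear[OF f]] x]
      by (induction i) auto
    then show ?thesis using n[OF x] by blast
  qed
  then have "carrier M = {\<zero>}" by auto
  then show False using ind by (simp add: indecomposable_module_def)
qed

end

section \<open>Indecomposable summands\<close>

lemma direct_sum_of_sym:
  assumes M: "left_module A M" and ds: "direct_sum_of A M N N'"
  shows "direct_sum_of A M N' N"
proof -
  interpret M: left_module A M by fact
  have "N \<subseteq> carrier M" "N' \<subseteq> carrier M"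
    using ds M.submoduleD(1) by (auto simp: direct_sum_of_def)
  then have "N' <+>\<^bsub>M\<^esub> N = N <+>\<^bsub>M\<^esub> N'"
    by (auto simp: mem_set_add) (metis M.a_comm subsetD)+
  then show ?thesis
    using ds by (auto simp: direct_sum_of_def)
qed

lemma submodule_trans:
  assumes M: "left_module A M" and N: "submodule N A M" and N': "submodule N' A (M\<lparr>carrier := N\<rparr>)"
  shows "submodule N' A M"
proof -
  interpret M: left_module A M by fact
  interpret N: left_module A "M\<lparr>carrier := N\<rparr>" by (rule M.submodule_left_module[OF N])
  show ?thesis
    using N.submoduleD[OF N'] M.submoduleD(1)[OF N] by (intro M.submoduleI) auto
qed

lemma retract_refl: "retract A M M"
  by (rule retractI[OF module_hom_id module_hom_id]) simp

lemma retract_of_trivial: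
  assumes L: "left_module A L" and r: "retract A L Z" and Z: "carrier Z \<subseteq> {z}"
  shows "carrier L = {\<zero>\<^bsub>L\<^esub>}"
proof -
  interpret L: left_module A L by fact
  obtain i p where i: "i \<in> module_hom A L Z" and "\<forall>x\<in>carrier L. p (i x) = x"
    using r by (auto simp: retract_def)
  then have eq: "x = p z" if "x \<in> carrier L" for x
    using module_homD(1)[OF i that] Z that by force
  have "x = \<zero>\<^bsub>L\<^esub>" if "x \<in> carrier L" for x
    using eq[OF that] eq[OF L.M.zero_closed] by simp
  then show ?thesis using L.M.zero_closed by blast
qed

context fg_artin_module
begin

text \<open>This replaces decompositions into finite families of indecomposables. If a property
  of a direct sum is always inherited by one of the two summands, then a minimal summand with the
  property is indecomposable. It is used for the properties ``has infinitely many indecomposable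
  retracts'', ``induces to a module with retract \<open>W\<close>'' and ``restricts to a module with retract \<open>L\<close>''.\<close>

lemma indecomposable_summand_descent:
  assumes Q: "Q (carrier M)" and zero: "\<not> Q {\<zero>\<^bsub>M\<^esub>}"
    and split: "\<And>N N1 N2. submodule N A M \<Longrightarrow> Q N \<Longrightarrow> direct_sum_of A (M\<lparr>carrier := N\<rparr>) N1 N2
      \<Longrightarrow> Q N1 \<or> Q N2"
  obtains N where "submodule N A M" "retract A (M\<lparr>carrier := N\<rparr>) M"
    "indecomposable_module A (M\<lparr>carrier := N\<rparr>)" "Q N"
proof -
  define Z where "Z = {N. submodule N A M \<and> retract A (M\<lparr>carrier := N\<rparr>) M \<and> Q N}"
  have "carrier M \<in> Z"
    using Q M.submodule_carrier by (simp add: Z_def retract_refl)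
  then obtain N where N: "N \<in> Z"
    and min: "\<And>N'. submodule N' A M \<Longrightarrow> N' \<subset> N \<Longrightarrow> N' \<notin> Z"
    by (rule wfE_min[OF wf_submodule]) (auto simp: Z_def)
  then have NM: "submodule N A M" "retract A (M\<lparr>carrier := N\<rparr>) M" "Q N"
    by (auto simp: Z_def)
  note lN = M.submodule_left_module[OF NM(1)]
  have one: "N2 = {\<zero>\<^bsub>M\<^esub>}" if ds: "direct_sum_of A (M\<lparr>carrier := N\<rparr>) N1 N2" and Q1: "Q N1" for N1 N2
  proof -
    have s: "submodule N1 A (M\<lparr>carrier := N\<rparr>)" "submodule N2 A (M\<lparr>carrier := N\<rparr>)"
      and int: "N1 \<inter> N2 = {\<zero>\<^bsub>M\<^esub>}"
      using ds by (auto simp: direct_sum_of_def)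
    have "N1 \<subseteq> N" "N2 \<subseteq> N"
      using left_module.submoduleD(1)[OF lN s(1)] left_module.submoduleD(1)[OF lN s(2)] by auto
    have "retract A (M\<lparr>carrier := N1\<rparr>) (M\<lparr>carrier := N\<rparr>)"
      using direct_summand_retract[OF lN, of N1] ds by (auto simp: direct_summand_def)
    then have "retract A (M\<lparr>carrier := N1\<rparr>) M"
      using NM(2) by (rule retract_trans)
    then have "N1 \<in> Z"
      using submodule_trans[OF M.left_module_axioms NM(1) s(1)] Q1 by (simp add: Z_def)
    then have "N1 = N"
      using min[of N1] \<open>N1 \<subseteq> N\<close> by (auto simp: Z_def)
    then show ?thesis using int \<open>N2 \<subseteq> N\<close> by auto
  qed
  have "indecomposable_module A (M\<lparr>carrier := N\<rparr>)"
    unfolding indecomposable_module_def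
  proof (intro conjI allI impI)
    show "carrier (M\<lparr>carrier := N\<rparr>) \<noteq> {\<zero>\<^bsub>M\<lparr>carrier := N\<rparr>\<^esub>}"
      using NM(3) zero by auto
    fix N1 N2 assume ds: "direct_sum_of A (M\<lparr>carrier := N\<rparr>) N1 N2"
    show "N1 = {\<zero>\<^bsub>M\<lparr>carrier := N\<rparr>\<^esub>} \<or> N2 = {\<zero>\<^bsub>M\<lparr>carrier := N\<rparr>\<^esub>}"
      using split[OF NM(1,3) ds] one[OF ds] one[OF direct_sum_of_sym[OF lN ds]] by auto
  qed
  then show thesis using that NM by blast
qed

text \<open>The exchange step of the Krull-Schmidt theorem: \<open>p \<circ> i = id\<close> is the sum of
  \<open>p \<circ> a1 \<circ> c1 \<circ> i\<close> and \<open>p \<circ> a2 \<circ> c2 \<circ> i\<close>, one of which is bijective. The maps are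
  arbitrary because for induced modules they are the images of projections and inclusions under a
  functor.\<close>

lemma indecomposable_retract_split:
  assumes ind: "indecomposable_module A M" and r: "retract A M Y"
    and a: "a1 \<in> module_hom A Z1 Y" "a2 \<in> module_hom A Z2 Y"
    and c: "c1 \<in> module_hom A Y Z1" "c2 \<in> module_hom A Y Z2"
    and sum: "\<And>y. y \<in> carrier Y \<Longrightarrow> a1 (c1 y) \<oplus>\<^bsub>Y\<^esub> a2 (c2 y) = y"
  shows "retract A M Z1 \<or> retract A M Z2"
proof -
  obtain i p where i: "i \<in> module_hom A M Y" and p: "p \<in> module_hom A Y M"
    and pi: "\<And>x. x \<in> carrier M \<Longrightarrow> p (i x) = x"
    using r by (auto simp: retract_def)
  have bij: "retract A M Z"
    if a: "a \<in> module_hom A Z Y" and c: "c \<in> module_hom A Y Z"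
      and bij: "bij_betw ((p \<circ> a) \<circ> (c \<circ> i)) (carrier M) (carrier M)" for a c and Z :: "('a, 'z) module"
  proof -
    note pa = module_hom_comp[OF a p] and ci = module_hom_comp[OF i c]
    note f = module_hom_comp[OF ci pa]
    let ?g = "the_inv_into (carrier M) ((p \<circ> a) \<circ> (c \<circ> i))"
    have g: "?g \<in> module_hom A M M"
      using module_hom_inverse[OF f M.left_module_axioms bij] .
    have "(p \<circ> a) (((c \<circ> i) \<circ> ?g) x) = x" if "x \<in> carrier M" for x
      using f_the_inv_into_f_bij_betw[OF bij, of x] that by simp
    then show ?thesis
      by (rule retractI[OF module_hom_comp[OF g ci] pa])
  qed
  have "((p \<circ> a1) \<circ> (c1 \<circ> i)) x \<oplus>\<^bsub>M\<^esub> ((p \<circ> a2) \<circ> (c2 \<circ> i)) x = x" if x: "x \<in> carrier M" for x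
  proof -
    have "i x \<in> carrier Y" using module_homD(1)[OF i x] .
    moreover have "a1 (c1 (i x)) \<in> carrier Y" "a2 (c2 (i x)) \<in> carrier Y"
      using calculation a c by (auto simp: module_hom_def Pi_iff)
    ultimately have "p (a1 (c1 (i x))) \<oplus>\<^bsub>M\<^esub> p (a2 (c2 (i x))) = p (i x)"
      by (simp add: sum flip: module_homD(2)[OF p])
    then show ?thesis using pi[OF x] by simp
  qed
  then have "bij_betw ((p \<circ> a1) \<circ> (c1 \<circ> i)) (carrier M) (carrier M) \<or>
      bij_betw ((p \<circ> a2) \<circ> (c2 \<circ> i)) (carrier M) (carrier M)"
    by (intro indecomposable_local[OF ind] module_hom_comp[OF module_hom_comp[OF i c(1)] module_hom_comp[OF a(1) p]]
        module_hom_comp[OF module_hom_comp[OF i c(2)] module_hom_comp[OF a(2) p]])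
  then show ?thesis
    using bij[OF a(1) c(1)] bij[OF a(2) c(2)] by blast
qed

lemma indecomposable_retract_direct_sum:
  assumes ind: "indecomposable_module A M" and r: "retract A M Y"
    and Y: "left_module A Y" and ds: "direct_sum_of A Y N1 N2"
  shows "retract A M (Y\<lparr>carrier := N1\<rparr>) \<or> retract A M (Y\<lparr>carrier := N2\<rparr>)"
proof -
  obtain p p' where p: "p \<in> module_hom A Y (Y\<lparr>carrier := N1\<rparr>)" "p' \<in> module_hom A Y (Y\<lparr>carrier := N2\<rparr>)"
    "\<And>x. x \<in> carrier Y \<Longrightarrow> x = p x \<oplus>\<^bsub>Y\<^esub> p' x"
    by (rule direct_sum_of_decompose[OF Y ds]) blast
  have "N1 \<subseteq> carrier Y" "N2 \<subseteq> carrier Y"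
    using ds left_module.submoduleD(1)[OF Y] by (auto simp: direct_sum_of_def)
  then show ?thesis
    using p by (intro indecomposable_retract_split[OF ind r, of "\<lambda>x. x" _ "\<lambda>x. x" _ p p'] module_hom_incl) auto
qed

text \<open>Up to isomorphism an indecomposable module is its own only indecomposable retract, so
  the descent to indecomposable summands rules out that \<open>M\<close> has infinitely many.\<close>

lemma finite_indecomposable_retracts:
  "\<exists>Zs :: 'a umodule set. finite Zs \<and>
    (\<forall>L :: 'a umodule. fg_module A L \<and> indecomposable_module A L \<and> retract A L M
      \<longrightarrow> (\<exists>Z\<in>Zs. module_iso A L Z))"
proof -
  define fin where "fin N \<longleftrightarrow> (\<exists>Zs :: 'a umodule set. finite Zs \<and>
    (\<forall>L :: 'a umodule. fg_module A L \<and> indecomposable_module A L \<and> retract A L (M\<lparr>carrier := N\<rparr>)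
      \<longrightarrow> (\<exists>Z\<in>Zs. module_iso A L Z)))" for N
  have "fin (carrier M)"
  proof (rule ccontr)
    assume nfin: "\<not> fin (carrier M)"
    have zero: "fin {\<zero>\<^bsub>M\<^esub>}"
    proof -
      have False if L: "fg_module A L" "indecomposable_module A L" "retract A L (M\<lparr>carrier := {\<zero>\<^bsub>M\<^esub>}\<rparr>)"
        for L :: "'a umodule"
      proof -
        have "carrier L = {\<zero>\<^bsub>L\<^esub>}"
          using retract_of_trivial[OF fg_module_left_module[OF L(1)] L(3)] by simp
        then show False using L(2) by (simp add: indecomposable_module_def)
      qed
      then show ?thesis unfolding fin_def by (intro exI[of _ "{}"]) auto
    qed
    obtain N where N: "submodule N A M" "retract A (M\<lparr>carrier := N\<rparr>) M"
      "indecomposable_module A (M\<lparr>carrier := N\<rparr>)" "\<not> fin N"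
    proof (rule indecomposable_summand_descent[of "\<lambda>N. \<not> fin N"])
      fix N N1 N2
      assume N: "submodule N A M" "\<not> fin N" and ds: "direct_sum_of A (M\<lparr>carrier := N\<rparr>) N1 N2"
      show "\<not> fin N1 \<or> \<not> fin N2"
      proof (rule ccontr)
        assume "\<not> ?thesis"
        then obtain Zs1 Zs2 :: "'a umodule set" where fin: "finite Zs1" "finite Zs2"
          and 1: "\<And>L :: 'a umodule. fg_module A L \<Longrightarrow> indecomposable_module A L \<Longrightarrow>
            retract A L (M\<lparr>carrier := N1\<rparr>) \<Longrightarrow> \<exists>Z\<in>Zs1. module_iso A L Z"
          and 2: "\<And>L :: 'a umodule. fg_module A L \<Longrightarrow> indecomposable_module A L \<Longrightarrow>
            retract A L (M\<lparr>carrier := N2\<rparr>) \<Longrightarrow> \<exists>Z\<in>Zs2. module_iso A L Z"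
          unfolding fin_def by auto
        have "\<exists>Z\<in>Zs1 \<union> Zs2. module_iso A L Z"
          if L: "fg_module A L" "indecomposable_module A L" "retract A L (M\<lparr>carrier := N\<rparr>)"
          for L :: "'a umodule"
        proof -
          interpret L: fg_artin_module k A \<phi> L using artin L(1) by unfold_locales
          have "retract A L (M\<lparr>carrier := N1\<rparr>) \<or> retract A L (M\<lparr>carrier := N2\<rparr>)"
            using L.indecomposable_retract_direct_sum[OF L(2,3) M.submodule_left_module[OF N(1)] ds]
            by simp
          then show ?thesis using 1 2 L by blast
        qed
        then have "fin N" using fin unfolding fin_def by (intro exI[of _ "Zs1 \<union> Zs2"]) auto
        then show False using N(2) by simp
      qed
    qed (use nfin zero in auto)
    note lN = M.submodule_left_module[OF N(1)]
    obtain C :: "'a umodule" where C: "module_iso A (M\<lparr>carrier := N\<rparr>) C"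
      using fg_module_copy[OF fg_module_retract[OF fg lN N(2)]] by blast
    have "module_iso A L C"
      if L: "fg_module A L" "indecomposable_module A L" "retract A L (M\<lparr>carrier := N\<rparr>)"
      for L :: "'a umodule"
    proof -
      have "carrier L \<noteq> {\<zero>\<^bsub>L\<^esub>}" using L(2) by (simp add: indecomposable_module_def)
      then show ?thesis
        using retract_indecomposable_iso[OF fg_module_left_module[OF L(1)] lN N(3) _ L(3)] C
        by (auto intro: module_iso_trans)
    qed
    then have "fin N" unfolding fin_def by (intro exI[of _ "{C}"]) auto
    then show False using N(4) by simp
  qed
  then show ?thesis by (simp add: fin_def)
qed

end

lemma module_iso_refl: "module_iso A M M"
  unfolding module_iso_def by (rule bexI[OF _ module_hom_id]) (simp add: bij_betw_def)

lemma mem_Omega_indecomposables: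
  "L \<in> Omega_indecomposables A n \<longleftrightarrow>
    fg_module A L \<and> indecomposable_module A L \<and> (\<exists>K\<in>Omega A n. retract A L K)"
proof -
  have "(\<exists>N. direct_summand A K N \<and> module_iso A L (K\<lparr>carrier := N\<rparr>)) \<longleftrightarrow> retract A L K"
    if "fg_module A L" "K \<in> Omega A n" for K
    using retract_iff_direct_summand[of A L K] that
    by (auto simp: Omega_def fg_module_left_module)
  then show ?thesis
    unfolding Omega_indecomposables_def by blast
qed

text \<open>The right-hand side counts no isomorphism classes and does not ask the modules in \<open>Ys\<close>
  to be indecomposable. In this form the property can be carried along functors, which do not preserve
  indecomposability.\<close>

lemma syzygy_finite_iff:
  fixes A :: "('a, 'r) ring_scheme"
  assumes artin: "artin_algebra k A \<phi>"
  shows "syzygy_finite A n \<longleftrightarrow>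
    (\<exists>Ys :: 'a umodule set. finite Ys \<and> (\<forall>Y\<in>Ys. fg_module A Y) \<and>
      (\<forall>L\<in>Omega_indecomposables A n. \<exists>Y\<in>Ys. retract A L Y))"
    (is "_ \<longleftrightarrow> ?R")
proof -
  let ?OI = "Omega_indecomposables A n"
  define r where "r = {(L, L'). L \<in> ?OI \<and> L' \<in> ?OI \<and> module_iso A L L'}"
  have lm: "left_module A L" "fg_module A L" if "L \<in> ?OI" for L
    using that by (auto simp: mem_Omega_indecomposables fg_module_left_module)
  have "finite (?OI // r) \<longleftrightarrow> ?R"
  proof
    assume fin: "finite (?OI // r)"
    define rep where "rep c = (SOME L. L \<in> c)" for c :: "'a umodule set"
    have rep: "rep (r `` {L}) \<in> ?OI \<and> module_iso A L (rep (r `` {L}))" if "L \<in> ?OI" for L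
    proof -
      have "L \<in> r `` {L}" using that module_iso_refl by (auto simp: r_def)
      then have "rep (r `` {L}) \<in> r `` {L}" unfolding rep_def by (rule someI)
      then show ?thesis by (auto simp: r_def)
    qed
    show ?R
    proof (intro exI[of _ "rep ` (?OI // r)"] conjI ballI)
      fix Y assume "Y \<in> rep ` (?OI // r)"
      then obtain L where "L \<in> ?OI" "Y = rep (r `` {L})" by (auto simp: quotient_def)
      then show "fg_module A Y" using rep lm by auto
    next
      fix L assume L: "L \<in> ?OI"
      then have "rep (r `` {L}) \<in> rep ` (?OI // r)" by (auto simp: quotient_def)
      then show "\<exists>Y\<in>rep ` (?OI // r). retract A L Y"
        using rep[OF L] module_iso_imp_retract(1)[OF lm(1)[OF L]] by blast
    qed (use fin in auto)
  next
    assume ?R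
    then obtain Ys :: "'a umodule set" where Ys: "finite Ys" "\<And>Y. Y \<in> Ys \<Longrightarrow> fg_module A Y"
      and ret: "\<And>L. L \<in> ?OI \<Longrightarrow> \<exists>Y\<in>Ys. retract A L Y"
      by auto
    have "\<exists>Zs :: 'a umodule set. finite Zs \<and> (\<forall>L\<in>?OI. retract A L Y \<longrightarrow> (\<exists>Z\<in>Zs. module_iso A L Z))"
      if "Y \<in> Ys" for Y
    proof -
      interpret fg_artin_module k A \<phi> Y using artin Ys(2)[OF that] by unfold_locales
      show ?thesis using finite_indecomposable_retracts by (auto simp: mem_Omega_indecomposables)
    qed
    then obtain Zs :: "'a umodule \<Rightarrow> 'a umodule set" where
      Zs: "\<And>Y. Y \<in> Ys \<Longrightarrow> finite (Zs Y)"
        "\<And>Y L. Y \<in> Ys \<Longrightarrow> L \<in> ?OI \<Longrightarrow> retract A L Y \<Longrightarrow> \<exists>Z\<in>Zs Y. module_iso A L Z"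
      by metis
    have "c \<in> (\<lambda>Z. {L \<in> ?OI. module_iso A L Z}) ` (\<Union>Y\<in>Ys. Zs Y)" if c: "c \<in> ?OI // r" for c
    proof -
      obtain L where L: "L \<in> ?OI" "c = r `` {L}" using c by (auto simp: quotient_def)
      obtain Z where Z: "Z \<in> (\<Union>Y\<in>Ys. Zs Y)" "module_iso A L Z" using ret[OF L(1)] Zs(2) L(1) by blast
      have "module_iso A L L' \<longleftrightarrow> module_iso A L' Z" if L': "L' \<in> ?OI" for L'
      proof
        assume "module_iso A L L'"
        then show "module_iso A L' Z"
          using module_iso_sym[OF lm(1)[OF L(1)]] module_iso_trans Z(2) by blast
      next
        assume "module_iso A L' Z"
        then have "module_iso A Z L'" by (rule module_iso_sym[OF lm(1)[OF L']])
        with Z(2) show "module_iso A L L'" by (rule module_iso_trans)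
      qed
      then have "c = {L' \<in> ?OI. module_iso A L' Z}" using L by (auto simp: r_def)
      then show ?thesis using Z(1) by blast
    qed
    then have "?OI // r \<subseteq> (\<lambda>Z. {L \<in> ?OI. module_iso A L Z}) ` (\<Union>Y\<in>Ys. Zs Y)" by blast
    then show "finite (?OI // r)"
      by (rule finite_subset) (use Ys(1) Zs(1) in auto)
  qed
  then show ?thesis unfolding syzygy_finite_def r_def .
qed

section \<open>Projective modules and syzygies\<close>

definition regular_module :: "('a, 'r) ring_scheme \<Rightarrow> ('a, 'a) module" where
  "regular_module A = \<lparr>carrier = carrier A, monoid.mult = undefined, one = undefined,
     ring.zero = \<zero>\<^bsub>A\<^esub>, ring.add = ring.add A, smult = monoid.mult A\<rparr>"

lemma regular_module_simps [simp]:
  "carrier (regular_module A) = carrier A" "\<zero>\<^bsub>regular_module A\<^esub> = \<zero>\<^bsub>A\<^esub>"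
  "x \<oplus>\<^bsub>regular_module A\<^esub> y = x \<oplus>\<^bsub>A\<^esub> y" "a \<odot>\<^bsub>regular_module A\<^esub> x = a \<otimes>\<^bsub>A\<^esub> x"
  by (simp_all add: regular_module_def)

lemma regular_module_left_module:
  assumes "ring A"
  shows "left_module A (regular_module A)"
proof -
  interpret ring A by fact
  have "abelian_group (regular_module A)"
  proof (rule abelian_groupI)
    fix x assume "x \<in> carrier (regular_module A)"
    then show "\<exists>y\<in>carrier (regular_module A). y \<oplus>\<^bsub>regular_module A\<^esub> x = \<zero>\<^bsub>regular_module A\<^esub>"
      by (intro bexI[of _ "\<ominus>\<^bsub>A\<^esub> x"]) (auto simp: l_neg)
  qed (auto simp: a_ac)
  then show ?thesis
    by (intro left_module.intro left_module_axioms.intro ring_axioms)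
      (auto simp: l_distr r_distr m_assoc)
qed

text \<open>The common form of lifts along epimorphisms, of evaluations of free modules and of
  expansions in a dual basis.\<close>

lemma linear_combination_hom:
  assumes P: "left_module A P" and M: "left_module A M" and "finite I"
    and f: "f \<in> I \<rightarrow> module_hom A P (regular_module A)" and m: "m \<in> I \<rightarrow> carrier M"
  shows "(\<lambda>x. \<Oplus>\<^bsub>M\<^esub>i\<in>I. f i x \<odot>\<^bsub>M\<^esub> m i) \<in> module_hom A P M"
proof (rule module_homI)
  interpret M: left_module A M by fact
  note F = module_homD[OF funcset_mem[OF f], simplified] and m' = funcset_mem[OF m]
  show "(\<Oplus>\<^bsub>M\<^esub>i\<in>I. f i x \<odot>\<^bsub>M\<^esub> m i) \<in> carrier M" if "x \<in> carrier P" for x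
    using that m' F by (intro M.M.finsum_closed) auto
  fix x assume x: "x \<in> carrier P"
  {
    fix y assume y: "y \<in> carrier P"
    have "(\<Oplus>\<^bsub>M\<^esub>i\<in>I. f i (x \<oplus>\<^bsub>P\<^esub> y) \<odot>\<^bsub>M\<^esub> m i) = (\<Oplus>\<^bsub>M\<^esub>i\<in>I. f i x \<odot>\<^bsub>M\<^esub> m i \<oplus>\<^bsub>M\<^esub> f i y \<odot>\<^bsub>M\<^esub> m i)"
      using x y m' F by (intro M.M.finsum_cong') (auto simp: M.smult_l_distr)
    then show "(\<Oplus>\<^bsub>M\<^esub>i\<in>I. f i (x \<oplus>\<^bsub>P\<^esub> y) \<odot>\<^bsub>M\<^esub> m i) =
      (\<Oplus>\<^bsub>M\<^esub>i\<in>I. f i x \<odot>\<^bsub>M\<^esub> m i) \<oplus>\<^bsub>M\<^esub> (\<Oplus>\<^bsub>M\<^esub>i\<in>I. f i y \<odot>\<^bsub>M\<^esub> m i)"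
      using x y m' F by (simp add: M.M.finsum_addf Pi_iff)
  }
  fix a assume a: "a \<in> carrier A"
  have "(\<Oplus>\<^bsub>M\<^esub>i\<in>I. f i (a \<odot>\<^bsub>P\<^esub> x) \<odot>\<^bsub>M\<^esub> m i) = (\<Oplus>\<^bsub>M\<^esub>i\<in>I. a \<odot>\<^bsub>M\<^esub> (f i x \<odot>\<^bsub>M\<^esub> m i))"
    using a x m' F by (intro M.M.finsum_cong') (auto simp: M.smult_assoc)
  then show "(\<Oplus>\<^bsub>M\<^esub>i\<in>I. f i (a \<odot>\<^bsub>P\<^esub> x) \<odot>\<^bsub>M\<^esub> m i) = a \<odot>\<^bsub>M\<^esub> (\<Oplus>\<^bsub>M\<^esub>i\<in>I. f i x \<odot>\<^bsub>M\<^esub> m i)"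
    using a x m' F \<open>finite I\<close> by (simp add: M.finsum_smult_r Pi_iff)
qed

text \<open>The data of the dual basis lemma: finite generation and projectivity by
  coordinate functionals. Unlike the lifting property, they can be transported explicitly along
  functors. The index type is arbitrary because restriction of scalars replaces \<open>I\<close> by \<open>I \<times> B\<close>.\<close>

definition dual_basis ::
  "('a, 'r) ring_scheme \<Rightarrow> ('a, 'c) module \<Rightarrow> 'i set \<Rightarrow> ('i \<Rightarrow> 'c) \<Rightarrow> ('i \<Rightarrow> 'c \<Rightarrow> 'a) \<Rightarrow> bool" where
  "dual_basis A P I e f \<longleftrightarrow> finite I \<and> e \<in> I \<rightarrow> carrier P \<and>
     f \<in> I \<rightarrow> module_hom A P (regular_module A) \<and>
     (\<forall>x\<in>carrier P. x = (\<Oplus>\<^bsub>P\<^esub>i\<in>I. f i x \<odot>\<^bsub>P\<^esub> e i))"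

lemma dual_basisD:
  assumes "dual_basis A P I e f"
  shows "finite I" "\<And>i. i \<in> I \<Longrightarrow> e i \<in> carrier P"
    "\<And>i x. i \<in> I \<Longrightarrow> x \<in> carrier P \<Longrightarrow> f i x \<in> carrier A"
    "\<And>i x y. i \<in> I \<Longrightarrow> x \<in> carrier P \<Longrightarrow> y \<in> carrier P \<Longrightarrow> f i (x \<oplus>\<^bsub>P\<^esub> y) = f i x \<oplus>\<^bsub>A\<^esub> f i y"
    "\<And>i a x. i \<in> I \<Longrightarrow> a \<in> carrier A \<Longrightarrow> x \<in> carrier P \<Longrightarrow> f i (a \<odot>\<^bsub>P\<^esub> x) = a \<otimes>\<^bsub>A\<^esub> f i x"
    "\<And>x. x \<in> carrier P \<Longrightarrow> (\<Oplus>\<^bsub>P\<^esub>i\<in>I. f i x \<odot>\<^bsub>P\<^esub> e i) = x"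
    "f \<in> I \<rightarrow> module_hom A P (regular_module A)" "e \<in> I \<rightarrow> carrier P"
proof -
  show f: "f \<in> I \<rightarrow> module_hom A P (regular_module A)" "e \<in> I \<rightarrow> carrier P" "finite I"
    using assms by (auto simp: dual_basis_def)
  note F = module_homD[OF funcset_mem[OF f(1)], simplified]
  show "\<And>i. i \<in> I \<Longrightarrow> e i \<in> carrier P"
    "\<And>i x. i \<in> I \<Longrightarrow> x \<in> carrier P \<Longrightarrow> f i x \<in> carrier A"
    "\<And>i x y. i \<in> I \<Longrightarrow> x \<in> carrier P \<Longrightarrow> y \<in> carrier P \<Longrightarrow> f i (x \<oplus>\<^bsub>P\<^esub> y) = f i x \<oplus>\<^bsub>A\<^esub> f i y"
    "\<And>i a x. i \<in> I \<Longrightarrow> a \<in> carrier A \<Longrightarrow> x \<in> carrier P \<Longrightarrow> f i (a \<odot>\<^bsub>P\<^esub> x) = a \<otimes>\<^bsub>A\<^esub> f i x"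
    using f(2) F by auto
  show "\<And>x. x \<in> carrier P \<Longrightarrow> (\<Oplus>\<^bsub>P\<^esub>i\<in>I. f i x \<odot>\<^bsub>P\<^esub> e i) = x"
    using assms unfolding dual_basis_def by metis
qed

lemma dual_basis_fg:
  assumes P: "left_module A P" and db: "dual_basis A P I e f"
  shows "fg_module A P"
proof -
  interpret P: left_module A P by fact
  note D = dual_basisD[OF db]
  have "N = carrier P" if N: "submodule N A P" "e ` I \<subseteq> N" for N
  proof
    show "N \<subseteq> carrier P" by (rule P.submoduleD(1)[OF N(1)])
    show "carrier P \<subseteq> N"
    proof
      fix x assume x: "x \<in> carrier P"
      have "(\<Oplus>\<^bsub>P\<^esub>i\<in>I. f i x \<odot>\<^bsub>P\<^esub> e i) \<in> N"
        using D(3) x N(2) by (intro P.submodule_finsum[OF N(1)]) (auto intro!: P.submoduleD(5)[OF N(1)])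
      then show "x \<in> N" using D(6)[OF x] by simp
    qed
  qed
  then show ?thesis
    unfolding fg_module_iff[OF P] using D(1,2) by (intro exI[of _ "e ` I"]) auto
qed

lemma dual_basis_projective:
  assumes P: "left_module A P" and db: "dual_basis A P I e f"
  shows "projective_module A P"
  unfolding projective_module_def
proof (intro conjI allI impI dual_basis_fg[OF assms])
  interpret P: left_module A P by fact
  note D = dual_basisD[OF db]
  fix M N :: "'a umodule" and g h
  assume *: "fg_module A M \<and> fg_module A N \<and> g \<in> module_hom A M N \<and> g ` carrier M = carrier N \<and>
    h \<in> module_hom A P N"
  then have g: "g \<in> module_hom A M N" "g ` carrier M = carrier N" and h: "h \<in> module_hom A P N"
    by auto
  interpret M: left_module A M using * by (simp add: fg_module_left_module)
  interpret N: left_module A N using * by (simp add: fg_module_left_module)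
  have "\<exists>m\<in>carrier M. g m = h (e i)" if "i \<in> I" for i
    using g(2) module_homD(1)[OF h D(2)[OF that]] by (metis imageE)
  then obtain m where m: "\<And>i. i \<in> I \<Longrightarrow> m i \<in> carrier M" "\<And>i. i \<in> I \<Longrightarrow> g (m i) = h (e i)"
    by metis
  define l where "l x = (\<Oplus>\<^bsub>M\<^esub>i\<in>I. f i x \<odot>\<^bsub>M\<^esub> m i)" for x
  have "l \<in> module_hom A P M"
    unfolding l_def
    using m(1) by (intro linear_combination_hom[OF P M.left_module_axioms D(1,7)]) auto
  moreover have "g (l x) = h x" if x: "x \<in> carrier P" for x
  proof -
    have "g (l x) = (\<Oplus>\<^bsub>N\<^esub>i\<in>I. g (f i x \<odot>\<^bsub>M\<^esub> m i))"
      unfolding l_def using x m D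
      by (intro module_hom_finsum[OF M.left_module_axioms N.left_module_axioms g(1)]) auto
    also have "\<dots> = (\<Oplus>\<^bsub>N\<^esub>i\<in>I. h (f i x \<odot>\<^bsub>P\<^esub> e i))"
      using x m D module_homD[OF h] module_homD[OF g(1)] by (intro N.M.finsum_cong') auto
    also have "\<dots> = h (\<Oplus>\<^bsub>P\<^esub>i\<in>I. f i x \<odot>\<^bsub>P\<^esub> e i)"
      using x D by (intro module_hom_finsum[OF P.left_module_axioms N.left_module_axioms h, symmetric]) auto
    finally show ?thesis using D(6)[OF x] by simp
  qed
  ultimately show "\<exists>l\<in>module_hom A P M. \<forall>x\<in>carrier P. g (l x) = h x" by blast
qed

text \<open>The scalar action is a parameter: acting on each coordinate gives free modules, and
  acting by matrices gives induced modules.\<close>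

definition fun_module ::
  "'i set \<Rightarrow> ('c, 'm) ring_scheme \<Rightarrow> ('a \<Rightarrow> ('i \<Rightarrow> 'c) \<Rightarrow> 'i \<Rightarrow> 'c) \<Rightarrow> ('a, 'i \<Rightarrow> 'c) module" where
  "fun_module I M act = \<lparr>carrier = I \<rightarrow>\<^sub>E carrier M, monoid.mult = undefined, one = undefined,
     ring.zero = (\<lambda>i\<in>I. \<zero>\<^bsub>M\<^esub>), ring.add = (\<lambda>u v. \<lambda>i\<in>I. u i \<oplus>\<^bsub>M\<^esub> v i), smult = act\<rparr>"

lemma fun_module_simps [simp]:
  "carrier (fun_module I M act) = I \<rightarrow>\<^sub>E carrier M"
  "\<zero>\<^bsub>fun_module I M act\<^esub> = (\<lambda>i\<in>I. \<zero>\<^bsub>M\<^esub>)"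
  "u \<oplus>\<^bsub>fun_module I M act\<^esub> v = (\<lambda>i\<in>I. u i \<oplus>\<^bsub>M\<^esub> v i)"
  "a \<odot>\<^bsub>fun_module I M act\<^esub> u = act a u"
  by (simp_all add: fun_module_def)

lemma fun_module_abelian_group:
  assumes "abelian_group M"
  shows "abelian_group (fun_module I M act)"
proof -
  interpret M: abelian_group M by fact
  show ?thesis
  proof (rule abelian_groupI)
    fix u assume u: "u \<in> carrier (fun_module I M act)"
    then show "\<exists>v\<in>carrier (fun_module I M act). v \<oplus>\<^bsub>fun_module I M act\<^esub> u = \<zero>\<^bsub>fun_module I M act\<^esub>"
      by (intro bexI[of _ "\<lambda>i\<in>I. \<ominus>\<^bsub>M\<^esub> u i"]) (auto simp: PiE_iff M.l_neg intro!: restrict_ext)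
    show "\<zero>\<^bsub>fun_module I M act\<^esub> \<oplus>\<^bsub>fun_module I M act\<^esub> u = u"
      using u by (auto simp: PiE_iff fun_eq_iff extensional_def restrict_def)
  qed (auto simp: PiE_iff M.a_ac intro!: restrict_ext)
qed

lemma fun_module_finsum:
  assumes M: "abelian_group M" and "finite J" "h \<in> J \<rightarrow> (I \<rightarrow>\<^sub>E carrier M)" "i \<in> I"
  shows "(\<Oplus>\<^bsub>fun_module I M act\<^esub>j\<in>J. h j) i = (\<Oplus>\<^bsub>M\<^esub>j\<in>J. h j i)"
  using assms by (intro additive_finsum[OF fun_module_abelian_group[OF M] M, of "\<lambda>u. u i"])
    (auto simp: PiE_iff)

text \<open>Lift the identity of \<open>P\<close> along a free cover; the coordinates of the lift are the
  functionals.\<close>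

lemma projective_dual_basis:
  fixes P :: "'a umodule"
  assumes "projective_module A P"
  shows "\<exists>G f. dual_basis A P G (\<lambda>x. x) f"
proof -
  have fgP: "fg_module A P" using assms by (simp add: projective_module_def)
  interpret P: left_module A P using fgP by (rule fg_module_left_module)
  obtain G where G: "finite G" "G \<subseteq> carrier P"
    and gen: "carrier P = {(\<Oplus>\<^bsub>P\<^esub>g\<in>G. c g \<odot>\<^bsub>P\<^esub> g) | c. c \<in> G \<rightarrow> carrier A}"
    using fgP by (auto simp: fg_module_def)
  have GP: "\<And>g. g \<in> G \<Longrightarrow> g \<in> carrier P" using G by auto
  define F where "F = fun_module G A (\<lambda>a u. \<lambda>g\<in>G. a \<otimes>\<^bsub>A\<^esub> u g)"
  note ab = P.R.abelian_group_axioms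
  have F: "left_module A F"
    unfolding F_def
    by (intro left_module.intro left_module_axioms.intro P.R.ring_axioms fun_module_abelian_group ab)
      (auto simp: PiE_iff P.R.l_distr P.R.r_distr P.R.m_assoc fun_eq_iff extensional_def)
  interpret F: left_module A F by fact
  have Fc: "carrier F = G \<rightarrow>\<^sub>E carrier A" by (simp add: F_def)
  define unit where "unit g = (\<lambda>h\<in>G. if h = g then \<one>\<^bsub>A\<^esub> else \<zero>\<^bsub>A\<^esub>)" for g
  have unit: "unit g \<in> carrier F" for g by (auto simp: F_def unit_def)
  have F_fin: "(\<Oplus>\<^bsub>F\<^esub>g\<in>G. u g \<odot>\<^bsub>F\<^esub> unit g) = u" if u: "u \<in> carrier F" for u
  proof (rule extensionalityI[of _ G])
    have closed: "(\<lambda>g. u g \<odot>\<^bsub>F\<^esub> unit g) \<in> G \<rightarrow> carrier F"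
      using u unit unfolding Fc by (auto simp: PiE_mem intro!: F.smult_closed[unfolded Fc])
    then show "(\<Oplus>\<^bsub>F\<^esub>g\<in>G. u g \<odot>\<^bsub>F\<^esub> unit g) \<in> extensional G"
      using F.M.finsum_closed Fc by (auto simp: PiE_iff)
    show "u \<in> extensional G" using u Fc by (auto simp: PiE_iff)
    fix h assume h: "h \<in> G"
    have "(\<Oplus>\<^bsub>F\<^esub>g\<in>G. u g \<odot>\<^bsub>F\<^esub> unit g) h = (\<Oplus>\<^bsub>A\<^esub>g\<in>G. (u g \<odot>\<^bsub>F\<^esub> unit g) h)"
      using closed Fc G(1) h unfolding F_def by (intro fun_module_finsum ab) auto
    also have "\<dots> = (\<Oplus>\<^bsub>A\<^esub>g\<in>G. if h = g then u g else \<zero>\<^bsub>A\<^esub>)"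
      using u h Fc by (intro P.R.finsum_cong') (auto simp: F_def unit_def PiE_iff)
    also have "\<dots> = u h"
      using P.R.finsum_singleton[OF h G(1), of u] u Fc by (auto simp: PiE_iff)
    finally show "(\<Oplus>\<^bsub>F\<^esub>g\<in>G. u g \<odot>\<^bsub>F\<^esub> unit g) h = u h" .
  qed
  have "fg_module A F"
    unfolding fg_module_iff[OF F]
  proof (intro exI[of _ "unit ` G"] conjI allI impI)
    fix N assume N: "submodule N A F \<and> unit ` G \<subseteq> N"
    then have N': "submodule N A F" by simp
    have "u \<in> N" if u: "u \<in> carrier F" for u
    proof -
      have "(\<Oplus>\<^bsub>F\<^esub>g\<in>G. u g \<odot>\<^bsub>F\<^esub> unit g) \<in> N"
        using N u Fc by (intro F.submodule_finsum[OF N']) (auto intro!: F.submoduleD(5)[OF N'] simp: PiE_iff)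
      then show ?thesis using F_fin[OF u] by simp
    qed
    then show "N = carrier F" using F.submoduleD(1)[OF N'] by blast
  qed (use G unit in auto)
  then obtain C :: "'a umodule" and \<theta> where C: "fg_module A C"
    and \<theta>: "\<theta> \<in> module_hom A F C" "bij_betw \<theta> (carrier F) (carrier C)"
    using fg_module_copy unfolding module_iso_def by metis
  interpret C: left_module A C using C by (rule fg_module_left_module)
  let ?\<theta>' = "the_inv_into (carrier F) \<theta>"
  note \<theta>' = module_hom_inverse[OF \<theta>(1) F \<theta>(2)]
  define ev where "ev u = (\<Oplus>\<^bsub>P\<^esub>g\<in>G. u g \<odot>\<^bsub>P\<^esub> g)" for u
  have coord: "(\<lambda>u. u g) \<in> module_hom A F (regular_module A)" if "g \<in> G" for g
    using that by (auto simp: F_def module_hom_def PiE_iff)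
  have ev: "ev \<in> module_hom A F P"
    unfolding ev_def using GP coord by (intro linear_combination_hom[OF F P.left_module_axioms G(1)]) auto
  have "(ev \<circ> ?\<theta>') ` carrier C = carrier P"
  proof
    show "(ev \<circ> ?\<theta>') ` carrier C \<subseteq> carrier P"
      using module_homD(1)[OF module_hom_comp[OF \<theta>' ev]] by auto
    show "carrier P \<subseteq> (ev \<circ> ?\<theta>') ` carrier C"
    proof
      fix x assume "x \<in> carrier P"
      then obtain c where c: "c \<in> G \<rightarrow> carrier A" "x = (\<Oplus>\<^bsub>P\<^esub>g\<in>G. c g \<odot>\<^bsub>P\<^esub> g)"
        using gen by blast
      have r: "restrict c G \<in> carrier F" using c(1) Fc by auto
      have "ev (restrict c G) = x"
        unfolding ev_def c(2) using c(1) GP by (intro P.M.finsum_cong') auto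
      moreover have "?\<theta>' (\<theta> (restrict c G)) = restrict c G"
        using \<theta>(2) r by (simp add: bij_betw_def the_inv_into_f_f)
      ultimately have "x = (ev \<circ> ?\<theta>') (\<theta> (restrict c G))" by simp
      then show "x \<in> (ev \<circ> ?\<theta>') ` carrier C" using module_homD(1)[OF \<theta>(1) r] by blast
    qed
  qed
  then obtain h where h: "h \<in> module_hom A P C" "\<And>x. x \<in> carrier P \<Longrightarrow> (ev \<circ> ?\<theta>') (h x) = x"
    using assms C fgP module_hom_comp[OF \<theta>' ev] module_hom_id[of A P]
    unfolding projective_module_def by meson
  have "dual_basis A P G (\<lambda>x. x) (\<lambda>g x. (?\<theta>' \<circ> h) x g)"
    unfolding dual_basis_def
  proof (intro conjI ballI)
    show "finite G" by fact
    show "(\<lambda>x. x) \<in> G \<rightarrow> carrier P" using GP by auto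
    show "(\<lambda>g x. (?\<theta>' \<circ> h) x g) \<in> G \<rightarrow> module_hom A P (regular_module A)"
      using module_hom_comp[OF module_hom_comp[OF h(1) \<theta>'] coord] by (simp add: comp_def)
  next
    fix x assume "x \<in> carrier P"
    then show "x = (\<Oplus>\<^bsub>P\<^esub>g\<in>G. (?\<theta>' \<circ> h) x g \<odot>\<^bsub>P\<^esub> g)"
      using h(2)[of x] by (simp add: ev_def)
  qed
  then show ?thesis by blast
qed

lemma dual_basis_iso:
  assumes P: "left_module A P" and Q: "left_module A Q" and db: "dual_basis A P I e f"
    and \<theta>: "\<theta> \<in> module_hom A P Q" and \<theta>': "\<theta>' \<in> module_hom A Q P"
    and inv: "\<And>y. y \<in> carrier Q \<Longrightarrow> \<theta> (\<theta>' y) = y"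
  shows "dual_basis A Q I (\<lambda>i. \<theta> (e i)) (\<lambda>i y. f i (\<theta>' y))"
proof -
  interpret P: left_module A P by fact
  interpret Q: left_module A Q by fact
  note D = dual_basisD[OF db] and T = module_homD[OF \<theta>] and T' = module_homD[OF \<theta>']
  have "(\<Oplus>\<^bsub>Q\<^esub>i\<in>I. f i (\<theta>' y) \<odot>\<^bsub>Q\<^esub> \<theta> (e i)) = y" if y: "y \<in> carrier Q" for y
  proof -
    have "(\<Oplus>\<^bsub>Q\<^esub>i\<in>I. f i (\<theta>' y) \<odot>\<^bsub>Q\<^esub> \<theta> (e i)) = (\<Oplus>\<^bsub>Q\<^esub>i\<in>I. \<theta> (f i (\<theta>' y) \<odot>\<^bsub>P\<^esub> e i))"
      using D T T' y by (intro Q.M.finsum_cong') auto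
    also have "\<dots> = \<theta> (\<Oplus>\<^bsub>P\<^esub>i\<in>I. f i (\<theta>' y) \<odot>\<^bsub>P\<^esub> e i)"
      using D T' y by (intro module_hom_finsum[OF P Q \<theta>, symmetric]) auto
    finally show ?thesis using D(6)[OF T'(1)[OF y]] inv[OF y] by simp
  qed
  then show ?thesis
    unfolding dual_basis_def using D(1-5) T T' by (auto intro!: module_homI)
qed

lemma mem_Omega_0: "K \<in> Omega A 0 \<longleftrightarrow> fg_module A K"
  using module_iso_refl by (auto simp: Omega_def nth_syzygy_def)

lemma filter_image_eq:
  assumes "\<theta> ` U = V" "\<And>x. x \<in> U \<Longrightarrow> p (\<theta> x) \<longleftrightarrow> q x"
  shows "{y \<in> V. p y} = \<theta> ` {x \<in> U. q x}"
  using assms by auto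

text \<open>The definition of syzygies fixes the type of the elements of all modules in a
  resolution. Here the type is arbitrary, and the resolution is copied into the prescribed one.\<close>

lemma Omega_SucI:
  fixes A :: "('a, 'r) ring_scheme" and P :: "nat \<Rightarrow> ('a, 'd) module" and Q :: "('a, 'e) module"
    and K :: "'a umodule" and I :: "nat \<Rightarrow> 'i set"
  assumes Q: "fg_module A Q" and P: "\<And>i. left_module A (P i)"
    and db: "\<And>i. dual_basis A (P i) (I i) (e i) (f i)"
    and d: "\<And>i. d i \<in> module_hom A (P (Suc i)) (P i)"
    and \<epsilon>: "\<epsilon> \<in> module_hom A (P 0) Q" "\<epsilon> ` carrier (P 0) = carrier Q"
    and ex0: "d 0 ` carrier (P 1) = {x \<in> carrier (P 0). \<epsilon> x = \<zero>\<^bsub>Q\<^esub>}"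
    and ex: "\<And>i. d (Suc i) ` carrier (P (Suc (Suc i))) = {x \<in> carrier (P (Suc i)). d i x = \<zero>\<^bsub>P i\<^esub>}"
    and K: "fg_module A K" and \<kappa>: "\<kappa> \<in> module_hom A K (P m)" "inj_on \<kappa> (carrier K)"
      "\<kappa> ` carrier K = d m ` carrier (P (Suc m))"
  shows "K \<in> Omega A (Suc m)"
proof -
  have "\<exists>C :: 'a umodule. \<exists>\<theta>. fg_module A C \<and> \<theta> \<in> module_hom A (P i) C \<and>
      bij_betw \<theta> (carrier (P i)) (carrier C)" for i
    using fg_module_copy[OF dual_basis_fg[OF P db], of i] unfolding module_iso_def by blast
  then obtain C :: "nat \<Rightarrow> 'a umodule" and \<theta> where C: "\<And>i. fg_module A (C i)"
    and \<theta>: "\<And>i. \<theta> i \<in> module_hom A (P i) (C i)"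
    and bij: "\<And>i. bij_betw (\<theta> i) (carrier (P i)) (carrier (C i))"
    by metis
  obtain Q' :: "'a umodule" and \<xi> where Q': "fg_module A Q'" and \<xi>: "\<xi> \<in> module_hom A Q Q'"
    "bij_betw \<xi> (carrier Q) (carrier Q')"
    using fg_module_copy[OF Q] unfolding module_iso_def by blast
  note lC = fg_module_left_module[OF C] and lQ = fg_module_left_module[OF Q]
    and lQ' = fg_module_left_module[OF Q']
  define \<theta>' where "\<theta>' i = the_inv_into (carrier (P i)) (\<theta> i)" for i
  have \<theta>': "\<theta>' i \<in> module_hom A (C i) (P i)" for i
    unfolding \<theta>'_def by (rule module_hom_inverse[OF \<theta> P bij])
  have inv: "\<theta> i (\<theta>' i y) = y" if "y \<in> carrier (C i)" for i y
    using f_the_inv_into_f_bij_betw[OF bij] that by (simp add: \<theta>'_def)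
  have inv': "\<theta>' i (\<theta> i x) = x" if "x \<in> carrier (P i)" for i x
    using bij that by (simp add: \<theta>'_def the_inv_into_f_f bij_betw_def)
  have im\<theta>: "\<theta> i ` carrier (P i) = carrier (C i)" for i using bij by (simp add: bij_betw_def)
  define d' where "d' i = (\<theta> i \<circ> d i) \<circ> \<theta>' (Suc i)" for i
  define \<epsilon>' where "\<epsilon>' = (\<xi> \<circ> \<epsilon>) \<circ> \<theta>' 0"
  have d': "d' i \<in> module_hom A (C (Suc i)) (C i)" for i
    unfolding d'_def by (rule module_hom_comp[OF \<theta>' module_hom_comp[OF d \<theta>]])
  have \<epsilon>': "\<epsilon>' \<in> module_hom A (C 0) Q'"
    unfolding \<epsilon>'_def by (rule module_hom_comp[OF \<theta>' module_hom_comp[OF \<epsilon>(1) \<xi>(1)]])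
  have im': "\<theta>' i ` carrier (C i) = carrier (P i)" for i
  proof
    show "\<theta>' i ` carrier (C i) \<subseteq> carrier (P i)" using module_homD(1)[OF \<theta>'] by auto
    show "carrier (P i) \<subseteq> \<theta>' i ` carrier (C i)"
      using inv' module_homD(1)[OF \<theta>] by (metis image_eqI subsetI)
  qed
  have zP: "\<zero>\<^bsub>P i\<^esub> \<in> carrier (P i)" for i
    using left_module.submoduleD(2)[OF P left_module.submodule_carrier[OF P]] .
  have zQ: "\<zero>\<^bsub>Q\<^esub> \<in> carrier Q"
    using left_module.submoduleD(2)[OF lQ left_module.submodule_carrier[OF lQ]] .
  have imd': "d' i ` carrier (C (Suc i)) = \<theta> i ` d i ` carrier (P (Suc i))" for i
    unfolding d'_def image_comp[symmetric] im' ..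
  have ker_d': "{y \<in> carrier (C (Suc i)). d' i y = \<zero>\<^bsub>C i\<^esub>} = \<theta> (Suc i) ` {x \<in> carrier (P (Suc i)). d i x = \<zero>\<^bsub>P i\<^esub>}"
    (is "?L = ?R") for i
  proof -
    have z: "d' i (\<theta> (Suc i) x) = \<zero>\<^bsub>C i\<^esub> \<longleftrightarrow> d i x = \<zero>\<^bsub>P i\<^esub>" if x: "x \<in> carrier (P (Suc i))" for x
    proof
      assume "d' i (\<theta> (Suc i) x) = \<zero>\<^bsub>C i\<^esub>"
      then have "\<theta> i (d i x) = \<theta> i \<zero>\<^bsub>P i\<^esub>"
        using x by (simp add: d'_def inv' module_hom_zero[OF P lC \<theta>])
      then show "d i x = \<zero>\<^bsub>P i\<^esub>"
        using inv'[OF module_homD(1)[OF d x]] inv'[OF zP[of i]] by (metis (no_types))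
    qed (simp add: x d'_def inv' module_hom_zero[OF P lC \<theta>])
    show ?thesis by (intro filter_image_eq im\<theta> z)
  qed
  have ker_\<epsilon>': "{y \<in> carrier (C 0). \<epsilon>' y = \<zero>\<^bsub>Q'\<^esub>} = \<theta> 0 ` {x \<in> carrier (P 0). \<epsilon> x = \<zero>\<^bsub>Q\<^esub>}"
  proof -
    have z: "\<epsilon>' (\<theta> 0 x) = \<zero>\<^bsub>Q'\<^esub> \<longleftrightarrow> \<epsilon> x = \<zero>\<^bsub>Q\<^esub>" if x: "x \<in> carrier (P 0)" for x
    proof
      assume "\<epsilon>' (\<theta> 0 x) = \<zero>\<^bsub>Q'\<^esub>"
      then have "\<xi> (\<epsilon> x) = \<xi> \<zero>\<^bsub>Q\<^esub>"
        using x by (simp add: \<epsilon>'_def inv' module_hom_zero[OF lQ lQ' \<xi>(1)])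
      then show "\<epsilon> x = \<zero>\<^bsub>Q\<^esub>"
        using bij_betw_imp_inj_on[OF \<xi>(2)] module_homD(1)[OF \<epsilon>(1) x] zQ by (auto dest: inj_onD)
    qed (simp add: x \<epsilon>'_def inv' module_hom_zero[OF lQ lQ' \<xi>(1)])
    show ?thesis by (intro filter_image_eq im\<theta> z)
  qed
  have "projective_module A (C i)" for i
    by (rule dual_basis_projective[OF lC dual_basis_iso[OF P lC db \<theta> \<theta>' inv]])
  then have "projective_resolution A C d' \<epsilon>' Q'"
    unfolding projective_resolution_def
  proof (intro conjI allI)
    show "\<epsilon>' ` carrier (C 0) = carrier Q'"
      unfolding \<epsilon>'_def image_comp[symmetric] im' \<epsilon>(2) using \<xi>(2) by (simp add: bij_betw_def)
    show "d' 0 ` carrier (C 1) = {x \<in> carrier (C 0). \<epsilon>' x = \<zero>\<^bsub>Q'\<^esub>}"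
      using imd'[of 0] ex0 ker_\<epsilon>' by simp
    show "d' (Suc i) ` carrier (C (Suc (Suc i))) = {x \<in> carrier (C (Suc i)). d' i x = \<zero>\<^bsub>C i\<^esub>}" for i
      using imd'[of "Suc i"] ex ker_d' by simp
  qed (use d' \<epsilon>' in auto)
  moreover have "module_iso A K (C m\<lparr>carrier := d' m ` carrier (C (Suc m))\<rparr>)"
  proof -
    have im: "(\<theta> m \<circ> \<kappa>) ` carrier K = d' m ` carrier (C (Suc m))"
      unfolding imd' image_comp[symmetric] \<kappa>(3) ..
    have "\<kappa> ` carrier K \<subseteq> carrier (P m)" using module_homD(1)[OF \<kappa>(1)] by auto
    then have "inj_on (\<theta> m \<circ> \<kappa>) (carrier K)"
      using \<kappa>(2) bij[of m] by (auto simp: bij_betw_def intro!: comp_inj_on intro: inj_on_subset)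
    then show ?thesis
      using module_hom_corestrict[OF module_hom_comp[OF \<kappa>(1) \<theta>]] im
      unfolding module_iso_def bij_betw_def by (intro bexI[of _ "\<theta> m \<circ> \<kappa>"]) auto
  qed
  ultimately show ?thesis
    using K Q' unfolding Omega_def nth_syzygy_def by auto
qed

section \<open>Ring extensions with a normal basis\<close>

text \<open>Left and right bases are both covered, with \<open>act b r\<close> equal to \<open>r b\<close> or to \<open>b r\<close>.\<close>

lemma basis_coordinates:
  fixes act :: "'b \<Rightarrow> 'a \<Rightarrow> 'a"
  assumes S: "ring S" and R: "subring R S" and B: "finite B"
    and act: "\<And>b r. b \<in> B \<Longrightarrow> r \<in> R \<Longrightarrow> act b r \<in> carrier S"
    and add: "\<And>b r r'. b \<in> B \<Longrightarrow> r \<in> R \<Longrightarrow> r' \<in> R \<Longrightarrow> act b (r \<oplus>\<^bsub>S\<^esub> r') = act b r \<oplus>\<^bsub>S\<^esub> act b r'"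
    and span: "carrier S = {(\<Oplus>\<^bsub>S\<^esub>b\<in>B. act b (c b)) | c. c \<in> B \<rightarrow> R}"
    and indep: "\<forall>c. c \<in> B \<rightarrow> R \<and> (\<Oplus>\<^bsub>S\<^esub>b\<in>B. act b (c b)) = \<zero>\<^bsub>S\<^esub> \<longrightarrow> (\<forall>b\<in>B. c b = \<zero>\<^bsub>S\<^esub>)"
  shows "\<exists>co. (\<forall>b\<in>B. \<forall>s\<in>carrier S. co b s \<in> R) \<and>
    (\<forall>s\<in>carrier S. (\<Oplus>\<^bsub>S\<^esub>b\<in>B. act b (co b s)) = s) \<and>
    (\<forall>c s. \<forall>b\<in>B. c \<in> B \<rightarrow> R \<longrightarrow> (\<Oplus>\<^bsub>S\<^esub>b\<in>B. act b (c b)) = s \<longrightarrow> co b s = c b)"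
proof -
  interpret S: ring S by fact
  note E = subringE[OF R]
  have RS: "\<And>r. r \<in> R \<Longrightarrow> r \<in> carrier S" using E(1) by auto
  have "\<exists>c. c \<in> B \<rightarrow> R \<and> (\<Oplus>\<^bsub>S\<^esub>b\<in>B. act b (c b)) = s" if "s \<in> carrier S" for s
    using that unfolding span by auto
  then obtain c where c: "\<And>s. s \<in> carrier S \<Longrightarrow> c s \<in> B \<rightarrow> R"
    "\<And>s. s \<in> carrier S \<Longrightarrow> (\<Oplus>\<^bsub>S\<^esub>b\<in>B. act b (c s b)) = s"
    by metis
  have uniq: "c1 b = c2 b"
    if c1: "c1 \<in> B \<rightarrow> R" and c2: "c2 \<in> B \<rightarrow> R" and b: "b \<in> B"
      and eq: "(\<Oplus>\<^bsub>S\<^esub>b\<in>B. act b (c1 b)) = (\<Oplus>\<^bsub>S\<^esub>b\<in>B. act b (c2 b))" for c1 c2 b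
  proof -
    let ?d = "\<lambda>b. c1 b \<oplus>\<^bsub>S\<^esub> \<ominus>\<^bsub>S\<^esub> c2 b"
    have d: "?d \<in> B \<rightarrow> R" using c1 c2 E(5,7) by (simp add: Pi_iff)
    have dR: "?d b \<in> R" if "b \<in> B" for b using d that by auto
    have "(\<Oplus>\<^bsub>S\<^esub>b\<in>B. act b (c1 b)) = (\<Oplus>\<^bsub>S\<^esub>b\<in>B. act b (?d b) \<oplus>\<^bsub>S\<^esub> act b (c2 b))"
    proof (intro S.finsum_cong')
      fix b assume b: "b \<in> B"
      have "c1 b = ?d b \<oplus>\<^bsub>S\<^esub> c2 b"
        using b c1 c2 RS by (auto simp: S.a_assoc S.l_neg Pi_iff)
      moreover have "act b (?d b \<oplus>\<^bsub>S\<^esub> c2 b) = act b (?d b) \<oplus>\<^bsub>S\<^esub> act b (c2 b)"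
        using add[OF b dR[OF b]] c2 b by auto
      ultimately show "act b (c1 b) = act b (?d b) \<oplus>\<^bsub>S\<^esub> act b (c2 b)" by simp
    qed (use act dR c2 in \<open>auto simp: Pi_iff\<close>)
    also have "\<dots> = (\<Oplus>\<^bsub>S\<^esub>b\<in>B. act b (?d b)) \<oplus>\<^bsub>S\<^esub> (\<Oplus>\<^bsub>S\<^esub>b\<in>B. act b (c2 b))"
      using act dR c2 by (intro S.finsum_addf) (auto simp: Pi_iff)
    finally have "(\<Oplus>\<^bsub>S\<^esub>b\<in>B. act b (?d b)) \<oplus>\<^bsub>S\<^esub> (\<Oplus>\<^bsub>S\<^esub>b\<in>B. act b (c2 b)) = (\<Oplus>\<^bsub>S\<^esub>b\<in>B. act b (c2 b))"
      using eq by simp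
    moreover have "(\<Oplus>\<^bsub>S\<^esub>b\<in>B. act b (?d b)) \<in> carrier S" "(\<Oplus>\<^bsub>S\<^esub>b\<in>B. act b (c2 b)) \<in> carrier S"
      using act dR c2 by (auto simp: Pi_iff intro!: S.finsum_closed)
    ultimately have "(\<Oplus>\<^bsub>S\<^esub>b\<in>B. act b (?d b)) = \<zero>\<^bsub>S\<^esub>"
      using S.add.r_cancel_one by blast
    then have "?d b = \<zero>\<^bsub>S\<^esub>" using indep d b by blast
    then show ?thesis
      using b c1 c2 RS S.minus_equality[of "c1 b" "\<ominus>\<^bsub>S\<^esub> c2 b"] by (simp add: Pi_iff)
  qed
  show ?thesis
  proof (intro exI[of _ "\<lambda>b s. c s b"] conjI ballI allI impI)
    fix c' s b
    assume c': "c' \<in> B \<rightarrow> R" "(\<Oplus>\<^bsub>S\<^esub>b\<in>B. act b (c' b)) = s" and b: "b \<in> B"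
    have "s \<in> carrier S" using c' unfolding span by auto
    then show "c s b = c' b" using uniq[OF c(1) c'(1) b] c(2) c'(2) by simp
  qed (use c in auto)
qed

lemma finsum_Times:
  assumes M: "abelian_group M" and "finite I" "finite J" "h \<in> I \<times> J \<rightarrow> carrier M"
  shows "(\<Oplus>\<^bsub>M\<^esub>ij\<in>I \<times> J. h ij) = (\<Oplus>\<^bsub>M\<^esub>i\<in>I. \<Oplus>\<^bsub>M\<^esub>j\<in>J. h (i, j))"
proof -
  interpret M: abelian_group M by fact
  show ?thesis
    using assms(2,4)
  proof (induction I rule: finite_induct)
    case (insert i I)
    have "(\<Oplus>\<^bsub>M\<^esub>ij\<in>insert i I \<times> J. h ij) = (\<Oplus>\<^bsub>M\<^esub>ij\<in>Pair i ` J \<union> I \<times> J. h ij)"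
      by (rule arg_cong[of _ _ "finsum M h"]) auto
    also have "\<dots> = (\<Oplus>\<^bsub>M\<^esub>ij\<in>Pair i ` J. h ij) \<oplus>\<^bsub>M\<^esub> (\<Oplus>\<^bsub>M\<^esub>ij\<in>I \<times> J. h ij)"
      using insert.hyps insert.prems assms(3) by (intro M.finsum_Un_disjoint) auto
    also have "(\<Oplus>\<^bsub>M\<^esub>ij\<in>Pair i ` J. h ij) = (\<Oplus>\<^bsub>M\<^esub>j\<in>J. h (i, j))"
      using insert.prems by (intro M.finsum_reindex) (auto simp: inj_on_def)
    also have "(\<Oplus>\<^bsub>M\<^esub>ij\<in>I \<times> J. h ij) = (\<Oplus>\<^bsub>M\<^esub>i\<in>I. \<Oplus>\<^bsub>M\<^esub>j\<in>J. h (i, j))"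
      using insert.IH insert.prems by auto
    finally show ?case
      using insert.hyps insert.prems
      by (subst M.finsum_insert) (auto simp: Pi_iff intro!: M.finsum_closed)
  qed simp
qed

text \<open>The part of an excellent extension that concerns the basis. The condition on direct
  summands enters in \<open>retract_Ind_of_summand_condition\<close> as a separate hypothesis.\<close>

locale normal_basis_extension = S?: ring S for S :: "('a, 'r) ring_scheme" (structure) +
  fixes R B :: "'a set"
  assumes subring: "subring R S" and finite_B: "finite B" and B_carrier: "B \<subseteq> carrier S"
    and left_basis: "left_basis S R B" and right_basis: "right_basis S R B"
    and normal: "\<And>b. b \<in> B \<Longrightarrow> R #> b = b <# R"
begin

abbreviation R' :: "('a, 'r) ring_scheme" where "R' \<equiv> S\<lparr>carrier := R\<rparr>"

lemma R'_ring: "ring R'"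
  by (rule subring_is_ring[OF subring])

lemma R_carrier [simp]: "r \<in> R \<Longrightarrow> r \<in> carrier S"
  using subringE(1)[OF subring] by auto

lemma B_in [simp]: "b \<in> B \<Longrightarrow> b \<in> carrier S"
  using B_carrier by auto

lemma R_closed [simp]: "\<one> \<in> R" "\<zero> \<in> R" "r \<in> R \<Longrightarrow> r' \<in> R \<Longrightarrow> r \<oplus> r' \<in> R"
  "r \<in> R \<Longrightarrow> r' \<in> R \<Longrightarrow> r \<otimes> r' \<in> R"
  using subringE[OF subring] by auto

lemma finsum_R':
  assumes "finite I" "h \<in> I \<rightarrow> R"
  shows "finsum R' h I = finsum S h I"
proof -
  interpret R': ring R' by (rule R'_ring)
  show ?thesis
    using additive_finsum[OF R'.abelian_group_axioms abelian_group_axioms, of "\<lambda>x. x" I h] assms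
    by auto
qed

lemma finsum_R: "h \<in> I \<rightarrow> R \<Longrightarrow> finsum S h I \<in> R"
proof (cases "finite I")
  case True
  interpret R': ring R' by (rule R'_ring)
  assume "h \<in> I \<rightarrow> R"
  then show ?thesis using R'.finsum_closed[of h I] finsum_R'[OF True] by simp
qed (simp add: finsum_infinite)

lemma exists_right_coordinates:
  "\<exists>co. (\<forall>b\<in>B. \<forall>s\<in>carrier S. co b s \<in> R) \<and> (\<forall>s\<in>carrier S. (\<Oplus>b\<in>B. b \<otimes> co b s) = s) \<and>
    (\<forall>c s. \<forall>b\<in>B. c \<in> B \<rightarrow> R \<longrightarrow> (\<Oplus>b\<in>B. b \<otimes> c b) = s \<longrightarrow> co b s = c b)"
  by (rule basis_coordinates[OF ring_axioms subring finite_B, of "\<lambda>b r. b \<otimes> r"])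
    (use right_basis in \<open>auto simp: r_distr right_basis_def\<close>)

lemma exists_left_coordinates:
  "\<exists>co. (\<forall>b\<in>B. \<forall>s\<in>carrier S. co b s \<in> R) \<and> (\<forall>s\<in>carrier S. (\<Oplus>b\<in>B. co b s \<otimes> b) = s) \<and>
    (\<forall>c s. \<forall>b\<in>B. c \<in> B \<rightarrow> R \<longrightarrow> (\<Oplus>b\<in>B. c b \<otimes> b) = s \<longrightarrow> co b s = c b)"
  by (rule basis_coordinates[OF ring_axioms subring finite_B, of "\<lambda>b r. r \<otimes> b"])
    (use left_basis in \<open>auto simp: l_distr left_basis_def\<close>)

definition right_coord :: "'a \<Rightarrow> 'a \<Rightarrow> 'a" where
  "right_coord = (SOME co. (\<forall>b\<in>B. \<forall>s\<in>carrier S. co b s \<in> R) \<and> (\<forall>s\<in>carrier S. (\<Oplus>b\<in>B. b \<otimes> co b s) = s) \<and>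
    (\<forall>c s. \<forall>b\<in>B. c \<in> B \<rightarrow> R \<longrightarrow> (\<Oplus>b\<in>B. b \<otimes> c b) = s \<longrightarrow> co b s = c b))"

definition left_coord :: "'a \<Rightarrow> 'a \<Rightarrow> 'a" where
  "left_coord = (SOME co. (\<forall>b\<in>B. \<forall>s\<in>carrier S. co b s \<in> R) \<and> (\<forall>s\<in>carrier S. (\<Oplus>b\<in>B. co b s \<otimes> b) = s) \<and>
    (\<forall>c s. \<forall>b\<in>B. c \<in> B \<rightarrow> R \<longrightarrow> (\<Oplus>b\<in>B. c b \<otimes> b) = s \<longrightarrow> co b s = c b))"

lemma right_coord_closed [simp]: "b \<in> B \<Longrightarrow> s \<in> carrier S \<Longrightarrow> right_coord b s \<in> R"
  and right_coord_sum: "s \<in> carrier S \<Longrightarrow> (\<Oplus>b\<in>B. b \<otimes> right_coord b s) = s"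
  and right_coord_unique: "c \<in> B \<rightarrow> R \<Longrightarrow> (\<Oplus>b\<in>B. b \<otimes> c b) = s \<Longrightarrow> b \<in> B \<Longrightarrow> right_coord b s = c b"
  using someI_ex[OF exists_right_coordinates, folded right_coord_def] by blast+

lemma left_coord_closed [simp]: "b \<in> B \<Longrightarrow> s \<in> carrier S \<Longrightarrow> left_coord b s \<in> R"
  and left_coord_sum: "s \<in> carrier S \<Longrightarrow> (\<Oplus>b\<in>B. left_coord b s \<otimes> b) = s"
  and left_coord_unique: "c \<in> B \<rightarrow> R \<Longrightarrow> (\<Oplus>b\<in>B. c b \<otimes> b) = s \<Longrightarrow> b \<in> B \<Longrightarrow> left_coord b s = c b"
  using someI_ex[OF exists_left_coordinates, folded left_coord_def] by blast+

lemma right_coord_add: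
  assumes "b \<in> B" "s \<in> carrier S" "t \<in> carrier S"
  shows "right_coord b (s \<oplus> t) = right_coord b s \<oplus> right_coord b t"
proof (rule right_coord_unique[OF _ _ assms(1)])
  have "(\<Oplus>b\<in>B. b \<otimes> (right_coord b s \<oplus> right_coord b t)) = (\<Oplus>b\<in>B. b \<otimes> right_coord b s \<oplus> b \<otimes> right_coord b t)"
    using assms by (intro finsum_cong') (auto simp: r_distr)
  also have "\<dots> = s \<oplus> t"
    using assms by (subst finsum_addf) (auto simp: right_coord_sum)
  finally show "(\<Oplus>b\<in>B. b \<otimes> (right_coord b s \<oplus> right_coord b t)) = s \<oplus> t" .
qed (use assms in auto)

lemma right_coord_mult:
  assumes "b \<in> B" "s \<in> carrier S" "r \<in> R"
  shows "right_coord b (s \<otimes> r) = right_coord b s \<otimes> r"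
proof (rule right_coord_unique[OF _ _ assms(1)])
  have "(\<Oplus>b\<in>B. b \<otimes> (right_coord b s \<otimes> r)) = (\<Oplus>b\<in>B. (b \<otimes> right_coord b s) \<otimes> r)"
    using assms by (intro finsum_cong') (auto simp: m_assoc)
  also have "\<dots> = s \<otimes> r"
    using assms finite_B by (subst finsum_ldistr[symmetric]) (auto simp: right_coord_sum)
  finally show "(\<Oplus>b\<in>B. b \<otimes> (right_coord b s \<otimes> r)) = s \<otimes> r" .
qed (use assms in auto)

lemma left_coord_add:
  assumes "b \<in> B" "s \<in> carrier S" "t \<in> carrier S"
  shows "left_coord b (s \<oplus> t) = left_coord b s \<oplus> left_coord b t"
proof (rule left_coord_unique[OF _ _ assms(1)])
  have "(\<Oplus>b\<in>B. (left_coord b s \<oplus> left_coord b t) \<otimes> b) = (\<Oplus>b\<in>B. left_coord b s \<otimes> b \<oplus> left_coord b t \<otimes> b)"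
    using assms by (intro finsum_cong') (auto simp: l_distr)
  also have "\<dots> = s \<oplus> t"
    using assms by (subst finsum_addf) (auto simp: left_coord_sum)
  finally show "(\<Oplus>b\<in>B. (left_coord b s \<oplus> left_coord b t) \<otimes> b) = s \<oplus> t" .
qed (use assms in auto)

lemma left_coord_mult:
  assumes "b \<in> B" "s \<in> carrier S" "r \<in> R"
  shows "left_coord b (r \<otimes> s) = r \<otimes> left_coord b s"
proof (rule left_coord_unique[OF _ _ assms(1)])
  have "(\<Oplus>b\<in>B. (r \<otimes> left_coord b s) \<otimes> b) = (\<Oplus>b\<in>B. r \<otimes> (left_coord b s \<otimes> b))"
    using assms by (intro finsum_cong') (auto simp: m_assoc)
  also have "\<dots> = r \<otimes> s"
    using assms finite_B by (subst finsum_rdistr[symmetric]) (auto simp: left_coord_sum)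
  finally show "(\<Oplus>b\<in>B. (r \<otimes> left_coord b s) \<otimes> b) = r \<otimes> s" .
qed (use assms in auto)

lemma right_coord_single:
  assumes "b \<in> B" "b' \<in> B" "r \<in> R"
  shows "right_coord b' (b \<otimes> r) = (if b' = b then r else \<zero>)"
proof (rule right_coord_unique[OF _ _ assms(2)])
  have "(\<Oplus>c\<in>B. c \<otimes> (if c = b then r else \<zero>)) = (\<Oplus>c\<in>B. if b = c then c \<otimes> r else \<zero>)"
    using assms by (intro finsum_cong') auto
  also have "\<dots> = b \<otimes> r"
    using finsum_singleton[OF assms(1) finite_B, of "\<lambda>c. c \<otimes> r"] assms by auto
  finally show "(\<Oplus>c\<in>B. c \<otimes> (if c = b then r else \<zero>)) = b \<otimes> r" .
qed (use assms in auto)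

lemma right_coord_basis:
  assumes "b \<in> B" "b' \<in> B"
  shows "right_coord b' b = (if b' = b then \<one> else \<zero>)"
  using right_coord_single[OF assms, of \<one>] assms by simp

text \<open>The coordinates of \<open>s t\<close> are obtained by applying the matrix of left
  multiplication by \<open>s\<close> to those of \<open>t\<close>.\<close>

lemma right_coord_mult_expand:
  assumes "b' \<in> B" "s \<in> carrier S" "t \<in> carrier S"
  shows "right_coord b' (s \<otimes> t) = (\<Oplus>b\<in>B. right_coord b' (s \<otimes> b) \<otimes> right_coord b t)"
proof -
  have "s \<otimes> t = (\<Oplus>b\<in>B. s \<otimes> (b \<otimes> right_coord b t))"
    using assms finite_B by (subst finsum_rdistr[symmetric]) (auto simp: right_coord_sum)
  then have "right_coord b' (s \<otimes> t) = right_coord b' (\<Oplus>b\<in>B. s \<otimes> (b \<otimes> right_coord b t))" by simp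
  also have "\<dots> = (\<Oplus>b\<in>B. right_coord b' (s \<otimes> (b \<otimes> right_coord b t)))"
    using assms finite_B by (intro additive_finsum abelian_group_axioms) (auto simp: right_coord_add)
  also have "\<dots> = (\<Oplus>b\<in>B. right_coord b' (s \<otimes> b) \<otimes> right_coord b t)"
  proof (intro finsum_cong')
    fix b assume "b \<in> B"
    then show "right_coord b' (s \<otimes> (b \<otimes> right_coord b t)) = right_coord b' (s \<otimes> b) \<otimes> right_coord b t"
      using assms by (subst m_assoc[symmetric]) (auto simp: right_coord_mult)
  qed (use assms in auto)
  finally show ?thesis .
qed

text \<open>The automorphism \<open>\<sigma>\<^sub>b\<close> of \<open>R\<close> with \<open>r b = b \<sigma>\<^sub>b(r)\<close>.\<close>

definition twist :: "'a \<Rightarrow> 'a \<Rightarrow> 'a" where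
  "twist b r = right_coord b (r \<otimes> b)"

lemma twist_closed [simp]: "b \<in> B \<Longrightarrow> r \<in> R \<Longrightarrow> twist b r \<in> R"
  by (simp add: twist_def)

lemma basis_twist:
  assumes "b \<in> B" "r \<in> R"
  shows "r \<otimes> b = b \<otimes> twist b r"
proof -
  have "r \<otimes> b \<in> b <# R"
    using assms normal[OF assms(1)] by (auto simp: r_coset_def)
  then obtain r' where r': "r' \<in> R" "r \<otimes> b = b \<otimes> r'" by (auto simp: l_coset_def)
  then have "twist b r = r'" using assms by (simp add: twist_def right_coord_single)
  then show ?thesis using r' by simp
qed

lemma twist_surj:
  assumes "b \<in> B"
  shows "twist b ` R = R"
proof
  show "twist b ` R \<subseteq> R" using assms by auto
  show "R \<subseteq> twist b ` R"
  proof
    fix r assume r: "r \<in> R"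
    then have "b \<otimes> r \<in> R #> b" using normal[OF assms] by (auto simp: l_coset_def)
    then obtain r' where r': "r' \<in> R" "b \<otimes> r = r' \<otimes> b" by (auto simp: r_coset_def)
    then have "twist b r' = r" using right_coord_single[OF assms assms r] by (simp add: twist_def)
    then show "r \<in> twist b ` R" using r'(1) by blast
  qed
qed

lemma right_coord_twist:
  assumes "b \<in> B" "b' \<in> B" "r \<in> R"
  shows "right_coord b' (r \<otimes> b) = (if b' = b then twist b r else \<zero>)"
  using assms by (simp add: basis_twist right_coord_single)

section \<open>Restriction of scalars\<close>

lemma restrict_left_module:
  assumes "left_module S M"
  shows "left_module R' M"
proof -
  interpret M: left_module S M by fact
  show ?thesis
    by (intro left_module.intro left_module_axioms.intro R'_ring M.M.abelian_group_axioms)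
      (auto simp: M.smult_l_distr M.smult_r_distr M.smult_assoc M.smult_one)
qed

lemma restrict_module_hom: "f \<in> module_hom S M N \<Longrightarrow> f \<in> module_hom R' M N"
  by (auto simp: module_hom_def)

lemma restrict_retract: "retract S M N \<Longrightarrow> retract R' M N"
  unfolding retract_def by (elim bexE, intro bexI) (auto intro: restrict_module_hom)

lemma restrict_module_iso: "module_iso S M N \<Longrightarrow> module_iso R' M N"
  unfolding module_iso_def by (elim bexE, intro bexI) (auto intro: restrict_module_hom)

lemma restrict_submodule:
  assumes "left_module S M" "submodule N S M"
  shows "submodule N R' M"
  using left_module.submoduleD[OF assms]
  by (intro left_module.submoduleI[OF restrict_left_module[OF assms(1)]]) auto

text \<open>The products of basis elements with generators over \<open>S\<close> generate over \<open>R\<close>.\<close>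

lemma restrict_fg_module:
  assumes "fg_module S M"
  shows "fg_module R' M"
proof -
  interpret M: left_module S M using assms by (rule fg_module_left_module)
  interpret M': left_module R' M by (rule restrict_left_module[OF M.left_module_axioms])
  obtain G where G: "finite G" "G \<subseteq> carrier M"
    and gen: "\<And>N. submodule N S M \<Longrightarrow> G \<subseteq> N \<Longrightarrow> N = carrier M"
    by (rule fg_moduleE[OF assms]) blast
  have GM: "\<And>g. g \<in> G \<Longrightarrow> g \<in> carrier M" using G by auto
  let ?G = "(\<lambda>(b, g). b \<odot>\<^bsub>M\<^esub> g) ` (B \<times> G)"
  show ?thesis
    unfolding fg_module_iff[OF M'.left_module_axioms]
  proof (intro exI[of _ ?G] conjI allI impI)
    show "finite ?G" using G finite_B by auto
    show "?G \<subseteq> carrier M" using GM by auto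
    fix N assume N: "submodule N R' M \<and> ?G \<subseteq> N"
    then have N': "submodule N R' M" by simp
    note D = M'.submoduleD[OF N']
    \<comment> \<open>The largest \<open>S\<close>-submodule contained in \<open>N\<close>.\<close>
    let ?U = "{x \<in> carrier M. \<forall>s\<in>carrier S. s \<odot>\<^bsub>M\<^esub> x \<in> N}"
    have "submodule ?U S M"
      using D by (intro M.submoduleI)
        (auto simp: M.smult_r_null M.smult_r_distr simp flip: M.smult_assoc)
    moreover have "G \<subseteq> ?U"
    proof safe
      fix g s assume g: "g \<in> G" and s: "s \<in> carrier S"
      have "s \<odot>\<^bsub>M\<^esub> g = (\<Oplus>b\<in>B. left_coord b s \<otimes> b) \<odot>\<^bsub>M\<^esub> g" using left_coord_sum[OF s] by simp
      also have "\<dots> = (\<Oplus>\<^bsub>M\<^esub>b\<in>B. (left_coord b s \<otimes> b) \<odot>\<^bsub>M\<^esub> g)"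
        using s GM[OF g] finite_B by (intro M.finsum_smult_l) auto
      also have "\<dots> = (\<Oplus>\<^bsub>M\<^esub>b\<in>B. left_coord b s \<odot>\<^bsub>M\<^esub> (b \<odot>\<^bsub>M\<^esub> g))"
        using s GM[OF g] by (intro M.M.finsum_cong') (auto simp: M.smult_assoc)
      also have "\<dots> \<in> N"
      proof (rule M'.submodule_finsum[OF N'], rule Pi_I)
        fix b assume "b \<in> B"
        then have "b \<odot>\<^bsub>M\<^esub> g \<in> N" "left_coord b s \<in> carrier R'" using N g s by auto
        then show "left_coord b s \<odot>\<^bsub>M\<^esub> (b \<odot>\<^bsub>M\<^esub> g) \<in> N" using D(5) by blast
      qed
      finally show "s \<odot>\<^bsub>M\<^esub> g \<in> N" .
    qed (use GM in auto)
    ultimately have "?U = carrier M" by (rule gen)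
    then have "x \<in> N" if "x \<in> carrier M" for x
      using that M.smult_one[OF that] by (metis (no_types, lifting) one_closed mem_Collect_eq)
    then show "N = carrier M" using D(1) by auto
  qed
qed

lemma restrict_dual_basis:
  assumes P: "left_module S P" and db: "dual_basis S P I e f"
  shows "dual_basis R' P (I \<times> B) (\<lambda>(i, b). b \<odot>\<^bsub>P\<^esub> e i) (\<lambda>(i, b) x. left_coord b (f i x))"
proof -
  interpret P: left_module S P by fact
  note D = dual_basisD[OF db]
  have "(\<Oplus>\<^bsub>P\<^esub>ib\<in>I \<times> B. (case ib of (i, b) \<Rightarrow> \<lambda>x. left_coord b (f i x)) x \<odot>\<^bsub>P\<^esub> (case ib of (i, b) \<Rightarrow> b \<odot>\<^bsub>P\<^esub> e i)) = x"
    (is "?l = x") if x: "x \<in> carrier P" for x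
  proof -
    have "?l = (\<Oplus>\<^bsub>P\<^esub>i\<in>I. \<Oplus>\<^bsub>P\<^esub>b\<in>B. left_coord b (f i x) \<odot>\<^bsub>P\<^esub> (b \<odot>\<^bsub>P\<^esub> e i))"
      using D x finite_B by (subst finsum_Times[OF P.M.abelian_group_axioms]) auto
    also have "\<dots> = (\<Oplus>\<^bsub>P\<^esub>i\<in>I. f i x \<odot>\<^bsub>P\<^esub> e i)"
    proof (intro P.M.finsum_cong')
      fix i assume i: "i \<in> I"
      have "(\<Oplus>\<^bsub>P\<^esub>b\<in>B. left_coord b (f i x) \<odot>\<^bsub>P\<^esub> (b \<odot>\<^bsub>P\<^esub> e i)) = (\<Oplus>\<^bsub>P\<^esub>b\<in>B. (left_coord b (f i x) \<otimes> b) \<odot>\<^bsub>P\<^esub> e i)"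
        using i D x by (intro P.M.finsum_cong') (auto simp: P.smult_assoc)
      also have "\<dots> = (\<Oplus>b\<in>B. left_coord b (f i x) \<otimes> b) \<odot>\<^bsub>P\<^esub> e i"
        using i D x finite_B by (intro P.finsum_smult_l[symmetric]) auto
      finally show "(\<Oplus>\<^bsub>P\<^esub>b\<in>B. left_coord b (f i x) \<odot>\<^bsub>P\<^esub> (b \<odot>\<^bsub>P\<^esub> e i)) = f i x \<odot>\<^bsub>P\<^esub> e i"
        using i D x by (simp add: left_coord_sum)
    qed (use D x in auto)
    finally show ?thesis using D(6)[OF x] by simp
  qed
  then show ?thesis
    unfolding dual_basis_def using D finite_B by (auto simp: left_coord_add left_coord_mult intro!: module_homI)
qed

lemma restrict_projective:
  fixes P :: "'a umodule"
  assumes "projective_module S P"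
  shows "projective_module R' P"
proof -
  obtain G f where "dual_basis S P G (\<lambda>x. x) f" using projective_dual_basis[OF assms] by blast
  moreover have "left_module S P"
    using assms by (simp add: projective_module_def fg_module_left_module)
  ultimately show ?thesis
    using dual_basis_projective[OF restrict_left_module restrict_dual_basis] by blast
qed

lemma restrict_Omega:
  assumes "K \<in> Omega S n"
  shows "K \<in> Omega R' n"
proof -
  obtain M :: "'a umodule" where K: "fg_module S K" and M: "fg_module S M" and syz: "nth_syzygy S n M K"
    using assms by (auto simp: Omega_def)
  have "nth_syzygy R' n M K"
  proof (cases n)
    case 0
    then show ?thesis using syz by (simp add: nth_syzygy_def restrict_module_iso)
  next
    case (Suc m)
    then obtain P d \<epsilon> where res: "projective_resolution S P d \<epsilon> M"
      and iso: "module_iso S K (P m\<lparr>carrier := d m ` carrier (P (Suc m))\<rparr>)"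
      using syz by (auto simp: nth_syzygy_def)
    have "projective_resolution R' P d \<epsilon> M"
      using res unfolding projective_resolution_def
      by (auto intro: restrict_projective restrict_module_hom)
    then show ?thesis
      using iso Suc by (auto simp: nth_syzygy_def intro: restrict_module_iso)
  qed
  then show ?thesis
    using K M restrict_fg_module unfolding Omega_def by blast
qed

section \<open>Induced modules\<close>

text \<open>The module \<open>S \<otimes>\<^sub>R M\<close>. As \<open>S\<close> is the direct sum of the \<open>b R\<close>, a family \<open>u\<close> stands for
  \<open>\<Sum> b \<otimes> u b\<close>, and \<open>s\<close> acts through the matrix of left multiplication by \<open>s\<close> on the right \<open>R\<close>-module
  \<open>S\<close>.\<close>

definition Ind :: "('a, 'c) module \<Rightarrow> ('a, 'a \<Rightarrow> 'c) module" where
  "Ind M = fun_module B M (\<lambda>s u. \<lambda>b'\<in>B. \<Oplus>\<^bsub>M\<^esub>b\<in>B. right_coord b' (s \<otimes> b) \<odot>\<^bsub>M\<^esub> u b)"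

text \<open>The element \<open>s \<otimes> x\<close>.\<close>

definition tens :: "('a, 'c) module \<Rightarrow> 'a \<Rightarrow> 'c \<Rightarrow> 'a \<Rightarrow> 'c" where
  "tens M s x = (\<lambda>b\<in>B. right_coord b s \<odot>\<^bsub>M\<^esub> x)"

lemma Ind_simps:
  "carrier (Ind M) = B \<rightarrow>\<^sub>E carrier M"
  "\<zero>\<^bsub>Ind M\<^esub> = (\<lambda>b\<in>B. \<zero>\<^bsub>M\<^esub>)"
  "u \<oplus>\<^bsub>Ind M\<^esub> v = (\<lambda>b\<in>B. u b \<oplus>\<^bsub>M\<^esub> v b)"
  "s \<odot>\<^bsub>Ind M\<^esub> u = (\<lambda>b'\<in>B. \<Oplus>\<^bsub>M\<^esub>b\<in>B. right_coord b' (s \<otimes> b) \<odot>\<^bsub>M\<^esub> u b)"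
  by (simp_all only: Ind_def fun_module_simps)

lemma Ind_mem: "u \<in> carrier (Ind M) \<Longrightarrow> b \<in> B \<Longrightarrow> u b \<in> carrier M"
  by (auto simp: Ind_simps)

lemma Ind_eqI:
  assumes "u \<in> carrier (Ind M)" "v \<in> carrier (Ind M)" "\<And>b. b \<in> B \<Longrightarrow> u b = v b"
  shows "u = v"
  using assms by (auto simp: Ind_simps PiE_iff intro: extensionalityI)

lemma Ind_abelian_group:
  assumes "left_module R' M"
  shows "abelian_group (Ind M)"
  unfolding Ind_def using assms by (intro fun_module_abelian_group) (simp add: left_module_def)

lemma tens_closed:
  assumes M: "left_module R' M" and "s \<in> carrier S" "x \<in> carrier M"
  shows "tens M s x \<in> carrier (Ind M)"
proof -
  interpret M: left_module R' M by fact
  show ?thesis using assms by (auto simp: tens_def Ind_simps)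
qed

lemma tens_add_left:
  assumes M: "left_module R' M" and "s \<in> carrier S" "t \<in> carrier S" "x \<in> carrier M"
  shows "tens M (s \<oplus> t) x = tens M s x \<oplus>\<^bsub>Ind M\<^esub> tens M t x"
proof -
  interpret M: left_module R' M by fact
  show ?thesis
    using assms M.smult_l_distr by (auto simp: tens_def Ind_simps right_coord_add intro!: restrict_ext)
qed

lemma tens_add_right:
  assumes M: "left_module R' M" and "s \<in> carrier S" "x \<in> carrier M" "y \<in> carrier M"
  shows "tens M s (x \<oplus>\<^bsub>M\<^esub> y) = tens M s x \<oplus>\<^bsub>Ind M\<^esub> tens M s y"
proof -
  interpret M: left_module R' M by fact
  show ?thesis
    using assms M.smult_r_distr by (auto simp: tens_def Ind_simps intro!: restrict_ext)
qed

lemma tens_smult: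
  assumes M: "left_module R' M" and "s \<in> carrier S" "r \<in> R" "x \<in> carrier M"
  shows "tens M (s \<otimes> r) x = tens M s (r \<odot>\<^bsub>M\<^esub> x)"
proof -
  interpret M: left_module R' M by fact
  show ?thesis
    using assms M.smult_assoc by (auto simp: tens_def right_coord_mult intro!: restrict_ext)
qed

lemma tens_basis:
  assumes M: "left_module R' M" and "b \<in> B" "x \<in> carrier M"
  shows "tens M b x = (\<lambda>b'\<in>B. if b' = b then x else \<zero>\<^bsub>M\<^esub>)"
proof -
  interpret M: left_module R' M by fact
  show ?thesis
    using assms M.smult_one M.smult_l_null by (auto simp: tens_def right_coord_basis intro!: restrict_ext)
qed

lemma Ind_finsum:
  assumes M: "left_module R' M" and "finite I" "h \<in> I \<rightarrow> carrier (Ind M)" "b \<in> B"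
  shows "(\<Oplus>\<^bsub>Ind M\<^esub>i\<in>I. h i) b = (\<Oplus>\<^bsub>M\<^esub>i\<in>I. h i b)"
  using assms unfolding Ind_def by (intro fun_module_finsum) (auto simp: left_module_def)

lemma Ind_sum_tens:
  assumes M: "left_module R' M" and u: "u \<in> carrier (Ind M)"
  shows "(\<Oplus>\<^bsub>Ind M\<^esub>b\<in>B. tens M b (u b)) = u"
proof -
  interpret M: left_module R' M by fact
  interpret IM: abelian_group "Ind M" by (rule Ind_abelian_group[OF M])
  have cl: "(\<lambda>b. tens M b (u b)) \<in> B \<rightarrow> carrier (Ind M)"
    using tens_closed[OF M] Ind_mem[OF u] by auto
  show ?thesis
  proof (rule Ind_eqI[OF IM.finsum_closed[OF cl] u])
    fix b' assume b': "b' \<in> B"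
    have "(\<Oplus>\<^bsub>Ind M\<^esub>b\<in>B. tens M b (u b)) b' = (\<Oplus>\<^bsub>M\<^esub>b\<in>B. tens M b (u b) b')"
      by (rule Ind_finsum[OF M finite_B cl b'])
    also have "\<dots> = (\<Oplus>\<^bsub>M\<^esub>b\<in>B. if b' = b then u b else \<zero>\<^bsub>M\<^esub>)"
      using b' Ind_mem[OF u] by (intro M.M.finsum_cong') (auto simp: tens_basis[OF M])
    also have "\<dots> = u b'"
      using M.M.finsum_singleton[OF b' finite_B, of u] Ind_mem[OF u] by auto
    finally show "(\<Oplus>\<^bsub>Ind M\<^esub>b\<in>B. tens M b (u b)) b' = u b'" .
  qed
qed

text \<open>The elements \<open>b \<otimes> x\<close> generate \<open>Ind M\<close> as an abelian group. Associativity of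
  the action and linearity of maps are checked on them alone, so that no double sums have to be
  interchanged.\<close>

lemma Ind_additive_ext:
  assumes M: "left_module R' M" and N: "abelian_group N"
    and f: "f \<in> carrier (Ind M) \<rightarrow> carrier N"
      "\<And>u v. u \<in> carrier (Ind M) \<Longrightarrow> v \<in> carrier (Ind M) \<Longrightarrow> f (u \<oplus>\<^bsub>Ind M\<^esub> v) = f u \<oplus>\<^bsub>N\<^esub> f v"
    and g: "g \<in> carrier (Ind M) \<rightarrow> carrier N"
      "\<And>u v. u \<in> carrier (Ind M) \<Longrightarrow> v \<in> carrier (Ind M) \<Longrightarrow> g (u \<oplus>\<^bsub>Ind M\<^esub> v) = g u \<oplus>\<^bsub>N\<^esub> g v"
    and eq: "\<And>b x. b \<in> B \<Longrightarrow> x \<in> carrier M \<Longrightarrow> f (tens M b x) = g (tens M b x)"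
    and u: "u \<in> carrier (Ind M)"
  shows "f u = g u"
proof -
  interpret N: abelian_group N by fact
  note IM = Ind_abelian_group[OF M]
  have cl: "(\<lambda>b. tens M b (u b)) \<in> B \<rightarrow> carrier (Ind M)"
    using tens_closed[OF M] Ind_mem[OF u] by auto
  have "f (\<Oplus>\<^bsub>Ind M\<^esub>b\<in>B. tens M b (u b)) = (\<Oplus>\<^bsub>N\<^esub>b\<in>B. f (tens M b (u b)))"
    by (rule additive_finsum[OF IM N f finite_B cl])
  also have "\<dots> = (\<Oplus>\<^bsub>N\<^esub>b\<in>B. g (tens M b (u b)))"
    using cl g(1) Ind_mem[OF u] eq by (intro N.finsum_cong') auto
  also have "\<dots> = g (\<Oplus>\<^bsub>Ind M\<^esub>b\<in>B. tens M b (u b))"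
    by (rule additive_finsum[OF IM N g finite_B cl, symmetric])
  finally show ?thesis by (simp add: Ind_sum_tens[OF M u])
qed

lemma Ind_smult_closed:
  assumes M: "left_module R' M" and "s \<in> carrier S" "u \<in> carrier (Ind M)"
  shows "s \<odot>\<^bsub>Ind M\<^esub> u \<in> carrier (Ind M)"
proof -
  interpret M: left_module R' M by fact
  show ?thesis using assms Ind_mem[OF assms(3)] by (auto simp: Ind_simps intro!: M.M.finsum_closed)
qed

lemma Ind_smult_add:
  assumes M: "left_module R' M" and s: "s \<in> carrier S" and u: "u \<in> carrier (Ind M)" "v \<in> carrier (Ind M)"
  shows "s \<odot>\<^bsub>Ind M\<^esub> (u \<oplus>\<^bsub>Ind M\<^esub> v) = s \<odot>\<^bsub>Ind M\<^esub> u \<oplus>\<^bsub>Ind M\<^esub> s \<odot>\<^bsub>Ind M\<^esub> v"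
proof -
  interpret M: left_module R' M by fact
  have "(\<Oplus>\<^bsub>M\<^esub>b\<in>B. right_coord b' (s \<otimes> b) \<odot>\<^bsub>M\<^esub> (\<lambda>b\<in>B. u b \<oplus>\<^bsub>M\<^esub> v b) b)
      = (\<Oplus>\<^bsub>M\<^esub>b\<in>B. right_coord b' (s \<otimes> b) \<odot>\<^bsub>M\<^esub> u b) \<oplus>\<^bsub>M\<^esub> (\<Oplus>\<^bsub>M\<^esub>b\<in>B. right_coord b' (s \<otimes> b) \<odot>\<^bsub>M\<^esub> v b)" if "b' \<in> B" for b'
  proof -
    have "(\<Oplus>\<^bsub>M\<^esub>b\<in>B. right_coord b' (s \<otimes> b) \<odot>\<^bsub>M\<^esub> (\<lambda>b\<in>B. u b \<oplus>\<^bsub>M\<^esub> v b) b)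
      = (\<Oplus>\<^bsub>M\<^esub>b\<in>B. right_coord b' (s \<otimes> b) \<odot>\<^bsub>M\<^esub> u b \<oplus>\<^bsub>M\<^esub> right_coord b' (s \<otimes> b) \<odot>\<^bsub>M\<^esub> v b)"
      using s that Ind_mem[OF u(1)] Ind_mem[OF u(2)]
      by (intro M.M.finsum_cong') (auto simp: M.smult_r_distr)
    then show ?thesis
      using s that Ind_mem[OF u(1)] Ind_mem[OF u(2)] by (simp add: M.M.finsum_addf Pi_iff)
  qed
  then show ?thesis by (auto simp: Ind_simps intro!: restrict_ext)
qed

lemma Ind_smult_tens:
  assumes M: "left_module R' M" and s: "s \<in> carrier S" "t \<in> carrier S" and x: "x \<in> carrier M"
  shows "s \<odot>\<^bsub>Ind M\<^esub> tens M t x = tens M (s \<otimes> t) x"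
proof -
  interpret M: left_module R' M by fact
  have "(\<Oplus>\<^bsub>M\<^esub>b\<in>B. right_coord b' (s \<otimes> b) \<odot>\<^bsub>M\<^esub> tens M t x b) = right_coord b' (s \<otimes> t) \<odot>\<^bsub>M\<^esub> x" if b': "b' \<in> B" for b'
  proof -
    have "(\<Oplus>\<^bsub>M\<^esub>b\<in>B. right_coord b' (s \<otimes> b) \<odot>\<^bsub>M\<^esub> tens M t x b)
      = (\<Oplus>\<^bsub>M\<^esub>b\<in>B. (right_coord b' (s \<otimes> b) \<otimes> right_coord b t) \<odot>\<^bsub>M\<^esub> x)"
      using s b' x M.smult_assoc by (intro M.M.finsum_cong') (auto simp: tens_def)
    also have "\<dots> = (\<Oplus>\<^bsub>R'\<^esub>b\<in>B. right_coord b' (s \<otimes> b) \<otimes> right_coord b t) \<odot>\<^bsub>M\<^esub> x"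
      using s b' x finite_B by (intro M.finsum_smult_l[symmetric]) auto
    also have "(\<Oplus>\<^bsub>R'\<^esub>b\<in>B. right_coord b' (s \<otimes> b) \<otimes> right_coord b t) = right_coord b' (s \<otimes> t)"
      using s b' finsum_R'[OF finite_B, of "\<lambda>b. right_coord b' (s \<otimes> b) \<otimes> right_coord b t"] right_coord_mult_expand[OF b' s]
      by simp
    finally show ?thesis .
  qed
  then show ?thesis by (auto simp: Ind_simps tens_def intro!: restrict_ext)
qed

lemma Ind_left_module:
  assumes M: "left_module R' M"
  shows "left_module S (Ind M)"
proof -
  interpret M: left_module R' M by fact
  interpret IM: abelian_group "Ind M" by (rule Ind_abelian_group[OF M])
  note ab = IM.abelian_group_axioms and cl = Ind_smult_closed[OF M] and add = Ind_smult_add[OF M]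
  show ?thesis
  proof (intro left_module.intro left_module_axioms.intro ring_axioms ab)
    fix a b u assume a: "a \<in> carrier S" "b \<in> carrier S" and u: "u \<in> carrier (Ind M)"
    show "(a \<oplus> b) \<odot>\<^bsub>Ind M\<^esub> u = a \<odot>\<^bsub>Ind M\<^esub> u \<oplus>\<^bsub>Ind M\<^esub> b \<odot>\<^bsub>Ind M\<^esub> u"
    proof (rule Ind_additive_ext[OF M ab _ _ _ _ _ u])
      fix c x assume "c \<in> B" "x \<in> carrier M"
      then show "(a \<oplus> b) \<odot>\<^bsub>Ind M\<^esub> tens M c x = a \<odot>\<^bsub>Ind M\<^esub> tens M c x \<oplus>\<^bsub>Ind M\<^esub> b \<odot>\<^bsub>Ind M\<^esub> tens M c x"
        using a by (simp add: Ind_smult_tens[OF M] l_distr tens_add_left[OF M])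
    qed (use a cl add in \<open>auto simp: IM.a_ac\<close>)
    show "(a \<otimes> b) \<odot>\<^bsub>Ind M\<^esub> u = a \<odot>\<^bsub>Ind M\<^esub> (b \<odot>\<^bsub>Ind M\<^esub> u)"
    proof (rule Ind_additive_ext[OF M ab _ _ _ _ _ u])
      fix c x assume "c \<in> B" "x \<in> carrier M"
      then show "(a \<otimes> b) \<odot>\<^bsub>Ind M\<^esub> tens M c x = a \<odot>\<^bsub>Ind M\<^esub> (b \<odot>\<^bsub>Ind M\<^esub> tens M c x)"
        using a by (simp add: Ind_smult_tens[OF M] m_assoc)
    qed (use a cl add in auto)
  next
    fix u assume u: "u \<in> carrier (Ind M)"
    show "\<one> \<odot>\<^bsub>Ind M\<^esub> u = u"
      by (rule Ind_additive_ext[OF M ab _ _ _ _ _ u])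
        (use cl add in \<open>auto simp: Ind_smult_tens[OF M]\<close>)
  qed (use cl add in auto)
qed

lemma Ind_homI:
  assumes M: "left_module R' M" and N: "left_module S N"
    and f: "f \<in> carrier (Ind M) \<rightarrow> carrier N"
      "\<And>u v. u \<in> carrier (Ind M) \<Longrightarrow> v \<in> carrier (Ind M) \<Longrightarrow> f (u \<oplus>\<^bsub>Ind M\<^esub> v) = f u \<oplus>\<^bsub>N\<^esub> f v"
    and lin: "\<And>s b x. s \<in> carrier S \<Longrightarrow> b \<in> B \<Longrightarrow> x \<in> carrier M \<Longrightarrow>
      f (tens M (s \<otimes> b) x) = s \<odot>\<^bsub>N\<^esub> f (tens M b x)"
  shows "f \<in> module_hom S (Ind M) N"
proof (rule module_homI)
  interpret N: left_module S N by fact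
  fix s u assume s: "s \<in> carrier S" and u: "u \<in> carrier (Ind M)"
  note cl = Ind_smult_closed[OF M]
  show "f (s \<odot>\<^bsub>Ind M\<^esub> u) = s \<odot>\<^bsub>N\<^esub> f u"
    by (rule Ind_additive_ext[OF M N.M.abelian_group_axioms _ _ _ _ _ u])
      (use s f cl in \<open>auto simp: Ind_smult_add[OF M] Ind_smult_tens[OF M] lin N.smult_r_distr Pi_iff\<close>)
qed (use f in auto)

text \<open>The unit \<open>x \<mapsto> 1 \<otimes> x\<close> of the adjunction between induction and restriction.\<close>

lemma tens_one_hom:
  assumes M: "left_module R' M"
  shows "tens M \<one> \<in> module_hom R' M (Ind M)"
proof (rule module_homI)
  fix a x assume a: "a \<in> carrier R'" and x: "x \<in> carrier M"
  have "tens M (\<one> \<otimes> a) x = a \<odot>\<^bsub>Ind M\<^esub> tens M \<one> x"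
    using a x by (simp add: Ind_smult_tens[OF M])
  then show "tens M \<one> (a \<odot>\<^bsub>M\<^esub> x) = a \<odot>\<^bsub>Ind M\<^esub> tens M \<one> x"
    using tens_smult[OF M one_closed _ x, of a] a by simp
qed (use tens_closed[OF M] tens_add_right[OF M] in auto)

lemma Ind_fg_module:
  assumes fg: "fg_module R' M"
  shows "fg_module S (Ind M)"
proof -
  have M: "left_module R' M" using fg by (rule fg_module_left_module)
  interpret M: left_module R' M by fact
  interpret IM: left_module S "Ind M" by (rule Ind_left_module[OF M])
  obtain G where G: "finite G" "G \<subseteq> carrier M"
    and gen: "\<And>N. submodule N R' M \<Longrightarrow> G \<subseteq> N \<Longrightarrow> N = carrier M"
    by (rule fg_moduleE[OF fg]) blast
  show ?thesis
    unfolding fg_module_iff[OF IM.left_module_axioms]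
  proof (intro exI[of _ "tens M \<one> ` G"] conjI allI impI)
    show "tens M \<one> ` G \<subseteq> carrier (Ind M)" using G tens_closed[OF M] by auto
    fix N assume N: "submodule N S (Ind M) \<and> tens M \<one> ` G \<subseteq> N"
    then have N': "submodule N S (Ind M)" by simp
    have "{x \<in> carrier M. tens M \<one> x \<in> N} = carrier M"
      using N G restrict_submodule[OF IM.left_module_axioms N']
      by (intro gen submodule_preimage[OF M restrict_left_module[OF IM.left_module_axioms] tens_one_hom[OF M]]) auto
    then have one: "tens M \<one> x \<in> N" if "x \<in> carrier M" for x using that by auto
    have "u \<in> N" if u: "u \<in> carrier (Ind M)" for u
    proof -
      have "tens M b (u b) \<in> N" if "b \<in> B" for b
        using IM.submoduleD(5)[OF N' B_in[OF that] one[OF Ind_mem[OF u that]]] Ind_mem[OF u that] that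
        by (simp add: Ind_smult_tens[OF M])
      then have "(\<Oplus>\<^bsub>Ind M\<^esub>b\<in>B. tens M b (u b)) \<in> N"
        by (intro IM.submodule_finsum[OF N']) auto
      then show ?thesis by (simp add: Ind_sum_tens[OF M u])
    qed
    then show "N = carrier (Ind M)" using IM.submoduleD(1)[OF N'] by auto
  qed (use G in auto)
qed

definition ind_map :: "('c \<Rightarrow> 'd) \<Rightarrow> ('a \<Rightarrow> 'c) \<Rightarrow> 'a \<Rightarrow> 'd" where
  "ind_map f u = (\<lambda>b\<in>B. f (u b))"

lemma ind_map_tens:
  assumes "left_module R' M" "f \<in> module_hom R' M N" "s \<in> carrier S" "x \<in> carrier M"
  shows "ind_map f (tens M s x) = tens N s (f x)"
  using assms module_homD(3)[OF assms(2)] by (auto simp: ind_map_def tens_def intro!: restrict_ext)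

lemma ind_map_hom:
  assumes M: "left_module R' M" and N: "left_module R' N" and f: "f \<in> module_hom R' M N"
  shows "ind_map f \<in> module_hom S (Ind M) (Ind N)"
proof (rule Ind_homI[OF M Ind_left_module[OF N]])
  note F = module_homD[OF f]
  show "ind_map f \<in> carrier (Ind M) \<rightarrow> carrier (Ind N)"
    using F by (auto simp: ind_map_def Ind_simps PiE_iff)
  show "ind_map f (u \<oplus>\<^bsub>Ind M\<^esub> v) = ind_map f u \<oplus>\<^bsub>Ind N\<^esub> ind_map f v"
    if "u \<in> carrier (Ind M)" "v \<in> carrier (Ind M)" for u v
    using F Ind_mem[OF that(1)] Ind_mem[OF that(2)] by (auto simp: ind_map_def Ind_simps intro!: restrict_ext)
  show "ind_map f (tens M (s \<otimes> b) x) = s \<odot>\<^bsub>Ind N\<^esub> ind_map f (tens M b x)"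
    if "s \<in> carrier S" "b \<in> B" "x \<in> carrier M" for s b x
    using that F by (simp add: ind_map_tens[OF M f] Ind_smult_tens[OF N])
qed

text \<open>Images and kernels of induced maps are computed in each coordinate. This is the
  exactness of induction.\<close>

lemma ind_map_image: "ind_map f ` carrier (Ind M) = B \<rightarrow>\<^sub>E f ` carrier M"
proof
  show "ind_map f ` carrier (Ind M) \<subseteq> B \<rightarrow>\<^sub>E f ` carrier M"
    by (auto simp: ind_map_def Ind_simps PiE_mem)
  show "B \<rightarrow>\<^sub>E f ` carrier M \<subseteq> ind_map f ` carrier (Ind M)"
  proof
    fix v assume v: "v \<in> B \<rightarrow>\<^sub>E f ` carrier M"
    then have "\<forall>b\<in>B. \<exists>x\<in>carrier M. v b = f x" by (auto simp: PiE_iff)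
    then obtain u where u: "\<And>b. b \<in> B \<Longrightarrow> u b \<in> carrier M" "\<And>b. b \<in> B \<Longrightarrow> v b = f (u b)" by metis
    have "v = ind_map f (restrict u B)"
      using v u(2) by (auto simp: ind_map_def PiE_iff intro!: extensionalityI[of _ B])
    moreover have "restrict u B \<in> carrier (Ind M)" using u(1) by (auto simp: Ind_simps)
    ultimately show "v \<in> ind_map f ` carrier (Ind M)" by blast
  qed
qed

lemma ind_map_kernel:
  "{u \<in> carrier (Ind M). ind_map f u = \<zero>\<^bsub>Ind N\<^esub>} = B \<rightarrow>\<^sub>E {x \<in> carrier M. f x = \<zero>\<^bsub>N\<^esub>}"
proof -
  have "ind_map f u = \<zero>\<^bsub>Ind N\<^esub> \<longleftrightarrow> (\<forall>b\<in>B. f (u b) = \<zero>\<^bsub>N\<^esub>)" for u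
    by (auto simp: ind_map_def Ind_simps fun_eq_iff restrict_def)
  then show ?thesis by (simp add: set_eq_iff Ind_simps PiE_iff) blast
qed

lemma Ind_retract:
  assumes M: "left_module R' M" and N: "left_module R' N" and r: "retract R' M N"
  shows "retract S (Ind M) (Ind N)"
proof -
  obtain i p where i: "i \<in> module_hom R' M N" and p: "p \<in> module_hom R' N M"
    and pi: "\<And>x. x \<in> carrier M \<Longrightarrow> p (i x) = x"
    using r by (auto simp: retract_def)
  have "ind_map p (ind_map i u) = u" if "u \<in> carrier (Ind M)" for u
    using that pi by (auto simp: ind_map_def Ind_simps PiE_iff intro!: extensionalityI[of _ B])
  then show ?thesis
    by (rule retractI[OF ind_map_hom[OF M N i] ind_map_hom[OF N M p]])
qed

text \<open>The multiplication map \<open>s \<otimes> x \<mapsto> s x\<close>.\<close>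

definition counit :: "('a, 'c) module \<Rightarrow> ('a \<Rightarrow> 'c) \<Rightarrow> 'c" where
  "counit M u = (\<Oplus>\<^bsub>M\<^esub>b\<in>B. b \<odot>\<^bsub>M\<^esub> u b)"

lemma counit_tens:
  assumes M: "left_module S M" and s: "s \<in> carrier S" and x: "x \<in> carrier M"
  shows "counit M (tens M s x) = s \<odot>\<^bsub>M\<^esub> x"
proof -
  interpret M: left_module S M by fact
  have "counit M (tens M s x) = (\<Oplus>\<^bsub>M\<^esub>b\<in>B. (b \<otimes> right_coord b s) \<odot>\<^bsub>M\<^esub> x)"
    unfolding counit_def using s x by (intro M.M.finsum_cong') (auto simp: tens_def M.smult_assoc)
  also have "\<dots> = (\<Oplus>b\<in>B. b \<otimes> right_coord b s) \<odot>\<^bsub>M\<^esub> x"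
    using s x finite_B by (intro M.finsum_smult_l[symmetric]) auto
  finally show ?thesis by (simp add: right_coord_sum s)
qed

lemma counit_hom:
  assumes M: "left_module S M"
  shows "counit M \<in> module_hom S (Ind M) M"
proof (rule Ind_homI[OF restrict_left_module[OF M] M])
  interpret M: left_module S M by fact
  show "counit M \<in> carrier (Ind M) \<rightarrow> carrier M"
    using Ind_mem[of _ M] by (auto simp: counit_def intro!: M.M.finsum_closed)
  show "counit M (u \<oplus>\<^bsub>Ind M\<^esub> v) = counit M u \<oplus>\<^bsub>M\<^esub> counit M v"
    if uv: "u \<in> carrier (Ind M)" "v \<in> carrier (Ind M)" for u v
  proof -
    have "counit M (u \<oplus>\<^bsub>Ind M\<^esub> v) = (\<Oplus>\<^bsub>M\<^esub>b\<in>B. b \<odot>\<^bsub>M\<^esub> u b \<oplus>\<^bsub>M\<^esub> b \<odot>\<^bsub>M\<^esub> v b)"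
      unfolding counit_def using Ind_mem[OF uv(1)] Ind_mem[OF uv(2)]
      by (intro M.M.finsum_cong') (auto simp: Ind_simps M.smult_r_distr)
    then show ?thesis
      unfolding counit_def using Ind_mem[OF uv(1)] Ind_mem[OF uv(2)] by (simp add: M.M.finsum_addf Pi_iff)
  qed
  show "counit M (tens M (s \<otimes> b) x) = s \<odot>\<^bsub>M\<^esub> counit M (tens M b x)"
    if "s \<in> carrier S" "b \<in> B" "x \<in> carrier M" for s b x
    using that by (simp add: counit_tens[OF M] M.smult_assoc)
qed

text \<open>A functional \<open>f : P \<rightarrow> R \<subseteq> S\<close> induces \<open>s \<otimes> x \<mapsto> s f(x)\<close>.\<close>

lemma Ind_dual_basis:
  assumes P: "left_module R' P" and db: "dual_basis R' P I e f"
  shows "dual_basis S (Ind P) I (\<lambda>i. tens P \<one> (e i)) (\<lambda>i u. counit (regular_module S) (ind_map (f i) u))"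
proof -
  interpret P: left_module R' P by fact
  interpret IP: left_module S "Ind P" by (rule Ind_left_module[OF P])
  note D = dual_basisD[OF db]
  note reg = regular_module_left_module[OF ring_axioms]
  let ?F = "\<lambda>i u. counit (regular_module S) (ind_map (f i) u)"
  have f: "f i \<in> module_hom R' P (regular_module S)" if "i \<in> I" for i
    using D(3)[OF that] D(4)[OF that] D(5)[OF that] by (auto intro!: module_homI)
  have F: "?F i \<in> module_hom S (Ind P) (regular_module S)" if "i \<in> I" for i
    using module_hom_comp[OF ind_map_hom[OF P restrict_left_module[OF reg] f[OF that]] counit_hom[OF reg]]
    by (simp add: comp_def)
  have e1: "tens P \<one> (e i) \<in> carrier (Ind P)" if "i \<in> I" for i
    using tens_closed[OF P] D(2)[OF that] by simp
  have F_tens: "?F i (tens P b x) = b \<otimes> f i x" if "i \<in> I" "b \<in> B" "x \<in> carrier P" for i b x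
    using that D(3)[OF that(1,3)] by (simp add: ind_map_tens[OF P f[OF that(1)]] counit_tens[OF reg])
  \<comment> \<open>Expansion in the proposed dual basis; it fixes every \<open>b \<otimes> x\<close>.\<close>
  define g where "g u = (\<Oplus>\<^bsub>Ind P\<^esub>i\<in>I. ?F i u \<odot>\<^bsub>Ind P\<^esub> tens P \<one> (e i))" for u
  have g: "g \<in> module_hom S (Ind P) (Ind P)"
    unfolding g_def using F e1
    by (intro linear_combination_hom[OF IP.left_module_axioms IP.left_module_axioms D(1)]) auto
  have "g u = u" if u: "u \<in> carrier (Ind P)" for u
  proof (rule Ind_additive_ext[OF P IP.M.abelian_group_axioms _ _ _ _ _ u])
    show "g \<in> carrier (Ind P) \<rightarrow> carrier (Ind P)" using module_homD(1)[OF g] by auto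
    show "g (u \<oplus>\<^bsub>Ind P\<^esub> v) = g u \<oplus>\<^bsub>Ind P\<^esub> g v" if "u \<in> carrier (Ind P)" "v \<in> carrier (Ind P)" for u v
      using module_homD(2)[OF g that] .
    show "g (tens P b x) = tens P b x" if b: "b \<in> B" and x: "x \<in> carrier P" for b x
    proof -
      have "g (tens P b x) = (\<Oplus>\<^bsub>Ind P\<^esub>i\<in>I. tens P b (f i x \<odot>\<^bsub>P\<^esub> e i))"
        unfolding g_def
      proof (intro IP.M.finsum_cong')
        fix i assume i: "i \<in> I"
        have fi: "f i x \<in> R" "e i \<in> carrier P" using D(2,3) i x by auto
        have "?F i (tens P b x) \<odot>\<^bsub>Ind P\<^esub> tens P \<one> (e i) = tens P (b \<otimes> f i x) (e i)"
          using i b x fi by (simp add: F_tens Ind_smult_tens[OF P])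
        then show "?F i (tens P b x) \<odot>\<^bsub>Ind P\<^esub> tens P \<one> (e i) = tens P b (f i x \<odot>\<^bsub>P\<^esub> e i)"
          using b fi by (simp add: tens_smult[OF P])
      qed (use b D x in \<open>auto intro!: tens_closed[OF P]\<close>)
      also have "\<dots> = tens P b (\<Oplus>\<^bsub>P\<^esub>i\<in>I. f i x \<odot>\<^bsub>P\<^esub> e i)"
        using b x D tens_add_right[OF P, of b] tens_closed[OF P, of b]
        by (intro additive_finsum[symmetric, OF P.M.abelian_group_axioms IP.M.abelian_group_axioms]) auto
      finally show ?thesis by (simp add: D(6)[OF x])
    qed
  qed auto
  then show ?thesis
    unfolding dual_basis_def g_def using D(1) e1 F by auto
qed

lemma Ind_Omega:
  fixes K K' :: "'a umodule"
  assumes K: "K \<in> Omega R' n" and K': "fg_module S K'" and iso: "module_iso S K' (Ind K)"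
  shows "K' \<in> Omega S n"
proof (cases n)
  case 0
  then show ?thesis using K' by (simp add: mem_Omega_0)
next
  case (Suc m)
  then obtain M :: "'a umodule" and P d \<epsilon> where fgK: "fg_module R' K" and M: "fg_module R' M"
    and res: "projective_resolution R' P d \<epsilon> M"
    and isoK: "module_iso R' K (P m\<lparr>carrier := d m ` carrier (P (Suc m))\<rparr>)"
    using K by (auto simp: Omega_def nth_syzygy_def)
  have proj: "\<And>i. projective_module R' (P i)" and d: "\<And>i. d i \<in> module_hom R' (P (Suc i)) (P i)"
    and \<epsilon>: "\<epsilon> \<in> module_hom R' (P 0) M" "\<epsilon> ` carrier (P 0) = carrier M"
    and ex0: "d 0 ` carrier (P 1) = {x \<in> carrier (P 0). \<epsilon> x = \<zero>\<^bsub>M\<^esub>}"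
    and ex: "\<And>i. d (Suc i) ` carrier (P (Suc (Suc i))) = {x \<in> carrier (P (Suc i)). d i x = \<zero>\<^bsub>P i\<^esub>}"
    using res unfolding projective_resolution_def by blast+
  have P: "left_module R' (P i)" for i
    using proj[of i] by (simp add: projective_module_def fg_module_left_module)
  note lK = fg_module_left_module[OF fgK] and lM = fg_module_left_module[OF M]
  have "\<exists>G f. dual_basis R' (P i) G (\<lambda>x. x) f" for i
    by (rule projective_dual_basis[OF proj])
  then obtain G f where db: "\<And>i. dual_basis R' (P i) (G i) (\<lambda>x. x) (f i)" by metis
  obtain \<kappa> where \<kappa>: "\<kappa> \<in> module_hom R' K (P m\<lparr>carrier := d m ` carrier (P (Suc m))\<rparr>)"
    and bij\<kappa>: "bij_betw \<kappa> (carrier K) (d m ` carrier (P (Suc m)))"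
    using isoK by (auto simp: module_iso_def)
  have imd: "d m ` carrier (P (Suc m)) \<subseteq> carrier (P m)" using module_homD(1)[OF d] by auto
  have \<kappa>P: "\<kappa> \<in> module_hom R' K (P m)"
    using module_hom_comp[OF \<kappa> module_hom_incl(2)[OF imd]] by (simp add: comp_def)
  obtain \<theta> where \<theta>: "\<theta> \<in> module_hom S K' (Ind K)" "bij_betw \<theta> (carrier K') (carrier (Ind K))"
    using iso by (auto simp: module_iso_def)
  have inj: "inj_on (ind_map \<kappa>) (carrier (Ind K))"
  proof (rule inj_onI)
    fix u v assume uv: "u \<in> carrier (Ind K)" "v \<in> carrier (Ind K)" "ind_map \<kappa> u = ind_map \<kappa> v"
    have "\<kappa> (u b) = \<kappa> (v b)" if "b \<in> B" for b
      using fun_cong[OF uv(3), of b] that by (simp add: ind_map_def)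
    then show "u = v"
      using bij\<kappa> Ind_mem[OF uv(1)] Ind_mem[OF uv(2)]
      by (intro Ind_eqI[OF uv(1,2)]) (auto simp: bij_betw_def dest: inj_onD)
  qed
  have "K' \<in> Omega S (Suc m)"
  proof (rule Omega_SucI)
    show "fg_module S (Ind M)" by (rule Ind_fg_module[OF M])
    show "left_module S (Ind (P i))" for i by (rule Ind_left_module[OF P])
    show "dual_basis S (Ind (P i)) (G i) (\<lambda>x. tens (P i) \<one> x)
      (\<lambda>j u. counit (regular_module S) (ind_map (f i j) u))" for i
      by (rule Ind_dual_basis[OF P db])
    show "ind_map (d i) \<in> module_hom S (Ind (P (Suc i))) (Ind (P i))" for i
      by (rule ind_map_hom[OF P P d])
    show "ind_map \<epsilon> \<in> module_hom S (Ind (P 0)) (Ind M)" by (rule ind_map_hom[OF P lM \<epsilon>(1)])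
    show "ind_map \<epsilon> ` carrier (Ind (P 0)) = carrier (Ind M)"
      by (simp add: ind_map_image \<epsilon>(2)) (simp add: Ind_simps)
    show "ind_map (d 0) ` carrier (Ind (P 1)) = {x \<in> carrier (Ind (P 0)). ind_map \<epsilon> x = \<zero>\<^bsub>Ind M\<^esub>}"
      unfolding ind_map_image ind_map_kernel ex0 ..
    show "ind_map (d (Suc i)) ` carrier (Ind (P (Suc (Suc i)))) =
      {x \<in> carrier (Ind (P (Suc i))). ind_map (d i) x = \<zero>\<^bsub>Ind (P i)\<^esub>}" for i
      unfolding ind_map_image ind_map_kernel ex ..
    show "fg_module S K'" by fact
    show "ind_map \<kappa> \<circ> \<theta> \<in> module_hom S K' (Ind (P m))"
      by (rule module_hom_comp[OF \<theta>(1) ind_map_hom[OF lK P \<kappa>P]])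
    show "inj_on (ind_map \<kappa> \<circ> \<theta>) (carrier K')"
      using \<theta>(2) inj by (auto simp: bij_betw_def intro: comp_inj_on)
    show "(ind_map \<kappa> \<circ> \<theta>) ` carrier K' = ind_map (d m) ` carrier (Ind (P (Suc m)))"
      unfolding image_comp[symmetric]
      using \<theta>(2) bij\<kappa> by (simp add: ind_map_image bij_betw_def)
  qed
  then show ?thesis using Suc by simp
qed

section \<open>Summands along restriction and induction\<close>

text \<open>Over \<open>R\<close>, the kernel of the multiplication map \<open>Ind W \<rightarrow> W\<close> has the complement
  \<open>1 \<otimes> W\<close>. The condition on summands provides a complement over \<open>S\<close>, which the multiplication map sends
  isomorphically onto \<open>W\<close>. The condition speaks about modules of a fixed type, so \<open>Ind W\<close> is first
  replaced by a copy.\<close>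

lemma retract_Ind_of_summand_condition:
  fixes W :: "'a umodule"
  assumes summand: "\<And>(M :: 'a umodule) N. fg_module S M \<Longrightarrow> submodule N S M \<Longrightarrow>
      direct_summand R' M N \<Longrightarrow> direct_summand S M N"
    and fg: "fg_module S W"
  shows "retract S W (Ind W)"
proof -
  note W = fg_module_left_module[OF fg]
  note W' = restrict_left_module[OF W]
  have fgI: "fg_module S (Ind W)" by (rule Ind_fg_module[OF restrict_fg_module[OF fg]])
  note IW = fg_module_left_module[OF fgI]
  obtain C :: "'a umodule" where C: "fg_module S C" and iso: "module_iso S (Ind W) C"
    using fg_module_copy[OF fgI] by blast
  note lC = fg_module_left_module[OF C]
  interpret W: left_module S W by fact
  interpret C: left_module S C by fact
  obtain \<theta> where \<theta>: "\<theta> \<in> module_hom S (Ind W) C" and bij: "bij_betw \<theta> (carrier (Ind W)) (carrier C)"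
    using iso by (auto simp: module_iso_def)
  let ?\<theta>' = "the_inv_into (carrier (Ind W)) \<theta>"
  note \<theta>' = module_hom_inverse[OF \<theta> IW bij]
  define g where "g = counit W \<circ> ?\<theta>'"
  have g: "g \<in> module_hom S C W"
    unfolding g_def by (rule module_hom_comp[OF \<theta>' counit_hom[OF W]])
  define j where "j = \<theta> \<circ> tens W \<one>"
  have j: "j \<in> module_hom R' W C"
    unfolding j_def by (rule module_hom_comp[OF tens_one_hom[OF W'] restrict_module_hom[OF \<theta>]])
  have gj: "g (j x) = x" if "x \<in> carrier W" for x
    using that tens_closed[OF W' one_closed that] bij
    by (simp add: g_def j_def bij_betw_def the_inv_into_f_f counit_tens[OF W] W.smult_one)
  define N where "N = {c \<in> carrier C. g c = \<zero>\<^bsub>W\<^esub>}"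
  have "direct_sum_of R' C (j ` carrier W) N"
    unfolding N_def
    using gj by (intro retract_direct_sum W' restrict_left_module[OF lC] j restrict_module_hom[OF g])
  then have "direct_summand R' C N"
    using direct_sum_of_sym[OF restrict_left_module[OF lC]] unfolding direct_summand_def by blast
  moreover have N: "submodule N S C"
    unfolding N_def by (rule submodule_kernel[OF lC W g])
  ultimately obtain N' where ds: "direct_sum_of S C N N'"
    using summand[OF C] unfolding direct_summand_def by blast
  then have N': "submodule N' S C" and int: "N \<inter> N' = {\<zero>\<^bsub>C\<^esub>}" and sum: "N <+>\<^bsub>C\<^esub> N' = carrier C"
    by (auto simp: direct_sum_of_def)
  note D = C.submoduleD[OF N'] and G = module_homD[OF g]
  have N'C: "\<And>x. x \<in> N' \<Longrightarrow> x \<in> carrier C" using D(1) by auto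
  have inj: "inj_on g N'"
  proof (rule inj_onI)
    fix x y assume xy: "x \<in> N'" "y \<in> N'" "g x = g y"
    have "g (x \<oplus>\<^bsub>C\<^esub> \<ominus>\<^bsub>C\<^esub> y) = \<zero>\<^bsub>W\<^esub>"
      using xy N'C G by (simp add: module_hom_minus[OF lC W g] W.M.r_neg)
    moreover have "x \<oplus>\<^bsub>C\<^esub> \<ominus>\<^bsub>C\<^esub> y \<in> N'" using xy D(3,4) by auto
    ultimately have "x \<oplus>\<^bsub>C\<^esub> \<ominus>\<^bsub>C\<^esub> y = \<zero>\<^bsub>C\<^esub>" using int N'C unfolding N_def by blast
    then have "\<ominus>\<^bsub>C\<^esub> (\<ominus>\<^bsub>C\<^esub> y) = x" using xy N'C by (intro C.M.minus_equality) auto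
    then show "x = y" using xy N'C by simp
  qed
  have surj: "g ` N' = carrier W"
  proof
    show "g ` N' \<subseteq> carrier W" using N'C G(1) by auto
    show "carrier W \<subseteq> g ` N'"
    proof
      fix x assume x: "x \<in> carrier W"
      then have "j x \<in> N <+>\<^bsub>C\<^esub> N'" using module_homD(1)[OF j] sum by simp
      then obtain c c' where c: "c \<in> N" "c' \<in> N'" "j x = c \<oplus>\<^bsub>C\<^esub> c'" unfolding mem_set_add by blast
      have "x = g (c \<oplus>\<^bsub>C\<^esub> c')" using gj[OF x] c(3) by simp
      also have "\<dots> = g c'" using c N'C G by (simp add: N_def)
      finally show "x \<in> g ` N'" using c(2) by blast
    qed
  qed
  have "g \<in> module_hom S (C\<lparr>carrier := N'\<rparr>) W"
    using module_hom_comp[OF module_hom_incl(2)[OF D(1)] g] by (simp add: comp_def)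
  then have "module_iso S (C\<lparr>carrier := N'\<rparr>) W"
    using inj surj unfolding module_iso_def bij_betw_def by auto
  then have W_C: "retract S W (C\<lparr>carrier := N'\<rparr>)"
    by (rule module_iso_imp_retract(2)[OF C.submodule_left_module[OF N']])
  have N'_C: "retract S (C\<lparr>carrier := N'\<rparr>) C"
    using direct_sum_of_sym[OF lC ds]
    by (intro direct_summand_retract[OF lC]) (auto simp: direct_summand_def)
  show ?thesis
    by (rule retract_trans[OF W_C retract_trans[OF N'_C module_iso_imp_retract(2)[OF IW iso]]])
qed

text \<open>The coordinates of \<open>Ind L\<close> are semilinear over \<open>R\<close>, since \<open>r (b \<otimes> x) = b \<otimes> \<sigma>\<^sub>b(r) x\<close>.\<close>

lemma Ind_smult_R:
  assumes L: "left_module R' L" and r: "r \<in> R" and u: "u \<in> carrier (Ind L)" and b: "b \<in> B"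
  shows "(r \<odot>\<^bsub>Ind L\<^esub> u) b = twist b r \<odot>\<^bsub>L\<^esub> u b"
proof -
  interpret L: left_module R' L by fact
  have "(r \<odot>\<^bsub>Ind L\<^esub> u) b = (\<Oplus>\<^bsub>L\<^esub>b'\<in>B. right_coord b (r \<otimes> b') \<odot>\<^bsub>L\<^esub> u b')"
    using b by (simp add: Ind_simps)
  also have "\<dots> = (\<Oplus>\<^bsub>L\<^esub>b'\<in>B. if b = b' then twist b' r \<odot>\<^bsub>L\<^esub> u b' else \<zero>\<^bsub>L\<^esub>)"
    using b r Ind_mem[OF u] L.smult_l_null
    by (intro L.M.finsum_cong') (auto simp: right_coord_twist)
  also have "\<dots> = twist b r \<odot>\<^bsub>L\<^esub> u b"
    using L.M.finsum_singleton[OF b finite_B, of "\<lambda>b'. twist b' r \<odot>\<^bsub>L\<^esub> u b'"] Ind_mem[OF u] r by auto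
  finally show ?thesis .
qed

text \<open>Compare the coefficients of \<open>b\<close> in \<open>1 r = r 1\<close>.\<close>

lemma right_coord_one_twist:
  assumes b: "b \<in> B" and r: "r \<in> R"
  shows "right_coord b \<one> \<otimes> r = twist b r \<otimes> right_coord b \<one>"
proof -
  have "right_coord b \<one> \<otimes> r = right_coord b (r \<otimes> \<one>)"
    using right_coord_mult[OF b one_closed r] r by simp
  also have "\<dots> = (\<Oplus>b'\<in>B. right_coord b (r \<otimes> b') \<otimes> right_coord b' \<one>)"
    using b r by (intro right_coord_mult_expand) auto
  also have "\<dots> = (\<Oplus>b'\<in>B. if b = b' then twist b' r \<otimes> right_coord b' \<one> else \<zero>)"
    using b r by (intro finsum_cong') (auto simp: right_coord_twist)
  also have "\<dots> = twist b r \<otimes> right_coord b \<one>"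
    using finsum_singleton[OF b finite_B, of "\<lambda>b'. twist b' r \<otimes> right_coord b' \<one>"] r by auto
  finally show ?thesis .
qed

text \<open>The crucial point for descending from \<open>S\<close> to \<open>R\<close>: some coefficient of \<open>1\<close> acts
  bijectively on \<open>L\<close>. By Fitting's lemma the only alternative is that all of them act nilpotently,
  and then they kill every minimal submodule, which contradicts that they are the coefficients of
  \<open>1\<close>.\<close>

lemma retract_restricted_Ind:
  assumes artin: "artin_algebra k R' \<psi>" and fg: "fg_module R' L" and ind: "indecomposable_module R' L"
  shows "retract R' L (Ind L)"
proof -
  interpret L: fg_artin_module k R' \<psi> L using artin fg by unfold_locales
  note lL = L.M.left_module_axioms
  note IL = Ind_left_module[OF lL]
  let ?f = "\<lambda>b x. right_coord b \<one> \<odot>\<^bsub>L\<^esub> x"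
  have f_closed: "?f b x \<in> carrier L" if "b \<in> B" "x \<in> carrier L" for b x
    using that by simp
  have f_add: "?f b (x \<oplus>\<^bsub>L\<^esub> y) = ?f b x \<oplus>\<^bsub>L\<^esub> ?f b y" if "b \<in> B" "x \<in> carrier L" "y \<in> carrier L" for b x y
    using that L.M.smult_r_distr by simp
  have f_semi: "?f b (r \<odot>\<^bsub>L\<^esub> x) = twist b r \<odot>\<^bsub>L\<^esub> ?f b x" if "b \<in> B" "r \<in> R" "x \<in> carrier L" for b r x
    using that L.M.smult_assoc[of "right_coord b \<one>" r x] L.M.smult_assoc[of "twist b r" "right_coord b \<one>" x]
    by (simp add: right_coord_one_twist)
  have klin: "L.klinear (?f b)" if b: "b \<in> B" for b
    unfolding L.klinear_def
  proof (intro conjI ballI)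
    fix c x assume c: "c \<in> carrier k" and x: "x \<in> carrier L"
    have "\<psi> c \<otimes> right_coord b \<one> = right_coord b \<one> \<otimes> \<psi> c"
      using L.\<phi>_central[OF c, of "right_coord b \<one>"] b by simp
    then show "?f b (\<psi> c \<odot>\<^bsub>L\<^esub> x) = \<psi> c \<odot>\<^bsub>L\<^esub> ?f b x"
      using b x L.\<phi>_closed[OF c] L.M.smult_assoc[of "right_coord b \<one>" "\<psi> c" x] L.M.smult_assoc[of "\<psi> c" "right_coord b \<one>" x]
      by simp
  qed (use b f_add in auto)
  have fitting: "bij_betw (?f b) (carrier L) (carrier L) \<or> (\<exists>n. \<forall>x\<in>carrier L. (?f b ^^ n) x = \<zero>\<^bsub>L\<^esub>)"
    if b: "b \<in> B" for b
    using L.fitting_indecomposable[OF klin[OF b], of "twist b"] twist_surj[OF b] f_semi[OF b] b ind by auto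
  have "\<exists>b\<in>B. bij_betw (?f b) (carrier L) (carrier L)"
  proof (rule ccontr)
    assume "\<not> ?thesis"
    then have nil: "\<exists>n. \<forall>x\<in>carrier L. (?f b ^^ n) x = \<zero>\<^bsub>L\<^esub>" if "b \<in> B" for b
      using fitting that by blast
    let ?Z = "{T. submodule T R' L \<and> T \<noteq> {\<zero>\<^bsub>L\<^esub>}}"
    have "carrier L \<in> ?Z"
      using ind L.M.submodule_carrier by (simp add: indecomposable_module_def)
    then obtain T where T: "T \<in> ?Z"
      and min: "\<And>T'. (T', T) \<in> {(N, N'). submodule N R' L \<and> submodule N' R' L \<and> N \<subset> N'} \<Longrightarrow> T' \<notin> ?Z"
      by (rule wfE_min[OF L.wf_submodule]) blast
    from T have sT: "submodule T R' L" and nz: "T \<noteq> {\<zero>\<^bsub>L\<^esub>}" by auto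
    note D = L.M.submoduleD[OF sT]
    have TL: "\<And>x. x \<in> T \<Longrightarrow> x \<in> carrier L" using D(1) by auto
    have kill: "?f b x = \<zero>\<^bsub>L\<^esub>" if b: "b \<in> B" and x: "x \<in> T" for b x
    proof -
      have sub: "?f b ` T \<subseteq> T" using D(5) b by auto
      have "submodule (?f b ` T) R' L"
      proof (rule L.M.submoduleI)
        show "?f b ` T \<subseteq> carrier L" using sub TL by auto
        show "\<zero>\<^bsub>L\<^esub> \<in> ?f b ` T"
          using L.M.smult_r_null[of "right_coord b \<one>"] b D(2) by (intro image_eqI[of _ _ "\<zero>\<^bsub>L\<^esub>"]) auto
        fix y z assume "y \<in> ?f b ` T" "z \<in> ?f b ` T"
        then obtain u v where "u \<in> T" "v \<in> T" "y = ?f b u" "z = ?f b v" by auto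
        then show "y \<oplus>\<^bsub>L\<^esub> z \<in> ?f b ` T"
          using D(3) TL f_add[OF b] by (intro image_eqI[of _ _ "u \<oplus>\<^bsub>L\<^esub> v"]) auto
      next
        fix r y assume "r \<in> carrier R'" "y \<in> ?f b ` T"
        then obtain r' u where "r' \<in> R" "r = twist b r'" "u \<in> T" "y = ?f b u"
          using twist_surj[OF b, symmetric] by fastforce
        then show "r \<odot>\<^bsub>L\<^esub> y \<in> ?f b ` T"
          using D(5)[of r' u] TL f_semi[OF b] by (intro image_eqI[of _ _ "r' \<odot>\<^bsub>L\<^esub> u"]) auto
      qed
      moreover have "?f b ` T \<noteq> T"
      proof
        assume eq: "?f b ` T = T"
        have pow: "(?f b ^^ n) ` T = T" for n
          using eq by (induction n) (simp_all only: funpow.simps image_comp[symmetric] image_id id_apply)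
        obtain n where n: "\<forall>x\<in>carrier L. (?f b ^^ n) x = \<zero>\<^bsub>L\<^esub>" using nil[OF b] by blast
        have "T \<subseteq> {\<zero>\<^bsub>L\<^esub>}"
        proof
          fix y assume "y \<in> T"
          then have "y \<in> (?f b ^^ n) ` T" by (simp only: pow)
          then show "y \<in> {\<zero>\<^bsub>L\<^esub>}" using n TL by auto
        qed
        then show False using nz D(2) by auto
      qed
      ultimately have "?f b ` T = {\<zero>\<^bsub>L\<^esub>}"
        using min[of "?f b ` T"] sub sT by blast
      then show ?thesis using x by blast
    qed
    \<comment> \<open>An empty basis is possible: it means that \<open>S\<close> is the zero ring.\<close>
    have "x = \<zero>\<^bsub>L\<^esub>" if x: "x \<in> T" for x
    proof (cases "B = {}")
      case True
      then have "\<one> = \<zero>" using right_coord_sum[of \<one>] by simp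
      then show ?thesis using L.M.smult_one[OF TL[OF x]] L.M.smult_l_null[OF TL[OF x]] by simp
    next
      case False
      then obtain b where b: "b \<in> B" by blast
      have "tens L \<one> x = \<zero>\<^bsub>Ind L\<^esub>"
        using kill x by (auto simp: tens_def Ind_simps intro!: restrict_ext)
      then have "tens L b x = \<zero>\<^bsub>Ind L\<^esub>"
        using Ind_smult_tens[OF lL B_in[OF b] one_closed TL[OF x]] b left_module.smult_r_null[OF IL, of b]
        by simp
      then have "tens L b x b = \<zero>\<^bsub>L\<^esub>" using b by (simp add: Ind_simps)
      then show ?thesis using b TL[OF x] by (simp add: tens_basis[OF lL])
    qed
    then have "T \<subseteq> {\<zero>\<^bsub>L\<^esub>}" by blast
    then show False using nz D(2) by blast
  qed
  then obtain b where b: "b \<in> B" and bij: "bij_betw (?f b) (carrier L) (carrier L)" by blast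
  let ?g = "the_inv_into (carrier L) (?f b)"
  have inj: "inj_on (?f b) (carrier L)" using bij by (rule bij_betw_imp_inj_on)
  have g: "?g y \<in> carrier L" "?f b (?g y) = y" if "y \<in> carrier L" for y
    using f_the_inv_into_f_bij_betw[OF bij, of y] that bij_betw_the_inv_into[OF bij]
    by (auto simp: bij_betw_def)
  have g_eq: "?g (?f b x) = x" if "x \<in> carrier L" for x
    using the_inv_into_f_f[OF inj that] .
  have "(\<lambda>u. ?g (u b)) \<in> module_hom R' (Ind L) L"
  proof (rule module_homI)
    show "?g (u b) \<in> carrier L" if "u \<in> carrier (Ind L)" for u
      using g(1)[OF Ind_mem[OF that b]] .
    show "?g ((u \<oplus>\<^bsub>Ind L\<^esub> v) b) = ?g (u b) \<oplus>\<^bsub>L\<^esub> ?g (v b)"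
      if "u \<in> carrier (Ind L)" "v \<in> carrier (Ind L)" for u v
    proof -
      note uv = Ind_mem[OF that(1) b] Ind_mem[OF that(2) b]
      have "?f b (?g (u b) \<oplus>\<^bsub>L\<^esub> ?g (v b)) = u b \<oplus>\<^bsub>L\<^esub> v b"
        using f_add[OF b g(1)[OF uv(1)] g(1)[OF uv(2)]] g(2)[OF uv(1)] g(2)[OF uv(2)] by simp
      then show ?thesis
        using g_eq[of "?g (u b) \<oplus>\<^bsub>L\<^esub> ?g (v b)"] g(1) uv b by (simp add: Ind_simps)
    qed
    show "?g ((r \<odot>\<^bsub>Ind L\<^esub> u) b) = r \<odot>\<^bsub>L\<^esub> ?g (u b)"
      if r: "r \<in> carrier R'" and u: "u \<in> carrier (Ind L)" for r u
    proof -
      note ub = Ind_mem[OF u b]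
      have "?f b (r \<odot>\<^bsub>L\<^esub> ?g (u b)) = twist b r \<odot>\<^bsub>L\<^esub> u b"
        using f_semi[OF b _ g(1)[OF ub], of r] g(2)[OF ub] r by simp
      then show ?thesis
        using g_eq[of "r \<odot>\<^bsub>L\<^esub> ?g (u b)"] L.M.smult_closed[OF r g(1)[OF ub]] Ind_smult_R[OF lL _ u b, of r] r
        by simp
    qed
  qed
  moreover have "?g (tens L \<one> x b) = x" if "x \<in> carrier L" for x
    using that b g_eq by (simp add: tens_def)
  ultimately show ?thesis
    by (intro retractI[OF tens_one_hom[OF lL]])
qed

lemma Ind_direct_sum_split:
  assumes W: "fg_artin_module k S \<phi> W" "indecomposable_module S W" and N: "left_module R' N"
    and ds: "direct_sum_of R' N N1 N2" and r: "retract S W (Ind N)"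
  shows "retract S W (Ind (N\<lparr>carrier := N1\<rparr>)) \<or> retract S W (Ind (N\<lparr>carrier := N2\<rparr>))"
proof -
  obtain p p' where p: "p \<in> module_hom R' N (N\<lparr>carrier := N1\<rparr>)" "p' \<in> module_hom R' N (N\<lparr>carrier := N2\<rparr>)"
    "\<And>x. x \<in> carrier N \<Longrightarrow> x = p x \<oplus>\<^bsub>N\<^esub> p' x"
    by (rule direct_sum_of_decompose[OF N ds]) blast
  have sub: "submodule N1 R' N" "submodule N2 R' N" using ds by (auto simp: direct_sum_of_def)
  note l1 = left_module.submodule_left_module[OF N sub(1)] and l2 = left_module.submodule_left_module[OF N sub(2)]
  note i1 = module_hom_incl(2)[OF left_module.submoduleD(1)[OF N sub(1)], of R']
    and i2 = module_hom_incl(2)[OF left_module.submoduleD(1)[OF N sub(2)], of R']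
  have "ind_map (\<lambda>x. x) (ind_map p u) \<oplus>\<^bsub>Ind N\<^esub> ind_map (\<lambda>x. x) (ind_map p' u) = u"
    if u: "u \<in> carrier (Ind N)" for u
    using u p(3)[OF Ind_mem[OF u], symmetric]
    by (auto simp: ind_map_def Ind_simps PiE_iff intro!: extensionalityI[of _ B])
  then show ?thesis
    by (rule fg_artin_module.indecomposable_retract_split[OF W r ind_map_hom[OF l1 N i1] ind_map_hom[OF l2 N i2]
        ind_map_hom[OF N l1 p(1)] ind_map_hom[OF N l2 p(2)]])
qed

section \<open>Syzygy finiteness along excellent extensions\<close>

lemma syzygy_finite_extension:
  assumes artinS: "artin_algebra k S \<phi>" and artinR: "artin_algebra k' R' \<psi>"
    and summand: "\<And>(M :: 'a umodule) N. fg_module S M \<Longrightarrow> submodule N S M \<Longrightarrow>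
      direct_summand R' M N \<Longrightarrow> direct_summand S M N"
    and fin: "syzygy_finite R' n"
  shows "syzygy_finite S n"
proof -
  obtain Ys :: "'a umodule set" where Ys: "finite Ys" "\<And>Y. Y \<in> Ys \<Longrightarrow> fg_module R' Y"
    and ret: "\<And>L. L \<in> Omega_indecomposables R' n \<Longrightarrow> \<exists>Y\<in>Ys. retract R' L Y"
    using fin unfolding syzygy_finite_iff[OF artinR] by blast
  have "\<exists>C :: 'a umodule. fg_module S C \<and> module_iso S (Ind Y) C" if "Y \<in> Ys" for Y
    by (rule fg_module_copy[OF Ind_fg_module[OF Ys(2)[OF that]]])
  then obtain C :: "'a umodule \<Rightarrow> 'a umodule" where C: "\<And>Y. Y \<in> Ys \<Longrightarrow> fg_module S (C Y)"
    "\<And>Y. Y \<in> Ys \<Longrightarrow> module_iso S (Ind Y) (C Y)"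
    by metis
  have "\<exists>Z\<in>C ` Ys. retract S W Z" if W: "W \<in> Omega_indecomposables S n" for W
  proof -
    obtain K where fgW: "fg_module S W" and indW: "indecomposable_module S W"
      and K: "K \<in> Omega S n" "retract S W K"
      using W by (auto simp: mem_Omega_indecomposables)
    interpret W: fg_artin_module k S \<phi> W using artinS fgW by unfold_locales
    interpret WR: fg_artin_module k' R' \<psi> W using artinR restrict_fg_module[OF fgW] by unfold_locales
    obtain N where N: "submodule N R' W" "retract R' (W\<lparr>carrier := N\<rparr>) W"
      "indecomposable_module R' (W\<lparr>carrier := N\<rparr>)" "retract S W (Ind (W\<lparr>carrier := N\<rparr>))"
    proof (rule WR.indecomposable_summand_descent[of "\<lambda>N. retract S W (Ind (W\<lparr>carrier := N\<rparr>))"])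
      show "retract S W (Ind (W\<lparr>carrier := carrier W\<rparr>))"
        using retract_Ind_of_summand_condition[OF summand fgW] by simp
      show "\<not> retract S W (Ind (W\<lparr>carrier := {\<zero>\<^bsub>W\<^esub>}\<rparr>))"
      proof
        assume r: "retract S W (Ind (W\<lparr>carrier := {\<zero>\<^bsub>W\<^esub>}\<rparr>))"
        have "carrier (Ind (W\<lparr>carrier := {\<zero>\<^bsub>W\<^esub>}\<rparr>)) \<subseteq> {\<lambda>b\<in>B. \<zero>\<^bsub>W\<^esub>}"
          by (auto simp: Ind_simps PiE_iff intro!: extensionalityI[of _ B])
        then show False
          using retract_of_trivial[OF W.M.left_module_axioms r] indW by (simp add: indecomposable_module_def)
      qed
      show "retract S W (Ind (W\<lparr>carrier := N1\<rparr>)) \<or> retract S W (Ind (W\<lparr>carrier := N2\<rparr>))"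
        if "submodule N R' W" "retract S W (Ind (W\<lparr>carrier := N\<rparr>))"
          "direct_sum_of R' (W\<lparr>carrier := N\<rparr>) N1 N2" for N N1 N2
        using Ind_direct_sum_split[OF W.fg_artin_module_axioms indW WR.M.submodule_left_module[OF that(1)] that(3,2)]
        by simp
    qed
    note lN = WR.M.submodule_left_module[OF N(1)]
    note fgN = fg_module_retract[OF WR.fg lN N(2)]
    obtain L :: "'a umodule" where L: "fg_module R' L" "module_iso R' (W\<lparr>carrier := N\<rparr>) L"
      using fg_module_copy[OF fgN] by blast
    note lL = fg_module_left_module[OF L(1)]
    have "retract R' L K"
      by (rule retract_trans[OF module_iso_imp_retract(2)[OF lN L(2)] retract_trans[OF N(2) restrict_retract[OF K(2)]]])
    moreover have "indecomposable_module R' L"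
      by (rule indecomposable_module_iso[OF lN L(2) lL N(3)])
    ultimately have "L \<in> Omega_indecomposables R' n"
      using L(1) restrict_Omega[OF K(1)] by (auto simp: mem_Omega_indecomposables)
    then obtain Y where Y: "Y \<in> Ys" "retract R' L Y" using ret by blast
    have "retract R' (W\<lparr>carrier := N\<rparr>) Y"
      using module_iso_imp_retract(1)[OF lN L(2)] Y(2) by (rule retract_trans)
    then have r1: "retract S (Ind (W\<lparr>carrier := N\<rparr>)) (Ind Y)"
      by (rule Ind_retract[OF lN fg_module_left_module[OF Ys(2)[OF Y(1)]]])
    have r2: "retract S (Ind Y) (C Y)"
      using Ind_left_module[OF fg_module_left_module[OF Ys(2)[OF Y(1)]]] C(2)[OF Y(1)]
      by (rule module_iso_imp_retract(1))
    have "retract S W (C Y)"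
      by (rule retract_trans[OF N(4) retract_trans[OF r1 r2]])
    then show ?thesis using Y(1) by blast
  qed
  then show ?thesis
    unfolding syzygy_finite_iff[OF artinS] using Ys(1) C(1)
    by (intro exI[of _ "C ` Ys"]) auto
qed

lemma syzygy_finite_subring:
  assumes artinS: "artin_algebra k S \<phi>" and artinR: "artin_algebra k' R' \<psi>"
    and fin: "syzygy_finite S n"
  shows "syzygy_finite R' n"
proof -
  obtain Ys :: "'a umodule set" where Ys: "finite Ys" "\<And>Y. Y \<in> Ys \<Longrightarrow> fg_module S Y"
    and ret: "\<And>W. W \<in> Omega_indecomposables S n \<Longrightarrow> \<exists>Y\<in>Ys. retract S W Y"
    using fin unfolding syzygy_finite_iff[OF artinS] by blast
  have "\<exists>Y\<in>Ys. retract R' L Y" if L: "L \<in> Omega_indecomposables R' n" for L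
  proof -
    obtain K where fgL: "fg_module R' L" and indL: "indecomposable_module R' L"
      and K: "K \<in> Omega R' n" "retract R' L K"
      using L by (auto simp: mem_Omega_indecomposables)
    have fgK: "fg_module R' K" using K(1) by (simp add: Omega_def)
    note lL = fg_module_left_module[OF fgL] and lK = fg_module_left_module[OF fgK]
    interpret L: fg_artin_module k' R' \<psi> L using artinR fgL by unfold_locales
    interpret IL: fg_artin_module k S \<phi> "Ind L" using artinS Ind_fg_module[OF fgL] by unfold_locales
    obtain N where N: "submodule N S (Ind L)" "retract S (Ind L\<lparr>carrier := N\<rparr>) (Ind L)"
      "indecomposable_module S (Ind L\<lparr>carrier := N\<rparr>)" "retract R' L (Ind L\<lparr>carrier := N\<rparr>)"
    proof (rule IL.indecomposable_summand_descent[of "\<lambda>N. retract R' L (Ind L\<lparr>carrier := N\<rparr>)"])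
      show "retract R' L (Ind L\<lparr>carrier := carrier (Ind L)\<rparr>)"
        using retract_restricted_Ind[OF artinR fgL indL] by simp
      show "\<not> retract R' L (Ind L\<lparr>carrier := {\<zero>\<^bsub>Ind L\<^esub>}\<rparr>)"
        using retract_of_trivial[OF lL] indL by (fastforce simp: indecomposable_module_def)
      show "retract R' L (Ind L\<lparr>carrier := N1\<rparr>) \<or> retract R' L (Ind L\<lparr>carrier := N2\<rparr>)"
        if "submodule N S (Ind L)" "retract R' L (Ind L\<lparr>carrier := N\<rparr>)"
          "direct_sum_of S (Ind L\<lparr>carrier := N\<rparr>) N1 N2" for N N1 N2
      proof -
        note lN = IL.M.submodule_left_module[OF that(1)]
        have "direct_sum_of R' (Ind L\<lparr>carrier := N\<rparr>) N1 N2"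
          using that(3) restrict_submodule[OF lN] by (auto simp: direct_sum_of_def)
        then show ?thesis
          using L.indecomposable_retract_direct_sum[OF indL that(2) restrict_left_module[OF lN]] by simp
      qed
    qed
    note lN = IL.M.submodule_left_module[OF N(1)]
    note fgN = fg_module_retract[OF IL.fg lN N(2)]
    obtain W :: "'a umodule" where W: "fg_module S W" "module_iso S (Ind L\<lparr>carrier := N\<rparr>) W"
      using fg_module_copy[OF fgN] by blast
    obtain K' :: "'a umodule" where K': "fg_module S K'" "module_iso S (Ind K) K'"
      using fg_module_copy[OF Ind_fg_module[OF fgK]] by blast
    note IK = Ind_left_module[OF lK]
    have "retract S W (Ind L)"
      using module_iso_imp_retract(2)[OF lN W(2)] N(2) by (rule retract_trans)
    moreover have "retract S (Ind L) K'"
      using Ind_retract[OF lL lK K(2)] module_iso_imp_retract(1)[OF IK K'(2)] by (rule retract_trans)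
    ultimately have "retract S W K'" by (rule retract_trans)
    moreover have "K' \<in> Omega S n"
      by (rule Ind_Omega[OF K(1) K'(1) module_iso_sym[OF IK K'(2)]])
    moreover have "indecomposable_module S W"
      by (rule indecomposable_module_iso[OF lN W(2) fg_module_left_module[OF W(1)] N(3)])
    ultimately have "W \<in> Omega_indecomposables S n"
      using W(1) by (auto simp: mem_Omega_indecomposables)
    then obtain Y where Y: "Y \<in> Ys" "retract S W Y" using ret by blast
    have "retract S (Ind L\<lparr>carrier := N\<rparr>) Y"
      using module_iso_imp_retract(1)[OF lN W(2)] Y(2) by (rule retract_trans)
    then have "retract R' L Y"
      by (rule retract_trans[OF N(4) restrict_retract])
    then show ?thesis using Y(1) by blast
  qed
  then show ?thesis
    unfolding syzygy_finite_iff[OF artinR] using Ys restrict_fg_module by (intro exI[of _ Ys]) auto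
qed

end

theorem corollary3p6:
  fixes k :: "('k, 'q) ring_scheme"
    and S :: "('a, 'r) ring_scheme"
    and R :: "'a set"
    and \<phi> \<psi> :: "'k \<Rightarrow> 'a"
    and n :: nat
  assumes "artin_algebra k S \<phi>"
    and "artin_algebra k (S\<lparr>carrier := R\<rparr>) \<psi>"
    and "excellent_extension S R"
  shows "syzygy_finite (S\<lparr>carrier := R\<rparr>) n \<longleftrightarrow> syzygy_finite S n"
proof -
  obtain B where B: "finite B" "B \<subseteq> carrier S" "left_basis S R B" "right_basis S R B"
      "\<forall>b\<in>B. R #>\<^bsub>S\<^esub> b = b <#\<^bsub>S\<^esub> R"
    and "ring S" "subring R S"
    and summand: "\<And>(M :: 'a umodule) N. fg_module S M \<Longrightarrow> submodule N S M \<Longrightarrow>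
      direct_summand (S\<lparr>carrier := R\<rparr>) M N \<Longrightarrow> direct_summand S M N"
    using assms(3) unfolding excellent_extension_def by blast
  then interpret normal_basis_extension S R B
    by (intro normal_basis_extension.intro normal_basis_extension_axioms.intro) auto
  show ?thesis
    using syzygy_finite_extension[OF assms(1,2) summand] syzygy_finite_subring[OF assms(1,2)] by blast
qed

end
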